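(* Fix a constant $c\ge 6.5$. There is a constant $C$ (depending only on $c$) such that the following holds. Let $\varepsilon\in(0,1)$, let $d,k,B$ be positive integers with $\log^{6.5}d\le B\le \log^{c}d$, and let $U\in\mathbb{C}^{d\times d}$ be a unitary matrix all of whose entries have modulus at most $1$. Then for some positive integer $m\le C\varepsilon^{-2}k\log d\log^2(k\log d)$, provided $k\ge\log^{2.5}m$, the matrix $\Phi$ obtained from the construction in the context, with $\mathcal{A}$ the bounded orthogonal ensemble associated with $U$ having $mB$ rows, satisfies $$\sup_{x\in T_k}\left|\frac{1}{mB}\|\Phi x\|_2^2-\|x\|_2^2\right|\le\varepsilon$$ with probability at least $3/4$.
   Context: Bounded orthogonal ensemble associated with $U$ with $M$ rows: choose $t_1,\dots,t_M\in[d]$ independently and uniformly at random, and let $A\in\mathbb{C}^{M\times d}$ have rows $u_{t_1},\dots,u_{t_M}$, where $u_j$ is the $j$-th row of $U$ (e.g. $U$ the discrete Fourier or Hadamard matrix). Construction: draw $A$ with rows $a_1,\dots,a_{mB}$; for $(b,i)\in[m]\times[B]$ let $h(b,i)=B(b-1)+i$; draw independent uniform signs $\sigma_{b,i}\in\{\pm1\}$ independent of $A$; $\Phi\in\mathbb{C}^{m\times d}$ has $b$-th row $\sum_{i\in[B]}\sigma_{b,i}a_{h(b,i)}$. $T_k=\{x\in\mathbb{C}^d:\ \|x\|_0\le k,\ \|x\|_2\le1\}$, where $\|x\|_0$ is the number of nonzero entries.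
   Formalization: "Unitary" is read as: U divided by the square root of d is unitary (as for Fourier and Hadamard matrices with entries of modulus 1); with U itself unitary, the mean of ‖Φx‖²/(mB) is ‖x‖²/d and the claim fails, e.g. for U = I, k = d large, ε = 1/2. *)

theory Defs
  imports
    "HOL-Probability.Probability"
    "Jordan_Normal_Form.Schur_Decomposition"
begin

unbundle no vec_syntax and no inner_syntax

definition l2_norm :: "complex vec \<Rightarrow> real" where
  "l2_norm x = L2_set (\<lambda>l. cmod (x $ l)) {..<dim_vec x}"

definition l0_norm :: "complex vec \<Rightarrow> nat" where
  "l0_norm x = card {l. l < dim_vec x \<and> x $ l \<noteq> 0}"

definition sparse_vecs :: "nat \<Rightarrow> nat \<Rightarrow> complex vec set" where
  "sparse_vecs d k = {x \<in> carrier_vec d. l0_norm x \<le> k \<and> l2_norm x \<le> 1}"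

definition unitary_mat :: "nat \<Rightarrow> complex mat \<Rightarrow> bool" where
  "unitary_mat d V \<longleftrightarrow> V \<in> carrier_mat d d \<and> mat_adjoint V * V = 1\<^sub>m d"

text \<open>The rows of \<open>U\<close> are sampled without rescaling, so an isometry in expectation requires the
  normalisation of the Fourier and Hadamard matrices with entries of modulus 1: the unitary
  matrix is \<open>(1 / sqrt d) \<cdot>\<^sub>m U\<close>.

  All indices start at 0: rows and columns of a \<open>d \<times> d\<close> matrix are indexed by \<open>{..<d}\<close>.\<close>

definition bounded_orthogonal_ensemble :: "nat \<Rightarrow> complex mat \<Rightarrow> nat \<Rightarrow> complex mat pmf" where
  "bounded_orthogonal_ensemble d U M =
     map_pmf (\<lambda>t. mat\<^sub>r M d (\<lambda>j. Matrix.row U (t j)))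
       (Pi_pmf {..<M} 0 (\<lambda>_. pmf_of_set {..<d}))"

definition uniform_signs :: "nat \<Rightarrow> nat \<Rightarrow> (nat \<times> nat \<Rightarrow> complex) pmf" where
  "uniform_signs m B = Pi_pmf ({..<m} \<times> {..<B}) 0 (\<lambda>_. pmf_of_set {1, -1})"

text \<open>With one-based indices, row \<open>(b, i)\<close> of the sample is row number \<open>B * (b - 1) + i\<close>.\<close>

definition block_index :: "nat \<Rightarrow> nat \<Rightarrow> nat \<Rightarrow> nat" where
  "block_index B b i = B * b + i"

definition signed_block_sums ::
    "nat \<Rightarrow> nat \<Rightarrow> complex mat \<Rightarrow> (nat \<times> nat \<Rightarrow> complex) \<Rightarrow> complex mat" where
  "signed_block_sums m B A \<sigma> =
     mat m (dim_col A) (\<lambda>(b, l). \<Sum>i<B. \<sigma> (b, i) * A $$ (block_index B b i, l))"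

text \<open>The law of \<open>\<Phi>\<close>, for \<open>\<A>\<close> a law of matrices with \<open>m * B\<close> rows; \<open>pair_pmf\<close> makes
  the signs independent of the matrix.\<close>

definition signed_block_construction ::
    "complex mat pmf \<Rightarrow> nat \<Rightarrow> nat \<Rightarrow> complex mat pmf" where
  "signed_block_construction \<A> m B =
     map_pmf (\<lambda>(A, \<sigma>). signed_block_sums m B A \<sigma>) (pair_pmf \<A> (uniform_signs m B))"

text \<open>The supremum in the restricted isometry estimate ranges over a nonempty bounded set of reals,
  so the real-valued \<open>SUP\<close> is the true supremum.\<close>

lemma zero_in_sparse_vecs: "0\<^sub>v d \<in> sparse_vecs d k"
proof -
  have "{l. l < dim_vec (0\<^sub>v d :: complex vec) \<and> (0\<^sub>v d :: complex vec) $ l \<noteq> 0} = {}" by auto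
  hence "l0_norm (0\<^sub>v d) = 0" unfolding l0_norm_def by simp
  thus ?thesis by (simp add: sparse_vecs_def l2_norm_def L2_set_def)
qed

lemma bdd_above_isometry_error:
  assumes "dim_col \<Phi> = d"
  shows "bdd_above ((\<lambda>x. \<bar>1 / real (m * B) * (l2_norm (\<Phi> *\<^sub>v x))\<^sup>2 - (l2_norm x)\<^sup>2\<bar>)
    ` sparse_vecs d k)" (is "bdd_above (?f ` _)")
proof -
  define K where "K = (\<Sum>b<dim_row \<Phi>. \<Sum>l<d. cmod (\<Phi> $$ (b, l)))"
  have "?f x \<le> \<bar>1 / real (m * B)\<bar> * K\<^sup>2 + 1" if x: "x \<in> sparse_vecs d k" for x
  proof -
    have dx: "dim_vec x = d" and n1: "l2_norm x \<le> 1" using x by (auto simp: sparse_vecs_def)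
    have n0: "0 \<le> l2_norm x" by (simp add: l2_norm_def)
    have xl: "cmod (x $ l) \<le> 1" if "l < d" for l
      using member_le_L2_set[of "{..<d}" l "\<lambda>l. cmod (x $ l)"] that n1 dx
      by (simp add: l2_norm_def)
    have row: "cmod ((\<Phi> *\<^sub>v x) $ b) \<le> (\<Sum>l<d. cmod (\<Phi> $$ (b, l)))" if b: "b < dim_row \<Phi>" for b
    proof -
      have "(\<Phi> *\<^sub>v x) $ b = (\<Sum>l<d. \<Phi> $$ (b, l) * x $ l)"
        using b assms dx by (simp add: scalar_prod_def atLeast0LessThan)
      also have "cmod \<dots> \<le> (\<Sum>l<d. cmod (\<Phi> $$ (b, l) * x $ l))" by (rule norm_sum)
      also have "\<dots> \<le> (\<Sum>l<d. cmod (\<Phi> $$ (b, l)))"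
        by (rule sum_mono) (simp add: norm_mult xl mult_left_le)
      finally show ?thesis .
    qed
    have "l2_norm (\<Phi> *\<^sub>v x) \<le> (\<Sum>b<dim_row \<Phi>. cmod ((\<Phi> *\<^sub>v x) $ b))"
      unfolding l2_norm_def
      using L2_set_le_sum[of "{..<dim_row \<Phi>}" "\<lambda>b. cmod ((\<Phi> *\<^sub>v x) $ b)"] by simp
    also have "\<dots> \<le> K" unfolding K_def by (rule sum_mono) (use row in simp)
    finally have "(l2_norm (\<Phi> *\<^sub>v x))\<^sup>2 \<le> K\<^sup>2"
      by (rule power_mono) (simp add: l2_norm_def)
    hence "\<bar>1 / real (m * B)\<bar> * (l2_norm (\<Phi> *\<^sub>v x))\<^sup>2 \<le> \<bar>1 / real (m * B)\<bar> * K\<^sup>2"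
      by (rule mult_left_mono) simp
    moreover have "(l2_norm x)\<^sup>2 \<le> 1" using n0 n1 by (simp add: power_le_one)
    moreover have "?f x
        \<le> \<bar>1 / real (m * B)\<bar> * (l2_norm (\<Phi> *\<^sub>v x))\<^sup>2 + (l2_norm x)\<^sup>2"
      by (rule order_trans[OF abs_triangle_ineq4]) (simp add: abs_mult)
    ultimately show ?thesis by (meson add_mono order_trans)
  qed
  thus ?thesis by (rule bdd_aboveI2)
qed

end

theory Submission
  imports Defs
begin

text \<open>
  The rows of \<open>\<Phi>\<close> are grouped into \<open>m\<close> blocks of \<open>B\<close> rows \<open>A_b\<close> of the sampled matrix. Given the rows, the
  signs turn \<open>\<parallel>\<Phi> x\<parallel>\<^sup>2 - \<parallel>A x\<parallel>\<^sup>2\<close> into a chaos, which is decoupled by a random split of the cells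
  \<open>(b, i)\<close> and then bounded by chaining over sparse vectors. The metric is not the maximum over the
  blocks of \<open>\<parallel>A_b x\<parallel>\<close> but the normalised \<open>L\<^sub>2\<^sub>p\<close> mean over the blocks, with \<open>p\<close> of order \<open>ln (k ln d)\<close>;
  this is enough because \<open>|\<langle>\<phi>_b, x\<rangle>|\<^sup>2 / B\<close> never exceeds \<open>B k \<le> 2 ^ (p - 1)\<close>, and it avoids a factor \<open>ln m\<close>.

  The nets are lattices: a sparse vector is rounded to a multiple of a mesh, and one passes from a mesh
  to the doubled one by rounding the odd coordinates with random signs. The error is a Rademacher sum
  of distinct columns, whose norm in block \<open>b\<close> has \<open>2p\<close>-th moments of order
  \<open>\<parallel>G\<parallel>\<^sub>F + sqrt p * \<parallel>G\<parallel>\<close>, where \<open>G\<close> consists of at most \<open>2 ^ s\<close> columns of \<open>A_b\<close>. For \<open>2 ^ s \<ge> p\<close> the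
  operator norm is harmless, since blocks of \<open>ln d powr 6.5\<close> rows have a restricted isometry upper bound
  with good moments; the few levels with \<open>2 ^ s < p\<close> may lose a factor \<open>sqrt p\<close>. Both this bound and the
  concentration of \<open>\<parallel>A x\<parallel>\<^sup>2\<close> come from symmetrisation and the same chaining, with the supremum over the
  \<open>d\<close> rows of \<open>U\<close> as metric.
\<close>

subsection \<open>Finite averages\<close>

text \<open>The number of blocks is \<open>n * K * p\<^sup>2 / \<epsilon>\<^sup>2\<close> up to
  constants: \<open>n\<close>, of order ln d, is the entropy of one lattice move, and the chaining
  factors must sum to order \<open>p\<close> over as many as \<open>p\<close> levels. So they have
  to stay bounded wherever \<open>2 ^ s \<ge> p\<close>, and this is the obstacle:
  \<open>2 ^ s\<close> columns of a single short block need a squared operator norm of order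
  \<open>B * 2 ^ s / p\<close>. A block deviates from an isometry by order
  \<open>\<Gamma> * sqrt B + \<Gamma>\<^sup>2\<close> with \<open>\<Gamma>\<close> of order
  \<open>p * n * sqrt (2 ^ s)\<close>, so it is enough that \<open>p ^ 4 * n\<^sup>2\<close> is at
  most of order \<open>B\<close>. As \<open>p\<close> and \<open>n\<close> are at most of order ln
  d, this is a sixth power of ln d, which the exponent 6.5 covers. The deviation of the rows and the
  chaos are both bounded in terms of themselves, and the resulting inequalities are solved. All
  randomness is uniform on finite sets, so expectations are finite averages; at moments of order
  \<open>2 * n\<close> a union bound over \<open>3 ^ n\<close> objects costs only a
  constant.\<close>

definition avg :: "'a set \<Rightarrow> ('a \<Rightarrow> real) \<Rightarrow> real" where
  "avg S f = (\<Sum>x\<in>S. f x) / real (card S)"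

lemma avg_cong: "(\<And>x. x \<in> S \<Longrightarrow> f x = g x) \<Longrightarrow> avg S f = avg S g"
  by (simp add: avg_def)

lemma avg_mono: "(\<And>x. x \<in> S \<Longrightarrow> f x \<le> g x) \<Longrightarrow> avg S f \<le> avg S g"
  by (simp add: avg_def divide_right_mono sum_mono)

lemma avg_nonneg: "(\<And>x. x \<in> S \<Longrightarrow> 0 \<le> f x) \<Longrightarrow> 0 \<le> avg S f"
  by (simp add: avg_def sum_nonneg)

lemma avg_const: "finite S \<Longrightarrow> S \<noteq> {} \<Longrightarrow> avg S (\<lambda>_. c) = c"
  by (simp add: avg_def)

lemma avg_add: "avg S (\<lambda>x. f x + g x) = avg S f + avg S g"
  by (simp add: avg_def sum.distrib add_divide_distrib)

lemma avg_diff: "avg S (\<lambda>x. f x - g x) = avg S f - avg S g"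
  by (simp add: avg_def sum_subtractf diff_divide_distrib)

lemma avg_cmult: "avg S (\<lambda>x. c * f x) = c * avg S f"
  by (simp add: avg_def sum_distrib_left)

lemma avg_sum: "avg S (\<lambda>x. \<Sum>i\<in>I. f i x) = (\<Sum>i\<in>I. avg S (f i))"
  unfolding avg_def by (subst sum.swap) (simp add: sum_divide_distrib)

lemma avg_swap: "avg S (\<lambda>x. avg T (f x)) = avg T (\<lambda>y. avg S (\<lambda>x. f x y))"
  unfolding avg_def sum_divide_distrib[symmetric]
  by (subst sum.swap) (simp add: sum_divide_distrib[symmetric] mult.commute)

lemma avg_Times: "avg (S \<times> T) f = avg S (\<lambda>x. avg T (\<lambda>y. f (x, y)))"
  unfolding avg_def card_cartesian_product sum_divide_distrib[symmetric]
  by (simp add: sum.cartesian_product mult.commute)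

lemma avg_reindex: "bij_betw h S T \<Longrightarrow> avg T f = avg S (\<lambda>x. f (h x))"
  unfolding avg_def by (simp add: sum.reindex_bij_betw bij_betw_same_card)

lemma avg_attained:
  assumes "finite S" "S \<noteq> {}" shows "\<exists>x\<in>S. f x \<le> avg S f"
proof (rule ccontr)
  assume "\<not> ?thesis"
  hence "avg S f < f x" if "x \<in> S" for x using that by force
  hence "(\<Sum>x\<in>S. avg S f) < (\<Sum>x\<in>S. f x)" using assms by (intro sum_strict_mono) auto
  thus False using assms by (simp add: avg_def)
qed

lemma avg_markov:
  assumes "finite S" "\<And>x. x \<in> S \<Longrightarrow> 0 \<le> f x" "0 < a"
  shows "real (card {x\<in>S. a < f x}) \<le> avg S f / a * real (card S)"
proof (cases "S = {}")
  case False
  have "a * real (card {x\<in>S. a < f x}) = (\<Sum>x\<in>{x\<in>S. a < f x}. a)" by simp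
  also have "\<dots> \<le> (\<Sum>x\<in>{x\<in>S. a < f x}. f x)" by (rule sum_mono) auto
  also have "\<dots> \<le> (\<Sum>x\<in>S. f x)" using assms by (intro sum_mono2) auto
  also have "\<dots> = avg S f * real (card S)" using False assms by (simp add: avg_def)
  finally show ?thesis using assms(3) by (simp add: field_simps)
qed simp

section \<open>Convexity and power means\<close>

lemma convex_on_power: "convex_on {0..} (\<lambda>x::real. x ^ k)"
proof (cases "even k")
  case True
  show ?thesis by (rule convex_on_subset[OF convex_power_even[OF True]]) auto
qed (rule convex_power_odd)

text \<open>Convexity of the power with weights \<open>a / (a + b)\<close> and
  \<open>b / (a + b)\<close>, applied pointwise to \<open>f / a\<close> and \<open>g / b\<close>.
  Bounds of the form \<open>c * a ^ k\<close> keep the triangle inequality free of roots, and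
  \<open>c\<close> carries the normalisation.\<close>

lemma minkowski_sum_power:
  fixes f g :: "'a \<Rightarrow> real"
  assumes f: "\<And>x. x \<in> S \<Longrightarrow> 0 \<le> f x" and g: "\<And>x. x \<in> S \<Longrightarrow> 0 \<le> g x"
    and a: "0 < a" and b: "0 < b"
    and fa: "(\<Sum>x\<in>S. f x ^ k) \<le> c * a ^ k" and gb: "(\<Sum>x\<in>S. g x ^ k) \<le> c * b ^ k"
  shows "(\<Sum>x\<in>S. (f x + g x) ^ k) \<le> c * (a + b) ^ k"
proof -
  have pt: "(f x + g x) ^ k \<le> (a + b) ^ k * (a / (a + b) * (f x / a) ^ k + b / (a + b) * (g x / b) ^ k)"
    if "x \<in> S" for x
  proof -
    have e: "1 - b / (a+b) = a / (a+b)" using a b by (simp add: field_simps)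
    have "0 \<le> b / (a+b)" "b / (a+b) \<le> 1" "f x / a \<in> {0..}" "g x / b \<in> {0..}"
      using a b f[OF that] g[OF that] by auto
    from convex_onD[OF convex_on_power this, of k, unfolded e real_scaleR_def]
    have "(a / (a+b) * (f x / a) + b / (a+b) * (g x / b)) ^ k
        \<le> a / (a + b) * (f x / a) ^ k + b / (a + b) * (g x / b) ^ k" .
    moreover have "a / (a+b) * (f x / a) + b / (a+b) * (g x / b) = (f x + g x) / (a + b)"
      using a b by (simp add: add_divide_distrib)
    ultimately have "((f x + g x) / (a + b)) ^ k \<le> a / (a + b) * (f x / a) ^ k + b / (a + b) * (g x / b) ^ k"
      by simp
    hence "(a+b)^k * ((f x + g x) / (a + b)) ^ k \<le> (a+b)^k * (a / (a + b) * (f x / a) ^ k + b / (a + b) * (g x / b) ^ k)"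
      using a b by (intro mult_left_mono) auto
    thus ?thesis using a b by (simp add: power_divide)
  qed
  have "(\<Sum>x\<in>S. (f x + g x) ^ k) \<le>
      (\<Sum>x\<in>S. (a + b) ^ k * (a / (a + b) * (f x / a) ^ k + b / (a + b) * (g x / b) ^ k))"
    by (rule sum_mono) (rule pt)
  also have "\<dots> = (a + b) ^ k * (a / (a + b) * ((\<Sum>x\<in>S. f x ^ k) / a ^ k) + b / (a + b) * ((\<Sum>x\<in>S. g x ^ k) / b ^ k))"
    unfolding sum_distrib_left[symmetric] sum.distrib power_divide sum_divide_distrib ..
  also have "\<dots> \<le> (a + b) ^ k * (a / (a + b) * c + b / (a + b) * c)"
    using a b fa gb by (intro mult_left_mono add_mono) (auto simp: divide_le_eq)
  also have "a / (a + b) * c + b / (a + b) * c = (a / (a + b) + b / (a + b)) * c"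
    by (simp add: distrib_right)
  also have "a / (a + b) + b / (a + b) = 1"
    using a b by (simp add: add_divide_distrib[symmetric])
  also have "(a + b) ^ k * (1 * c) = c * (a + b) ^ k" by simp
  finally show ?thesis .
qed

lemma minkowski_avg:
  fixes f g :: "'a \<Rightarrow> real"
  assumes "finite S" "S \<noteq> {}" "\<And>x. x \<in> S \<Longrightarrow> 0 \<le> f x" "\<And>x. x \<in> S \<Longrightarrow> 0 \<le> g x" "0 < a" "0 < b"
    and "avg S (\<lambda>x. f x ^ k) \<le> a ^ k" "avg S (\<lambda>x. g x ^ k) \<le> b ^ k"
  shows "avg S (\<lambda>x. (f x + g x) ^ k) \<le> (a + b) ^ k"
proof -
  have c: "real (card S) > 0" using assms by (simp add: card_gt_0_iff)
  show ?thesis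
    using minkowski_sum_power[of S f g a b k "real (card S)"] assms c
    unfolding avg_def by (simp add: field_simps)
qed

lemma minkowski_avg_sum:
  fixes f :: "nat \<Rightarrow> 'a \<Rightarrow> real"
  assumes S: "finite S" "S \<noteq> {}" and f: "\<And>s x. x \<in> S \<Longrightarrow> 0 \<le> f s x" and a: "\<And>s. 0 < a s"
    and le: "\<And>s. s < N \<Longrightarrow> avg S (\<lambda>x. f s x ^ k) \<le> a s ^ k" and N: "0 < N"
  shows "avg S (\<lambda>x. (\<Sum>s<N. f s x) ^ k) \<le> (\<Sum>s<N. a s) ^ k"
  using N le
proof (induction N rule: nat_induct_non_zero)
  case (Suc N)
  have "0 < (\<Sum>s<N. a s)" using Suc.hyps a by (intro sum_pos) auto
  thus ?case using minkowski_avg[of S "\<lambda>x. \<Sum>s<N. f s x" "f N" "\<Sum>s<N. a s" "a N" k] Suc S f a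
    by (simp add: sum_nonneg)
qed simp

lemma avg_power_le:
  fixes f :: "'a \<Rightarrow> real"
  assumes S: "finite S" "S \<noteq> {}" and f: "\<And>x. x \<in> S \<Longrightarrow> 0 \<le> f x"
  shows "avg S f ^ k \<le> avg S (\<lambda>x. f x ^ k)"
proof -
  have c: "real (card S) > 0" using S by (simp add: card_gt_0_iff)
  have "(\<Sum>i\<in>S. (1 / real (card S)) *\<^sub>R f i) ^ k \<le> (\<Sum>i\<in>S. 1 / real (card S) * (f i) ^ k)"
    using S c f by (intro convex_on_sum[OF _ _ convex_on_power]) auto
  thus ?thesis unfolding avg_def by (simp add: sum_divide_distrib)
qed

lemma avg_le_of_power:
  fixes f :: "'a \<Rightarrow> real"
  assumes "finite S" "S \<noteq> {}" "\<And>x. x \<in> S \<Longrightarrow> 0 \<le> f x" "0 \<le> a" "0 < k"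
    and "avg S (\<lambda>x. f x ^ k) \<le> a ^ k"
  shows "avg S f \<le> a"
proof (rule power_le_imp_le_base)
  show "avg S f ^ Suc (k - 1) \<le> a ^ Suc (k - 1)"
    using avg_power_le[of S f k] assms by simp
qed (use assms in simp)

subsection \<open>Rademacher sums\<close>

text \<open>A sign vector is encoded by the set of its positive coordinates, so independent uniform
  signs on \<open>I\<close> become an average over \<open>Pow I\<close>.\<close>

definition eps :: "'a set \<Rightarrow> 'a \<Rightarrow> real" where
  "eps X i = (if i \<in> X then 1 else - 1)"

lemma eps_sq [simp]: "eps X i * eps X i = 1" by (simp add: eps_def)
lemma abs_eps [simp]: "\<bar>eps X i\<bar> = 1" by (simp add: eps_def)

lemma avg_Pow_insert:
  assumes "finite I" "j \<notin> I"
  shows "avg (Pow (insert j I)) f = avg (Pow I) (\<lambda>X. (f X + f (insert j X)) / 2)"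
proof -
  have "inj_on (insert j) (Pow I)" using assms by (auto simp: inj_on_def)
  moreover have "Pow I \<inter> insert j ` Pow I = {}" using assms by auto
  ultimately have "sum f (Pow (insert j I)) = sum f (Pow I) + sum (\<lambda>X. f (insert j X)) (Pow I)"
    using assms by (simp add: Pow_insert sum.union_disjoint sum.reindex)
  thus ?thesis using assms
    by (simp add: avg_def card_Pow sum_divide_distrib[symmetric] sum.distrib)
qed

lemma avg_Pow_const [simp]: "finite I \<Longrightarrow> avg (Pow I) (\<lambda>_. c) = c"
  by (rule avg_const) auto

lemma avg_Pow_compl: "avg (Pow I) f = avg (Pow I) (\<lambda>X. f (I - X))"
  by (rule avg_reindex, rule bij_betwI[where g = "\<lambda>X. I - X"]) auto

lemma avg_Pow_union:
  assumes "I \<inter> J = {}"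
  shows "avg (Pow (I \<union> J)) f = avg (Pow I) (\<lambda>X. avg (Pow J) (\<lambda>Y. f (X \<union> Y)))"
proof -
  have "bij_betw (\<lambda>(X, Y). X \<union> Y) (Pow I \<times> Pow J) (Pow (I \<union> J))"
    using assms by (intro bij_betwI[where g = "\<lambda>Z. (Z \<inter> I, Z \<inter> J)"]) auto
  from avg_reindex[OF this, of f] show ?thesis by (simp add: avg_Times)
qed

section \<open>Moments of positive semidefinite forms in random signs\<close>

lemma abs_power_diff_le:
  fixes x y :: real
  assumes "0 \<le> x" "0 \<le> y"
  shows "\<bar>x ^ n - y ^ n\<bar> \<le> real n * \<bar>x - y\<bar> * (x ^ (n - 1) + y ^ (n - 1))"
proof -
  have "x ^ n - y ^ n = (x - y) * (\<Sum>i<n. y ^ (n - Suc i) * x ^ i)" by (rule power_diff_sumr2)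
  also have "\<bar>\<dots>\<bar> \<le> \<bar>x - y\<bar> * (\<Sum>i<n. \<bar>y ^ (n - Suc i) * x ^ i\<bar>)"
    unfolding abs_mult[of "x - y"] by (intro mult_left_mono sum_abs abs_ge_zero)
  also have "\<dots> \<le> \<bar>x - y\<bar> * (\<Sum>i<n. x ^ (n - 1) + y ^ (n - 1))"
  proof (intro mult_left_mono sum_mono)
    fix i assume "i \<in> {..<n}"
    hence i: "i < n" by simp
    have "y ^ (n - Suc i) * x ^ i \<le> max x y ^ (n - Suc i) * max x y ^ i"
      using assms by (intro mult_mono power_mono) auto
    also have "\<dots> = max x y ^ (n - 1)" using i by (simp add: power_add[symmetric])
    also have "\<dots> \<le> x ^ (n - 1) + y ^ (n - 1)" using assms by (simp add: max_def)
    finally show "\<bar>y ^ (n - Suc i) * x ^ i\<bar> \<le> x ^ (n - 1) + y ^ (n - 1)" using assms by simp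
  qed auto
  finally show ?thesis by (simp add: mult.commute mult.left_commute)
qed

text \<open>Integration by parts in one sign, whose two values turn a quadratic form into \<open>r + 2 * a\<close> and \<open>r - 2 * a\<close>.\<close>

lemma rademacher_one_sign:
  fixes r a h :: real
  assumes "0 \<le> r + 2 * a" "0 \<le> r - 2 * a"
  shows "(a + h) * (r + 2 * a) ^ n - (a - h) * (r - 2 * a) ^ n
    \<le> h * ((r + 2 * a) ^ n + (r - 2 * a) ^ n)
      + 8 * real n * (((a + h)\<^sup>2 + h\<^sup>2) * (r + 2 * a) ^ (n - 1) + ((a - h)\<^sup>2 + h\<^sup>2) * (r - 2 * a) ^ (n - 1))"
proof -
  let ?x = "r + 2 * a" and ?y = "r - 2 * a"
  have "a * (?x ^ n - ?y ^ n) \<le> \<bar>a\<bar> * \<bar>?x ^ n - ?y ^ n\<bar>"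
    by (metis abs_ge_self abs_mult)
  also have "\<dots> \<le> \<bar>a\<bar> * (real n * \<bar>?x - ?y\<bar> * (?x ^ (n - 1) + ?y ^ (n - 1)))"
    by (intro mult_left_mono abs_power_diff_le assms) auto
  also have "\<dots> = 4 * real n * (a\<^sup>2 * ?x ^ (n - 1) + a\<^sup>2 * ?y ^ (n - 1))"
  proof -
    have "\<bar>?x - ?y\<bar> = 4 * \<bar>a\<bar>" by simp
    moreover have "\<bar>a\<bar> * (real n * (4 * \<bar>a\<bar>) * c) = 4 * real n * ((\<bar>a\<bar> * \<bar>a\<bar>) * c)" for c
      by (simp only: mult_ac)
    ultimately show ?thesis by (simp only: power2_eq_square abs_mult_self_eq distrib_left)
  qed
  \<comment> \<open>The terms are rewritten through \<open>a + h\<close> and \<open>a - h\<close>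
    because these are the two values of the linear form that multiplies the sign; only its squares
    can be summed over all signs.\<close>
  also have "\<dots> \<le> 4 * real n * ((2 * (a + h)\<^sup>2 + 2 * h\<^sup>2) * ?x ^ (n - 1) + (2 * (a - h)\<^sup>2 + 2 * h\<^sup>2) * ?y ^ (n - 1))"
  proof (intro mult_left_mono add_mono mult_right_mono)
    have "0 \<le> (a + 2 * h)\<^sup>2" "0 \<le> (a - 2 * h)\<^sup>2" by auto
    thus "a\<^sup>2 \<le> 2 * (a + h)\<^sup>2 + 2 * h\<^sup>2" "a\<^sup>2 \<le> 2 * (a - h)\<^sup>2 + 2 * h\<^sup>2"
      by (simp_all add: power2_eq_square algebra_simps)
  qed (use assms in auto)
  finally show ?thesis by (simp add: algebra_simps)
qed

lemma quad_form_insert: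
  fixes H :: "'i \<Rightarrow> 'i \<Rightarrow> real"
  assumes "finite J" "j \<notin> J" "\<And>i k. H i k = H k i"
  shows "(\<Sum>i\<in>insert j J. \<Sum>k\<in>insert j J. x i * x k * H i k) =
    (\<Sum>i\<in>J. \<Sum>k\<in>J. x i * x k * H i k) + 2 * x j * (\<Sum>i\<in>J. x i * H j i) + x j * x j * H j j"
proof -
  have 1: "(\<Sum>k\<in>J. x j * x k * H j k) = x j * (\<Sum>i\<in>J. x i * H j i)"
    by (simp add: sum_distrib_left mult.assoc)
  have 2: "(\<Sum>i\<in>J. x i * x j * H i j) = x j * (\<Sum>i\<in>J. x i * H j i)"
    by (simp add: sum_distrib_left assms(3)[of _ j] mult_ac)
  show ?thesis using assms(1,2) by (simp add: sum.distrib 1 2)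
qed

text \<open>In operator terms |Hx|^2 is at most W times <x, Hx> when 0 <= H <= W, here without a
  square root of H. Positivity is tested at x - Hx/W: the cross terms contribute -2|Hx|^2/W, the
  last term at most |Hx|^2/W.\<close>

lemma psd_image_bound:
  fixes H :: "'i \<Rightarrow> 'i \<Rightarrow> real"
  assumes sym: "\<And>i k. H i k = H k i" and W: "0 < W"
    and psd: "\<And>c. 0 \<le> (\<Sum>i\<in>I. \<Sum>k\<in>I. c i * c k * H i k)"
    and le: "\<And>c. (\<Sum>i\<in>I. \<Sum>k\<in>I. c i * c k * H i k) \<le> W * (\<Sum>i\<in>I. (c i)\<^sup>2)"
  shows "(\<Sum>j\<in>I. (\<Sum>i\<in>I. x i * H j i)\<^sup>2) \<le> W * (\<Sum>i\<in>I. \<Sum>k\<in>I. x i * x k * H i k)"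
proof -
  define y where "y j = (\<Sum>i\<in>I. x i * H j i)" for j
  let ?Q = "\<lambda>c. \<Sum>i\<in>I. \<Sum>k\<in>I. c i * c k * H i k"
  define N where "N = (\<Sum>j\<in>I. (y j)\<^sup>2)"
  have b1: "(\<Sum>i\<in>I. \<Sum>k\<in>I. y i * x k * H i k) = N"
    by (simp add: N_def y_def power2_eq_square sum_distrib_left mult.assoc)
  have b2: "(\<Sum>i\<in>I. \<Sum>k\<in>I. x i * y k * H i k) = N"
    by (subst sum.swap, subst sym) (simp add: b1[symmetric] mult_ac)
  have "?Q (\<lambda>i. x i - y i / W) = ?Q x - (\<Sum>i\<in>I. \<Sum>k\<in>I. y i * x k * H i k) / W
      - (\<Sum>i\<in>I. \<Sum>k\<in>I. x i * y k * H i k) / W + ?Q y / W\<^sup>2"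
  proof -
    have "(x i - y i / W) * (x k - y k / W) * H i k = x i * x k * H i k - y i * x k * H i k / W
       - x i * y k * H i k / W + y i * y k * H i k / W\<^sup>2" for i k
      by (simp add: divide_inverse power2_eq_square algebra_simps)
    thus ?thesis by (simp only: sum.distrib sum_subtractf sum_divide_distrib)
  qed
  also have "\<dots> = ?Q x - 2 * N / W + ?Q y / W\<^sup>2" unfolding b1 b2 by simp
  also have "\<dots> \<le> ?Q x - 2 * N / W + W * N / W\<^sup>2"
    using le[of y] by (simp add: N_def divide_right_mono)
  also have "\<dots> = ?Q x - N / W" using W by (simp add: power2_eq_square)
  finally have "0 \<le> ?Q x - N / W"
    using psd[of "\<lambda>i. x i - y i / W"] by linarith
  thus ?thesis using W by (simp add: N_def y_def field_simps)
qed

text \<open>The form is the sum over j of the sign at j times \<open>c j\<close>, and the two values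
  of that sign are paired. The variation of \<open>f ^ n\<close> in the sign gives the squares of
  \<open>c j\<close>, whose sum is at most \<open>W * f\<close> by \<open>psd_image_bound\<close>;
  the diagonal entries have sum at most \<open>T\<close> and square sum at most
  \<open>W * T\<close>. So the right-hand side consists of moments of \<open>f\<close>
  again.\<close>

lemma rademacher_quadratic_recursion:
  fixes H :: "'i \<Rightarrow> 'i \<Rightarrow> real"
  defines "f \<equiv> \<lambda>I X. \<Sum>i\<in>I. \<Sum>k\<in>I. eps X i * eps X k * H i k"
  assumes I: "finite I" and sym: "\<And>i k. H i k = H k i" and W: "0 < W"
    and psd: "\<And>c. 0 \<le> (\<Sum>i\<in>I. \<Sum>k\<in>I. c i * c k * H i k)"
    and le: "\<And>c. (\<Sum>i\<in>I. \<Sum>k\<in>I. c i * c k * H i k) \<le> W * (\<Sum>i\<in>I. (c i)\<^sup>2)"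
    and T: "(\<Sum>i\<in>I. H i i) \<le> T" and diag: "\<And>i. i \<in> I \<Longrightarrow> 0 \<le> H i i" "\<And>i. i \<in> I \<Longrightarrow> H i i \<le> W"
  shows "avg (Pow I) (\<lambda>X. f I X ^ Suc n) \<le> 
    avg (Pow I) (\<lambda>X. T * f I X ^ n + 8 * real n * ((W * f I X + W * T) * f I X ^ (n - 1)))"
proof -
  define c where "c j X = (\<Sum>i\<in>I. eps X i * H j i)" for j X
  have f0: "0 \<le> f I X" for X unfolding f_def by (rule psd)
  define F where "F j X = eps X j * c j X * f I X ^ n" for j X
  define G where "G j X = H j j * f I X ^ n + 8 * real n * (((c j X)\<^sup>2 + (H j j)\<^sup>2) * f I X ^ (n - 1))" for j X
  have FG: "avg (Pow I) (F j) \<le> avg (Pow I) (G j)" if j: "j \<in> I" for j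
  proof -
    define J where "J = I - {j}"
    have J: "finite J" "j \<notin> J" "I = insert j J" using I j by (auto simp: J_def)
    have "F j X + F j (insert j X) \<le> G j X + G j (insert j X)" if X: "X \<in> Pow J" for X
    proof -
      define a where "a = (\<Sum>i\<in>J. eps X i * H j i)"
      define r where "r = f J X + H j j"
      have jX: "j \<notin> X" using X J by auto
      have e: "eps (insert j X) i = eps X i" if "i \<in> J" for i using that J by (auto simp: eps_def)
      have a': "(\<Sum>i\<in>J. eps (insert j X) i * H j i) = a"
        unfolding a_def by (rule sum.cong) (auto simp: e)
      have f': "f J (insert j X) = f J X"
        unfolding f_def by (intro sum.cong) (auto simp: e)
      have f1: "f I X = r - 2 * a" "f I (insert j X) = r + 2 * a"
        using quad_form_insert[OF J(1,2) sym, where x = "eps X"]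
          quad_form_insert[OF J(1,2) sym, where x = "eps (insert j X)"] jX f' a'
        unfolding J(3) r_def f_def a_def by (simp_all add: eps_def)
      have c1: "c j X = a - H j j" "c j (insert j X) = a + H j j"
        using J a' jX by (simp_all add: c_def a_def eps_def)
      have F1: "F j X + F j (insert j X) = (a + H j j) * (r + 2 * a) ^ n - (a - H j j) * (r - 2 * a) ^ n"
        unfolding F_def f1 c1 using jX by (simp add: eps_def left_diff_distrib)
      have "F j X + F j (insert j X) \<le> G j X + G j (insert j X)"
      proof -
        have "0 \<le> r + 2 * a" "0 \<le> r - 2 * a"
          using f0[of X] f0[of "insert j X"] unfolding f1 by auto
        from rademacher_one_sign[OF this, of "H j j" n] show ?thesis
          unfolding F1 unfolding G_def f1 c1 distrib_left by linarith
      qed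
      thus ?thesis .
    qed
    thus ?thesis unfolding J(3) avg_Pow_insert[OF J(1,2)]
      by (intro avg_mono divide_right_mono) auto
  qed
  have f_eq: "f I X = (\<Sum>j\<in>I. eps X j * c j X)" for X
    by (simp add: f_def c_def sum_distrib_left mult.assoc)
  have "avg (Pow I) (\<lambda>X. f I X ^ Suc n) = avg (Pow I) (\<lambda>X. \<Sum>j\<in>I. F j X)"
    unfolding F_def sum_distrib_right[symmetric] f_eq[symmetric] by simp
  also have "\<dots> \<le> avg (Pow I) (\<lambda>X. \<Sum>j\<in>I. G j X)"
    unfolding avg_sum by (intro sum_mono FG)
  also have "\<dots> \<le> avg (Pow I) (\<lambda>X. T * f I X ^ n + 8 * real n * ((W * f I X + W * T) * f I X ^ (n - 1)))"
  proof (rule avg_mono)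
    fix X
    have h2: "(\<Sum>j\<in>I. (H j j)\<^sup>2) \<le> W * T"
    proof -
      have "(\<Sum>j\<in>I. (H j j)\<^sup>2) \<le> (\<Sum>j\<in>I. W * H j j)"
        unfolding power2_eq_square by (intro sum_mono mult_right_mono diag)
      also have "\<dots> \<le> W * T" using T W by (simp add: sum_distrib_left[symmetric])
      finally show ?thesis .
    qed
    have c2: "(\<Sum>j\<in>I. (c j X)\<^sup>2) \<le> W * f I X"
      unfolding c_def f_def by (rule psd_image_bound[OF sym W psd le])
    have "(\<Sum>j\<in>I. G j X) = (\<Sum>j\<in>I. H j j) * f I X ^ n
        + 8 * real n * (((\<Sum>j\<in>I. (c j X)\<^sup>2) + (\<Sum>j\<in>I. (H j j)\<^sup>2)) * f I X ^ (n - 1))"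
      unfolding G_def by (simp only: sum.distrib sum_distrib_left sum_distrib_right distrib_right distrib_left)
    also have "\<dots> \<le> T * f I X ^ n + 8 * real n * ((W * f I X + W * T) * f I X ^ (n - 1))"
      using f0[of X] T h2 c2 by (intro add_mono mult_mono mult_left_mono mult_right_mono) auto
    finally show "(\<Sum>j\<in>I. G j X) \<le> \<dots>" .
  qed
  finally show ?thesis .
qed

text \<open>The recursion bounds a moment by the two preceding ones with a coefficient that grows
  like \<open>n * W\<close>. Only moments up to order \<open>p\<close> are involved, so a single
  \<open>K\<close> absorbs it: \<open>T * K + 16 * p * W * K \<le> K * K\<close>.\<close>

lemma rademacher_quadratic_moment:
  fixes H :: "'i \<Rightarrow> 'i \<Rightarrow> real"
  assumes I: "finite I" and sym: "\<And>i k. H i k = H k i" and W: "0 < W"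
    and psd: "\<And>c. 0 \<le> (\<Sum>i\<in>I. \<Sum>k\<in>I. c i * c k * H i k)"
    and le: "\<And>c. (\<Sum>i\<in>I. \<Sum>k\<in>I. c i * c k * H i k) \<le> W * (\<Sum>i\<in>I. (c i)\<^sup>2)"
    and T: "(\<Sum>i\<in>I. H i i) \<le> T"
  shows "avg (Pow I) (\<lambda>X. (\<Sum>i\<in>I. \<Sum>k\<in>I. eps X i * eps X k * H i k) ^ p) \<le> (2 * T + 16 * real p * W) ^ p"
proof -
  define f where "f X = (\<Sum>i\<in>I. \<Sum>k\<in>I. eps X i * eps X k * H i k)" for X
  define K where "K = 2 * T + 16 * real p * W"
  have dg: "(\<Sum>i\<in>I. \<Sum>k\<in>I. (if i = j then 1 else 0) * (if k = j then 1 else 0) * H i k) = H j j"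
    if "j \<in> I" for j
  proof -
    have "(\<Sum>i\<in>I. \<Sum>k\<in>I. (if i = j then 1 else 0) * (if k = j then 1 else 0) * H i k)
        = (\<Sum>i\<in>I. if i = j then (\<Sum>k\<in>I. if k = j then H i k else 0) else 0)"
      by (intro sum.cong refl) (simp, intro impI sum.cong refl, simp)
    thus ?thesis using I that by simp
  qed
  have d0: "0 \<le> H j j" and dW: "H j j \<le> W" if "j \<in> I" for j
  proof -
    show "0 \<le> H j j" using psd[of "\<lambda>i. if i = j then 1 else 0"] dg[OF that] by simp
    have "(\<Sum>i\<in>I. (if i = j then 1 else 0 :: real)\<^sup>2) = (\<Sum>i\<in>I. if i = j then 1 else 0)"
      by (intro sum.cong) auto
    thus "H j j \<le> W" using le[of "\<lambda>i. if i = j then 1 else 0"] dg[OF that] I that by simp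
  qed
  have T0: "0 \<le> T" using T d0 by (meson order_trans sum_nonneg)
  have K0: "0 \<le> K" "T \<le> K" using T0 W by (auto simp: K_def)
  have rec: "avg (Pow I) (\<lambda>X. f X ^ Suc n) \<le>
      T * avg (Pow I) (\<lambda>X. f X ^ n) + 8 * real n * (W * avg (Pow I) (\<lambda>X. f X ^ n) + W * T * avg (Pow I) (\<lambda>X. f X ^ (n - 1)))" for n
  proof -
    \<comment> \<open>For \<open>n = 0\<close> the exponent \<open>n - 1\<close> is truncated, which
      the factor \<open>n\<close> makes harmless.\<close>
    have "T * f X ^ n + 8 * real n * ((W * f X + W * T) * f X ^ (n - 1))
      = T * f X ^ n + 8 * real n * (W * f X ^ n + W * T * f X ^ (n - 1))" for X
      by (cases n) (simp_all add: algebra_simps)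
    moreover have "avg (Pow I) (\<lambda>X. f X ^ Suc n) \<le>
      avg (Pow I) (\<lambda>X. T * f X ^ n + 8 * real n * ((W * f X + W * T) * f X ^ (n - 1)))"
      unfolding f_def using rademacher_quadratic_recursion[OF I sym W psd le T d0 dW] .
    ultimately have "avg (Pow I) (\<lambda>X. f X ^ Suc n) \<le>
      avg (Pow I) (\<lambda>X. T * f X ^ n + 8 * real n * (W * f X ^ n + W * T * f X ^ (n - 1)))" by presburger
    thus ?thesis by (simp only: avg_add avg_cmult)
  qed
  have "n \<le> p \<Longrightarrow> avg (Pow I) (\<lambda>X. f X ^ n) \<le> K ^ n" for n
  proof (induction n rule: less_induct)
    case (less n)
    show ?case
    proof (cases n)
      case 0
      thus ?thesis using I by simp
    next
      case (Suc k)
      have A: "avg (Pow I) (\<lambda>X. f X ^ k) \<le> K ^ k" "avg (Pow I) (\<lambda>X. f X ^ (k - 1)) \<le> K ^ (k - 1)"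
        using less Suc by auto
      have "avg (Pow I) (\<lambda>X. f X ^ Suc k) \<le> T * K ^ k + 8 * real k * (W * K ^ k + W * T * K ^ (k - 1))"
        by (rule order_trans[OF rec]) (use A T0 W in \<open>intro add_mono mult_left_mono; simp\<close>)
      also have "\<dots> \<le> K ^ Suc k"
      proof (cases k)
        case 0
        thus ?thesis using K0 by simp
      next
        case k: (Suc l)
        have kp: "real k \<le> real p" using less Suc by simp
        have "T * K + 8 * real k * (W * K + W * T) \<le> T * K + 8 * real p * (W * K + W * K)"
          using kp K0 T0 W by (intro add_mono mult_mono mult_left_mono) auto
        also have "\<dots> \<le> (2 * T + 16 * real p * W) * K"
          using K0 T0 by (simp add: algebra_simps)
        finally have "T * K + 8 * real k * (W * K + W * T) \<le> K * K" by (simp add: K_def)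
        hence "(T * K + 8 * real k * (W * K + W * T)) * K ^ l \<le> K * K * K ^ l"
          using K0 by (intro mult_right_mono) auto
        thus ?thesis by (simp add: k algebra_simps)
      qed
      finally show ?thesis by (simp add: Suc)
    qed
  qed
  thus ?thesis unfolding f_def K_def by simp
qed

lemma norm_sum_sq_expand:
  fixes g :: "'i \<Rightarrow> complex" and c :: "'i \<Rightarrow> real"
  shows "(cmod (\<Sum>i\<in>I. c i * g i))\<^sup>2 = (\<Sum>i\<in>I. \<Sum>k\<in>I. c i * c k * Re (g i * cnj (g k)))"
proof -
  have "complex_of_real ((cmod (\<Sum>i\<in>I. c i * g i))\<^sup>2) = (\<Sum>i\<in>I. c i * g i) * cnj (\<Sum>k\<in>I. c k * g k)"
    by (rule complex_norm_square)
  also have "\<dots> = (\<Sum>i\<in>I. \<Sum>k\<in>I. complex_of_real (c i * c k) * (g i * cnj (g k)))"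
    by (simp add: sum_product mult_ac)
  finally have "(cmod (\<Sum>i\<in>I. c i * g i))\<^sup>2 = Re (\<Sum>i\<in>I. \<Sum>k\<in>I. complex_of_real (c i * c k) * (g i * cnj (g k)))"
    by (metis Re_complex_of_real)
  thus ?thesis by (simp del: of_real_mult)
qed

text \<open>Reduction to the real Gram matrix \<open>H\<close> of the columns: its trace is the
  squared Frobenius norm, at most \<open>T\<close>, and its operator norm is at most
  \<open>W\<close>.\<close>

lemma rademacher_vector_moment:
  fixes g :: "'r \<Rightarrow> 'i \<Rightarrow> complex"
  assumes I: "finite I" and W: "0 < W"
    and le: "\<And>c. (\<Sum>r\<in>R. (cmod (\<Sum>i\<in>I. complex_of_real (c i) * g r i))\<^sup>2) \<le> W * (\<Sum>i\<in>I. (c i)\<^sup>2)"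
    and T: "(\<Sum>r\<in>R. \<Sum>i\<in>I. (cmod (g r i))\<^sup>2) \<le> T"
  shows "avg (Pow I) (\<lambda>X. (\<Sum>r\<in>R. (cmod (\<Sum>i\<in>I. eps X i * g r i))\<^sup>2) ^ p) \<le> (2 * T + 16 * real p * W) ^ p"
proof -
  define H where "H i k = (\<Sum>r\<in>R. Re (g r i * cnj (g r k)))" for i k
  have Q: "(\<Sum>r\<in>R. (cmod (\<Sum>i\<in>I. complex_of_real (c i) * g r i))\<^sup>2) = (\<Sum>i\<in>I. \<Sum>k\<in>I. c i * c k * H i k)" for c
  proof -
    have "(\<Sum>r\<in>R. (cmod (\<Sum>i\<in>I. complex_of_real (c i) * g r i))\<^sup>2)
        = (\<Sum>r\<in>R. \<Sum>i\<in>I. \<Sum>k\<in>I. c i * c k * Re (g r i * cnj (g r k)))"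
      by (simp only: norm_sum_sq_expand)
    also have "\<dots> = (\<Sum>i\<in>I. \<Sum>r\<in>R. \<Sum>k\<in>I. c i * c k * Re (g r i * cnj (g r k)))" by (rule sum.swap)
    also have "\<dots> = (\<Sum>i\<in>I. \<Sum>k\<in>I. \<Sum>r\<in>R. c i * c k * Re (g r i * cnj (g r k)))"
      by (rule sum.cong[OF refl], rule sum.swap)
    finally show ?thesis unfolding H_def sum_distrib_left .
  qed
  have sym: "H i k = H k i" for i k unfolding H_def by (simp add: mult.commute)
  have psd: "0 \<le> (\<Sum>i\<in>I. \<Sum>k\<in>I. c i * c k * H i k)" for c
    unfolding Q[symmetric] by (simp add: sum_nonneg)
  have "(\<Sum>i\<in>I. H i i) = (\<Sum>r\<in>R. \<Sum>i\<in>I. (cmod (g r i))\<^sup>2)"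
    unfolding H_def by (subst sum.swap) (simp add: cmod_power2, simp add: power2_eq_square)
  with T have "(\<Sum>i\<in>I. H i i) \<le> T" by simp
  from rademacher_quadratic_moment[OF I sym W psd _ this] le show ?thesis unfolding Q by blast
qed

text \<open>The case of a single row: by Cauchy-Schwarz \<open>V\<close> bounds both the trace and
  the operator norm, and \<open>2 + 16 * p \<le> 18 * p\<close>.\<close>

lemma rademacher_scalar_moment:
  fixes w :: "'i \<Rightarrow> complex"
  assumes I: "finite I" and D: "0 < V" "(\<Sum>i\<in>I. (cmod (w i))\<^sup>2) \<le> V" and p: "0 < p"
  shows "avg (Pow I) (\<lambda>X. (cmod (\<Sum>i\<in>I. eps X i * w i)) ^ (2 * p)) \<le> (18 * real p * V) ^ p"
proof -
  have le: "(\<Sum>r\<in>{()}. (cmod (\<Sum>i\<in>I. complex_of_real (c i) * w i))\<^sup>2) \<le> V * (\<Sum>i\<in>I. (c i)\<^sup>2)" for c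
  proof -
    have "cmod (\<Sum>i\<in>I. complex_of_real (c i) * w i) \<le> (\<Sum>i\<in>I. \<bar>c i\<bar> * cmod (w i))"
      by (rule order_trans[OF norm_sum]) (simp add: norm_mult)
    hence "(cmod (\<Sum>i\<in>I. complex_of_real (c i) * w i))\<^sup>2 \<le> (\<Sum>i\<in>I. \<bar>c i\<bar> * cmod (w i))\<^sup>2"
      by (intro power_mono) auto
    also have "\<dots> \<le> (\<Sum>i\<in>I. \<bar>c i\<bar>\<^sup>2) * (\<Sum>i\<in>I. (cmod (w i))\<^sup>2)"
      by (rule Cauchy_Schwarz_ineq_sum)
    also have "\<dots> \<le> (\<Sum>i\<in>I. (c i)\<^sup>2) * V"
      using D by (intro mult_mono) (auto intro: sum_nonneg)
    finally show ?thesis by (simp add: mult.commute)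
  qed
  have "avg (Pow I) (\<lambda>X. (\<Sum>r\<in>{()}. (cmod (\<Sum>i\<in>I. eps X i * w i))\<^sup>2) ^ p) \<le> (2 * V + 16 * real p * V) ^ p"
    by (rule rademacher_vector_moment[OF I D(1) le]) (use D in simp)
  also have "\<dots> \<le> (18 * real p * V) ^ p"
    using D p by (intro power_mono) (auto simp: algebra_simps)
  finally show ?thesis by (simp add: power_mult)
qed

subsection \<open>Sparse vectors and lattice approximations\<close>

definition lin :: "nat \<Rightarrow> (nat \<Rightarrow> complex) \<Rightarrow> (nat \<Rightarrow> real) \<Rightarrow> complex" where
  "lin D v x = (\<Sum>j<D. v j * complex_of_real (x j))"

definition sparse_ball :: "nat \<Rightarrow> nat \<Rightarrow> (nat \<Rightarrow> real) set" where
  "sparse_ball D K = {x. (\<forall>j\<ge>D. x j = 0) \<and> card {j. x j \<noteq> 0} \<le> K \<and> (\<Sum>j<D. (x j)\<^sup>2) \<le> 1}"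

text \<open>The strict inequality leaves only the zero vector at level 0, where the chains
  start.\<close>

definition int_vecs :: "nat \<Rightarrow> nat \<Rightarrow> (nat \<Rightarrow> int) set" where
  "int_vecs D s = {n. (\<forall>j\<ge>D. n j = 0) \<and> (\<Sum>j<D. \<bar>n j\<bar>) < 2 ^ s}"

text \<open>\<open>sqrt K\<close> bounds the l1 norm on the K-sparse unit ball, so rounding towards
  zero with this mesh gives integer l1 norm at most \<open>2 ^ s / 2\<close>; the factor 2 secures
  the strict inequality in \<open>int_vecs\<close>.\<close>

definition mesh :: "nat \<Rightarrow> nat \<Rightarrow> real" where
  "mesh K s = 2 * sqrt (real K) / 2 ^ s"

definition sparse_net :: "nat \<Rightarrow> nat \<Rightarrow> nat \<Rightarrow> (nat \<Rightarrow> real) set" where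
  "sparse_net D K S = sparse_ball D K \<inter> (\<lambda>n j. mesh K S * real_of_int (n j)) ` int_vecs D S"

text \<open>The approximants belong to the net itself because their energies, which enter the
  variance of the increments, are bounded only on the net.\<close>

definition net_chain :: "nat \<Rightarrow> nat \<Rightarrow> nat \<Rightarrow> (nat \<Rightarrow> (nat \<Rightarrow> real) \<Rightarrow> nat \<Rightarrow> real) \<Rightarrow> bool" where
  "net_chain D K S \<pi> \<longleftrightarrow>
     (\<forall>y\<in>sparse_net D K S. \<pi> 0 y = (\<lambda>_. 0) \<and> \<pi> S y = y \<and> (\<forall>s. \<pi> s y \<in> sparse_net D K S)) \<and>
     (\<forall>s\<le>S. card (\<pi> s ` sparse_net D K S) \<le> (2 * D + 1) ^ (2 ^ s))"

section \<open>Counting and coarsening of integer vectors\<close>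

text \<open>Moving a nonzero coordinate one step towards zero lowers the l1 norm by one, so radius
  \<open>L + 1\<close> is reached from radius \<open>L\<close> by one of \<open>2 * D + 1\<close>
  moves.\<close>

lemma card_int_vecs_le:
  "finite {n::nat \<Rightarrow> int. (\<forall>j\<ge>D. n j = 0) \<and> (\<Sum>j<D. \<bar>n j\<bar>) \<le> int L} \<and>
   card {n::nat \<Rightarrow> int. (\<forall>j\<ge>D. n j = 0) \<and> (\<Sum>j<D. \<bar>n j\<bar>) \<le> int L} \<le> (2 * D + 1) ^ L"
proof (induction L)
  case 0
  have "{n::nat \<Rightarrow> int. (\<forall>j\<ge>D. n j = 0) \<and> (\<Sum>j<D. \<bar>n j\<bar>) \<le> int 0} = {\<lambda>_. 0}"
  proof (intro Set.set_eqI iffI)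
    fix n :: "nat \<Rightarrow> int" assume n: "n \<in> {n. (\<forall>j\<ge>D. n j = 0) \<and> (\<Sum>j<D. \<bar>n j\<bar>) \<le> int 0}"
    moreover have "0 \<le> (\<Sum>j<D. \<bar>n j\<bar>)" by (rule sum_nonneg) simp
    ultimately have "(\<Sum>j<D. \<bar>n j\<bar>) = 0" by simp
    hence "\<forall>j<D. n j = 0" by (simp add: sum_nonneg_eq_0_iff)
    thus "n \<in> {\<lambda>_. 0}" using n by (auto simp: fun_eq_iff) (meson leI)
  qed auto
  thus ?case by simp
next
  case (Suc L)
  let ?Z = "\<lambda>L. {n::nat \<Rightarrow> int. (\<forall>j\<ge>D. n j = 0) \<and> (\<Sum>j<D. \<bar>n j\<bar>) \<le> int L}"
  \<comment> \<open>The pair \<open>(D, 0)\<close> is the move that changes nothing.\<close>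
  define P where "P = insert (D, 0) ({..<D} \<times> {1, -1::int})"
  have finP: "finite P" by (simp add: P_def)
  have cardP: "card P \<le> 2 * D + 1"
    unfolding P_def by (rule order_trans[OF card_insert_le_m1]) (auto simp: card_cartesian_product)
  have sub: "?Z (Suc L) \<subseteq> (\<lambda>(m, j, e). m(j := m j + e)) ` (?Z L \<times> P)"
  proof
    fix n assume n: "n \<in> ?Z (Suc L)"
    show "n \<in> (\<lambda>(m, j, e). m(j := m j + e)) ` (?Z L \<times> P)"
    proof (cases "n \<in> ?Z L")
      case True
      have "n = (\<lambda>(m, j, e). m(j := m j + e)) (n, D, 0)" by simp
      moreover have "(n, D, 0) \<in> ?Z L \<times> P" using True by (simp add: P_def)
      ultimately show ?thesis by (rule image_eqI)
    next
      case False
      have "(\<Sum>j<D. \<bar>n j\<bar>) \<noteq> 0" using False n by auto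
      then obtain j where j: "j < D" "n j \<noteq> 0" by (metis abs_zero lessThan_iff sum.neutral)
      define e where "e = sgn (n j)"
      have e: "e = 1 \<or> e = -1" "\<bar>n j - e\<bar> = \<bar>n j\<bar> - 1" using j by (auto simp: e_def sgn_if)
      define m where "m = n(j := n j - e)"
      have "(\<Sum>i<D. \<bar>m i\<bar>) = (\<Sum>i<D. \<bar>n i\<bar>) - 1"
        using j e by (simp add: sum.remove[of "{..<D}" j] m_def)
      hence "m \<in> ?Z L" using n j by (simp add: m_def)
      moreover have "n = (\<lambda>(m, j, e). m(j := m j + e)) (m, j, e)" by (simp add: m_def)
      moreover have "(j, e) \<in> P" using e j by (auto simp: P_def)
      ultimately show ?thesis by (intro image_eqI[where x = "(m, j, e)"]) auto
    qed
  qed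
  have fin: "finite (?Z L \<times> P)" using Suc finP by simp
  have "card (?Z (Suc L)) \<le> card (?Z L \<times> P)"
    using surj_card_le[OF fin sub] .
  also have "\<dots> = card (?Z L) * card P" by (rule card_cartesian_product)
  also have "\<dots> \<le> (2 * D + 1) ^ L * (2 * D + 1)" using Suc cardP by (intro mult_le_mono) auto
  finally have "card (?Z (Suc L)) \<le> (2 * D + 1) ^ Suc L" by (simp add: mult.commute)
  moreover have "finite (?Z (Suc L))" using finite_subset[OF sub] fin by blast
  ultimately show ?case by blast
qed

lemma finite_int_vecs: "finite (int_vecs D s)"
  and card_int_vecs: "card (int_vecs D s) \<le> (2 * D + 1) ^ (2 ^ s)"
proof -
  let ?Z = "{n::nat \<Rightarrow> int. (\<forall>j\<ge>D. n j = 0) \<and> (\<Sum>j<D. \<bar>n j\<bar>) \<le> int (2 ^ s)}"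
  have sub: "int_vecs D s \<subseteq> ?Z" by (auto simp: int_vecs_def)
  show "finite (int_vecs D s)" using finite_subset[OF sub] card_int_vecs_le[of D "2 ^ s"] by blast
  show "card (int_vecs D s) \<le> (2 * D + 1) ^ (2 ^ s)"
    using card_mono[OF _ sub] card_int_vecs_le[of D "2 ^ s"] order_trans by blast
qed

lemma int_vecs_0: "int_vecs D 0 = {\<lambda>_. 0}"
proof (intro Set.set_eqI iffI)
  fix n assume n: "n \<in> int_vecs D 0"
  hence "(\<Sum>j<D. \<bar>n j\<bar>) < 1" by (simp add: int_vecs_def)
  moreover have "0 \<le> (\<Sum>j<D. \<bar>n j\<bar>)" by (rule sum_nonneg) simp
  ultimately have "(\<Sum>j<D. \<bar>n j\<bar>) = 0" by linarith
  hence "\<forall>j<D. n j = 0" by (simp add: sum_nonneg_eq_0_iff)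
  thus "n \<in> {\<lambda>_. 0}" using n by (auto simp: fun_eq_iff int_vecs_def) (meson leI)
qed (simp add: int_vecs_def)

text \<open>The odd coordinates are rounded to an even neighbour along the signs \<open>X\<close> or along the opposite signs;
  one of the two choices does not increase the \<open>l\<^sub>1\<close> norm.\<close>

lemma int_vecs_halving:
  assumes n: "n \<in> int_vecs D (Suc s)" and X: "X \<subseteq> {j. j < D \<and> odd (n j)}"
  defines "O' \<equiv> {j. j < D \<and> odd (n j)}"
  shows "\<exists>n'\<in>int_vecs D s. \<exists>Y\<in>{X, O' - X}.
    \<forall>j. real_of_int (n j) = 2 * real_of_int (n' j) + (if j \<in> O' then eps Y j else 0)"
proof -
  define e where "e Y j = (if j \<in> O' then (if j \<in> Y then 1 else - 1) else 0 :: int)" for Y j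
  \<comment> \<open>Rounding along \<open>X\<close> lowers the l1 norm by exactly \<open>t\<close>,
    rounding along the opposite signs by \<open>- t\<close>.\<close>
  define t where "t = (\<Sum>j<D. e X j * sgn (n j))"
  have abs_e: "\<bar>n j - e Y j\<bar> = \<bar>n j\<bar> - e Y j * sgn (n j)" for Y j
  proof (cases "j \<in> O'")
    case True
    hence "n j \<noteq> 0" by (auto simp: O'_def)
    thus ?thesis by (auto simp: e_def sgn_if)
  qed (simp add: e_def)
  have neg: "e (O' - X) j = - e X j" for j by (simp add: e_def)
  define Y where "Y = (if 0 \<le> t then X else O' - X)"
  have "(\<Sum>j<D. \<bar>n j - e Y j\<bar>) = (\<Sum>j<D. \<bar>n j\<bar>) - (if 0 \<le> t then t else - t)"
    by (simp add: abs_e sum_subtractf Y_def neg t_def sum_negf)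
  hence le: "(\<Sum>j<D. \<bar>n j - e Y j\<bar>) < 2 ^ Suc s" using n by (auto simp: int_vecs_def split: if_splits)
  define n' where "n' j = (n j - e Y j) div 2" for j
  have ev: "even (n j - e Y j)" if "j < D" for j
    using that by (auto simp: e_def O'_def)
  have z: "n j = 0" "e Y j = 0" if "D \<le> j" for j using n that by (auto simp: int_vecs_def e_def O'_def)
  have n2: "n j = 2 * n' j + e Y j" for j
    using ev[of j] z[of j] unfolding n'_def by (cases "j < D") auto
  have "2 * (\<Sum>j<D. \<bar>n' j\<bar>) = (\<Sum>j<D. \<bar>n j - e Y j\<bar>)"
    unfolding sum_distrib_left by (rule sum.cong) (simp_all add: n2 abs_mult)
  hence "n' \<in> int_vecs D s" using le z by (auto simp: int_vecs_def n'_def)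
  moreover have "Y \<in> {X, O' - X}" by (simp add: Y_def)
  moreover have "real_of_int (n j) = 2 * real_of_int (n' j) + (if j \<in> O' then eps Y j else 0)" for j
    by (subst n2) (simp add: e_def eps_def)
  ultimately show ?thesis by blast
qed

lemma card_odd_le:
  assumes "n \<in> int_vecs D s" shows "card {j. j < D \<and> odd (n j)} \<le> 2 ^ s"
proof -
  have "int (card {j. j < D \<and> odd (n j)}) = (\<Sum>j\<in>{j. j < D \<and> odd (n j)}. 1)" by simp
  also have "\<dots> \<le> (\<Sum>j\<in>{j. j < D \<and> odd (n j)}. \<bar>n j\<bar>)"
  proof (rule sum_mono)
    fix j assume "j \<in> {j. j < D \<and> odd (n j)}"
    hence "n j \<noteq> 0" by auto
    thus "1 \<le> \<bar>n j\<bar>" by linarith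
  qed
  also have "\<dots> \<le> (\<Sum>j<D. \<bar>n j\<bar>)" by (rule sum_mono2) auto
  also have "\<dots> \<le> 2 ^ s" using assms by (simp add: int_vecs_def)
  finally show ?thesis by (metis of_nat_le_iff of_nat_numeral of_nat_power)
qed

text \<open>\<open>N x a\<close> reads ``the seminorm of \<open>x\<close> is at most \<open>a\<close>''; stating the axioms for a predicate
  avoids the roots in the definition of the \<open>L\<^sub>p\<close> seminorms used below.\<close>

locale seminorm_bound =
  fixes N :: "(nat \<Rightarrow> real) \<Rightarrow> real \<Rightarrow> bool"
  assumes N_add: "N x a \<Longrightarrow> N y b \<Longrightarrow> 0 < a \<Longrightarrow> 0 < b \<Longrightarrow> N (\<lambda>j. x j + y j) (a + b)"
    and N_scale: "N x a \<Longrightarrow> 0 < a \<Longrightarrow> 0 < h \<Longrightarrow> N (\<lambda>j. h * x j) (h * a)"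
    and N_neg: "N x a \<Longrightarrow> N (\<lambda>j. - x j) a"
    and N_zero: "0 < a \<Longrightarrow> N (\<lambda>_. 0) a"
    and N_mono: "N x a \<Longrightarrow> 0 < a \<Longrightarrow> a \<le> b \<Longrightarrow> N x b"
begin

text \<open>Since \<open>N\<close> is symmetric, the opposite signing that halving may select is as
  good as \<open>X\<close>. The two lattice points differ by the finer mesh times a signed indicator
  of the odd coordinates.\<close>

lemma int_vecs_coarsen:
  assumes K: "0 < K" and beta: "0 < \<beta>"
    and hyp: "\<And>O'. O' \<subseteq> {..<D} \<Longrightarrow> card O' \<le> 2 ^ Suc s \<Longrightarrow>
      \<exists>X\<subseteq>O'. N (\<lambda>j. if j \<in> O' then eps X j else 0) (\<beta> * sqrt (2 ^ Suc s))"
    and n: "n \<in> int_vecs D (Suc s)"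
  shows "\<exists>n'\<in>int_vecs D s.
    N (\<lambda>j. mesh K (Suc s) * real_of_int (n j) - mesh K s * real_of_int (n' j)) (2 * sqrt K * \<beta> / sqrt (2 ^ Suc s))"
proof -
  define O' where "O' = {j. j < D \<and> odd (n j)}"
  have "O' \<subseteq> {..<D}" "card O' \<le> 2 ^ Suc s" using card_odd_le[OF n] by (auto simp: O'_def)
  from hyp[OF this] obtain X where X: "X \<subseteq> O'"
    and NX: "N (\<lambda>j. if j \<in> O' then eps X j else 0) (\<beta> * sqrt (2 ^ Suc s))" by blast
  from int_vecs_halving[OF n X[unfolded O'_def]] obtain n' Y where n': "n' \<in> int_vecs D s"
    and Y: "Y \<in> {X, O' - X}"
    and eq: "\<And>j. real_of_int (n j) = 2 * real_of_int (n' j) + (if j \<in> O' then eps Y j else 0)"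
    unfolding O'_def[symmetric] by blast
  have NY: "N (\<lambda>j. if j \<in> O' then eps Y j else 0) (\<beta> * sqrt (2 ^ Suc s))"
  proof (cases "Y = X")
    case False
    hence "Y = O' - X" using Y by auto
    hence "(\<lambda>j. if j \<in> O' then eps Y j else 0) = (\<lambda>j. - (if j \<in> O' then eps X j else 0))"
      by (auto simp: eps_def)
    thus ?thesis using N_neg[OF NX] by simp
  next
    case True
    show ?thesis unfolding True by (rule NX)
  qed
  have h: "mesh K s = 2 * mesh K (Suc s)" "0 < mesh K (Suc s)" using K by (auto simp: mesh_def)
  have e1: "mesh K (Suc s) * real_of_int (n j) - mesh K s * real_of_int (n' j)
      = mesh K (Suc s) * (if j \<in> O' then eps Y j else 0)" for j
    unfolding eq h(1) by (simp add: algebra_simps)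
  have "(2::real) ^ Suc s = sqrt (2 ^ Suc s) * sqrt (2 ^ Suc s)" by simp
  hence e2: "mesh K (Suc s) * (\<beta> * sqrt (2 ^ Suc s)) = 2 * sqrt K * \<beta> / sqrt (2 ^ Suc s)"
    unfolding mesh_def by (simp add: field_simps)
  have "N (\<lambda>j. mesh K (Suc s) * (if j \<in> O' then eps Y j else 0)) (mesh K (Suc s) * (\<beta> * sqrt (2 ^ Suc s)))"
    by (rule N_scale[OF NY _ h(2)]) (use beta in simp)
  hence "N (\<lambda>j. mesh K (Suc s) * real_of_int (n j) - mesh K s * real_of_int (n' j)) (2 * sqrt K * \<beta> / sqrt (2 ^ Suc s))"
    by (simp only: e1 e2)
  thus ?thesis using n' by blast
qed

text \<open>Induction downwards from level \<open>S\<close>, where \<open>y\<close> is itself a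
  lattice point. One step adds 2 to an accumulated error of 8, both in units of the finer level, and
  \<open>(8 + 2) / sqrt 2 \<le> 8\<close> closes the induction.\<close>

lemma net_approximation:
  fixes \<beta> :: "nat \<Rightarrow> real"
  assumes K: "0 < K" and beta: "\<And>s. 0 < \<beta> s" and anti: "\<And>s. \<beta> (Suc s) \<le> \<beta> s"
    and hyp: "\<And>s O'. s \<le> S \<Longrightarrow> O' \<subseteq> {..<D} \<Longrightarrow> card O' \<le> 2 ^ s \<Longrightarrow>
      \<exists>X\<subseteq>O'. N (\<lambda>j. if j \<in> O' then eps X j else 0) (\<beta> s * sqrt (2 ^ s))"
    and y: "y \<in> sparse_net D K S" and s: "s \<le> S"
  shows "\<exists>n\<in>int_vecs D s. N (\<lambda>j. y j - mesh K s * real_of_int (n j)) (8 * sqrt K * \<beta> s / sqrt (2 ^ s))"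
  using s
proof (induction s rule: inc_induct)
  case base
  from y obtain n where "n \<in> int_vecs D S" "y = (\<lambda>j. mesh K S * real_of_int (n j))"
    by (auto simp: sparse_net_def)
  moreover have "0 < 8 * sqrt K * \<beta> S / sqrt (2 ^ S)" using K beta by simp
  ultimately show ?case using N_zero by (intro bexI[of _ n]) auto
next
  case (step s)
  then obtain n where n: "n \<in> int_vecs D (Suc s)"
    and Nn: "N (\<lambda>j. y j - mesh K (Suc s) * real_of_int (n j)) (8 * sqrt K * \<beta> (Suc s) / sqrt (2 ^ Suc s))" by blast
  have "\<exists>n'\<in>int_vecs D s. N (\<lambda>j. mesh K (Suc s) * real_of_int (n j) - mesh K s * real_of_int (n' j))
      (2 * sqrt K * \<beta> (Suc s) / sqrt (2 ^ Suc s))"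
    by (rule int_vecs_coarsen[OF K beta _ n], rule hyp) (use step in auto)
  then obtain n' where n': "n' \<in> int_vecs D s"
    and Nn': "N (\<lambda>j. mesh K (Suc s) * real_of_int (n j) - mesh K s * real_of_int (n' j))
      (2 * sqrt K * \<beta> (Suc s) / sqrt (2 ^ Suc s))" by blast
  have p: "0 < 8 * sqrt K * \<beta> (Suc s) / sqrt (2 ^ Suc s)" "0 < 2 * sqrt K * \<beta> (Suc s) / sqrt (2 ^ Suc s)"
    using K beta by simp_all
  have r2: "sqrt 2 > 1.4" by (rule real_less_rsqrt) (simp add: power2_eq_square)
  have "8 * sqrt K * \<beta> (Suc s) / sqrt (2 ^ Suc s) + 2 * sqrt K * \<beta> (Suc s) / sqrt (2 ^ Suc s)
      = (10 / sqrt 2) * (sqrt K * \<beta> (Suc s) / sqrt (2 ^ s))"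
    by (simp add: real_sqrt_mult add_divide_distrib[symmetric])
  also have "\<dots> \<le> 8 * (sqrt K * \<beta> s / sqrt (2 ^ s))"
    using r2 K beta[of "Suc s"] anti[of s]
    by (intro mult_mono divide_right_mono mult_left_mono) (auto simp: divide_le_eq intro: less_imp_le)
  finally have le: "8 * sqrt K * \<beta> (Suc s) / sqrt (2 ^ Suc s) + 2 * sqrt K * \<beta> (Suc s) / sqrt (2 ^ Suc s)
      \<le> 8 * sqrt K * \<beta> s / sqrt (2 ^ s)" by simp
  have "N (\<lambda>j. y j - mesh K s * real_of_int (n' j)) (8 * sqrt K * \<beta> s / sqrt (2 ^ s))"
    using N_mono[OF N_add[OF Nn Nn' p] _ le] p by (simp add: algebra_simps)
  thus ?case using n' by blast
qed

text \<open>Lattice approximants may leave the sparse ball, so each is replaced by a net point that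
  shares the same lattice approximant. This doubles the error, and a link between two levels costs
  at most 4 * 8 = 32 units.\<close>

theorem sparse_net_chain:
  fixes \<beta> :: "nat \<Rightarrow> real"
  assumes K: "0 < K" and S: "0 < S" and beta: "\<And>s. 0 < \<beta> s" and anti: "\<And>s. \<beta> (Suc s) \<le> \<beta> s"
    and hyp: "\<And>s O'. s \<le> S \<Longrightarrow> O' \<subseteq> {..<D} \<Longrightarrow> card O' \<le> 2 ^ s \<Longrightarrow>
      \<exists>X\<subseteq>O'. N (\<lambda>j. if j \<in> O' then eps X j else 0) (\<beta> s * sqrt (2 ^ s))"
  shows "\<exists>\<pi>. net_chain D K S \<pi> \<and> (\<forall>s<S. \<forall>y\<in>sparse_net D K S.
      N (\<lambda>j. \<pi> (Suc s) y j - \<pi> s y j) (32 * sqrt K * \<beta> s / sqrt (2 ^ s)))"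
proof -
  let ?F = "sparse_net D K S"
  define e where "e s = 8 * sqrt K * \<beta> s / sqrt (2 ^ s)" for s
  have e0: "0 < e s" for s using K beta by (simp add: e_def)
  have e_anti: "e (Suc s) \<le> e s" for s
    unfolding e_def using K beta[of s] anti[of s] by (intro frac_le mult_left_mono) auto
  have "\<forall>s y. \<exists>n. s \<le> S \<longrightarrow> y \<in> ?F \<longrightarrow> n \<in> int_vecs D s \<and> N (\<lambda>j. y j - mesh K s * real_of_int (n j)) (e s)"
    using net_approximation[OF K beta anti hyp] unfolding e_def by blast
  then obtain f where f: "\<And>s y. s \<le> S \<Longrightarrow> y \<in> ?F \<Longrightarrow> f s y \<in> int_vecs D s"
    "\<And>s y. s \<le> S \<Longrightarrow> y \<in> ?F \<Longrightarrow> N (\<lambda>j. y j - mesh K s * real_of_int (f s y j)) (e s)"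
    by metis
  define rep where "rep s c = (SOME z. z \<in> ?F \<and> f s z = c)" for s c
  \<comment> \<open>At level 0 the only lattice point is 0 and level \<open>S\<close> is exact, so
    both ends are fixed by hand; representatives serve the levels in between.\<close>
  define \<pi> where "\<pi> s y = (if s = 0 then (\<lambda>_. 0) else if S \<le> s then y else rep s (f s y))" for s y
  have rep: "rep s (f s y) \<in> ?F" "f s (rep s (f s y)) = f s y" if "y \<in> ?F" for s y
    using someI[of "\<lambda>z. z \<in> ?F \<and> f s z = f s y" y] that by (auto simp: rep_def)
  have zero: "(\<lambda>_. 0) \<in> ?F"
    by (auto simp: sparse_net_def sparse_ball_def int_vecs_def fun_eq_iff intro!: image_eqI[of _ _ "\<lambda>_. 0"])
  have 3: "\<pi> s y \<in> ?F" if "y \<in> ?F" for s y using that zero rep by (simp add: \<pi>_def)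
  have 4: "card (\<pi> s ` ?F) \<le> (2 * D + 1) ^ (2 ^ s)" if s: "s \<le> S" for s
  proof -
    consider "s = 0" | "0 < s" "s = S" | "0 < s" "s < S" using s by linarith
    thus ?thesis
    proof cases
      case 1
      have "\<pi> s ` ?F \<subseteq> {\<lambda>_. 0}" using 1 by (auto simp: \<pi>_def)
      hence "card (\<pi> s ` ?F) \<le> card {\<lambda>_::nat. 0::real}" by (intro card_mono) auto
      thus ?thesis using 1 by simp
    next
      case 2
      have "\<pi> s ` ?F \<subseteq> (\<lambda>n j. mesh K S * real_of_int (n j)) ` int_vecs D S"
        using 2 by (auto simp: \<pi>_def sparse_net_def)
      hence "card (\<pi> s ` ?F) \<le> card (int_vecs D S)" by (rule surj_card_le[OF finite_int_vecs])
      thus ?thesis using card_int_vecs[of D S] 2 by simp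
    next
      case 3
      have "\<pi> s ` ?F \<subseteq> rep s ` int_vecs D s" using 3 f(1) by (auto simp: \<pi>_def)
      hence "card (\<pi> s ` ?F) \<le> card (int_vecs D s)" by (rule surj_card_le[OF finite_int_vecs])
      thus ?thesis using card_int_vecs[of D s] by simp
    qed
  qed
  have d: "N (\<lambda>j. y j - \<pi> s y j) (2 * e s)" if y: "y \<in> ?F" and s: "s \<le> S" for y s
  proof -
    consider "s = 0" | "0 < s" "s = S" | "0 < s" "s < S" using s by linarith
    thus ?thesis
    proof cases
      case 1
      have "f 0 y = (\<lambda>_. 0)" using f(1)[of 0 y] y by (simp add: int_vecs_0)
      hence "N (\<lambda>j. y j - \<pi> 0 y j) (e 0)" using f(2)[of 0 y] y by (simp add: \<pi>_def)
      thus ?thesis using N_mono e0[of 0] 1 by force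
    next
      case 2
      thus ?thesis using N_zero e0[of s] by (simp add: \<pi>_def)
    next
      case 3
      define z where "z = rep s (f s y)"
      have z: "z \<in> ?F" "f s z = f s y" using rep[OF y] by (auto simp: z_def)
      have "N (\<lambda>j. (y j - mesh K s * real_of_int (f s y j)) + - (z j - mesh K s * real_of_int (f s y j))) (e s + e s)"
        using N_add[OF f(2)[OF s y] N_neg[OF f(2)[OF s z(1)]] e0 e0] z(2) by simp
      thus ?thesis using 3 by (simp add: \<pi>_def z_def)
    qed
  qed
  have 5: "N (\<lambda>j. \<pi> (Suc s) y j - \<pi> s y j) (32 * sqrt K * \<beta> s / sqrt (2 ^ s))" if y: "y \<in> ?F" and s: "s < S" for s y
  proof -
    have "N (\<lambda>j. (y j - \<pi> s y j) + - (y j - \<pi> (Suc s) y j)) (2 * e s + 2 * e (Suc s))"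
      using y s e0 by (intro N_add N_neg d) auto
    hence le: "N (\<lambda>j. \<pi> (Suc s) y j - \<pi> s y j) (2 * e s + 2 * e (Suc s))" by (simp add: algebra_simps)
    have "0 < 2 * e s + 2 * e (Suc s)" using e0[of s] e0[of "Suc s"] by linarith
    from N_mono[OF le this] show ?thesis using e_anti[of s] by (simp add: e_def)
  qed
  have "\<pi> 0 y = (\<lambda>_. 0)" "\<pi> S y = y" for y using S by (simp_all add: \<pi>_def)
  with 3 4 have "net_chain D K S \<pi>" unfolding net_chain_def by blast
  with 5 show ?thesis by blast
qed

end

section \<open>Rounding into the net and extension from the net\<close>

lemma finite_sparse_net: "finite (sparse_net D K S)"
  by (simp add: sparse_net_def finite_int_vecs)

lemma zero_in_sparse_net: "(\<lambda>_. 0) \<in> sparse_net D K S"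
  by (auto simp: sparse_net_def sparse_ball_def int_vecs_def fun_eq_iff intro!: image_eqI[of _ _ "\<lambda>_. 0"])

lemma sparse_ball_l1:
  assumes "x \<in> sparse_ball D K" shows "(\<Sum>j<D. \<bar>x j\<bar>) \<le> sqrt K"
proof -
  let ?A = "{j. x j \<noteq> 0}"
  have A: "?A \<subseteq> {..<D}" using assms by (auto simp: sparse_ball_def) (meson leI)
  have "(\<Sum>j<D. \<bar>x j\<bar>) = (\<Sum>j\<in>?A. 1 * \<bar>x j\<bar>)"
    using A by (simp, intro sum.mono_neutral_right) auto
  hence "(\<Sum>j<D. \<bar>x j\<bar>)\<^sup>2 = (\<Sum>j\<in>?A. 1 * \<bar>x j\<bar>)\<^sup>2" by simp
  also have "\<dots> \<le> (\<Sum>j\<in>?A. 1\<^sup>2) * (\<Sum>j\<in>?A. \<bar>x j\<bar>\<^sup>2)" by (rule Cauchy_Schwarz_ineq_sum)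
  also have "(\<Sum>j\<in>?A. \<bar>x j\<bar>\<^sup>2) = (\<Sum>j<D. (x j)\<^sup>2)" 
    using A by (simp, intro sum.mono_neutral_left) auto
  also have "(\<Sum>j\<in>?A. 1\<^sup>2) * (\<Sum>j<D. (x j)\<^sup>2) \<le> real K * 1"
    using assms by (intro mult_mono) (auto simp: sparse_ball_def sum_nonneg)
  finally show ?thesis by (intro real_le_rsqrt) simp
qed

text \<open>Rounding towards zero keeps the support and does not increase the norm. The remainder
  has at most \<open>K\<close> entries of size at most the mesh, hence norm at most
  \<open>2 * K / 2 ^ S\<close>, which is at most 1/16.\<close>

lemma sparse_net_rounding:
  assumes K: "0 < K" "32 * K \<le> 2 ^ S" and x: "x \<in> sparse_ball D K"
  shows "\<exists>y\<in>sparse_net D K S. \<exists>r\<in>sparse_ball D K. x = (\<lambda>j. y j + 1/16 * r j) \<and>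
    {j. y j \<noteq> 0} \<subseteq> {j. x j \<noteq> 0} \<and> {j. r j \<noteq> 0} \<subseteq> {j. x j \<noteq> 0}"
proof -
  define h where "h = mesh K S"
  have h: "0 < h" using K by (simp add: h_def mesh_def)
  define n where "n j = (if 0 \<le> x j then \<lfloor>\<bar>x j\<bar> / h\<rfloor> else - \<lfloor>\<bar>x j\<bar> / h\<rfloor>)" for j
  define y where "y j = h * real_of_int (n j)" for j
  define r where "r j = 16 * (x j - y j)" for j
  let ?A = "{j. x j \<noteq> 0}"
  have A: "?A \<subseteq> {..<D}" using x by (auto simp: sparse_ball_def) (meson leI)
  hence finA: "finite ?A" by (rule finite_subset) simp
  have cA: "card ?A \<le> K" using x by (simp add: sparse_ball_def)
  have fl: "0 \<le> real_of_int \<lfloor>\<bar>x j\<bar> / h\<rfloor>" "h * real_of_int \<lfloor>\<bar>x j\<bar> / h\<rfloor> \<le> \<bar>x j\<bar>"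
    "\<bar>x j\<bar> \<le> h * real_of_int \<lfloor>\<bar>x j\<bar> / h\<rfloor> + h" for j
  proof -
    show "0 \<le> real_of_int \<lfloor>\<bar>x j\<bar> / h\<rfloor>" using h by simp
    show "h * real_of_int \<lfloor>\<bar>x j\<bar> / h\<rfloor> \<le> \<bar>x j\<bar>"
      using of_int_floor_le[of "\<bar>x j\<bar> / h"] unfolding pos_le_divide_eq[OF h] by (simp only: mult.commute)
    have "\<bar>x j\<bar> / h \<le> real_of_int \<lfloor>\<bar>x j\<bar> / h\<rfloor> + 1" by linarith
    thus "\<bar>x j\<bar> \<le> h * real_of_int \<lfloor>\<bar>x j\<bar> / h\<rfloor> + h"
      unfolding pos_divide_le_eq[OF h] by (simp only: distrib_right mult_1 mult.commute[of h])
  qed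
  have nabs: "real_of_int \<bar>n j\<bar> = real_of_int \<lfloor>\<bar>x j\<bar> / h\<rfloor>" for j
    using fl(1)[of j] by (auto simp: n_def)
  have yabs: "\<bar>y j\<bar> \<le> \<bar>x j\<bar>" for j
    using nabs[of j] fl(2)[of j] h by (simp add: y_def abs_mult)
  have d: "\<bar>x j - y j\<bar> \<le> h" for j
    using fl[of j] by (auto simp: y_def n_def)
  have z: "y j = 0" "r j = 0" if "x j = 0" for j using that by (auto simp: y_def n_def r_def)
  have y2: "(\<Sum>j<D. (y j)\<^sup>2) \<le> 1"
  proof -
    have "(\<Sum>j<D. (y j)\<^sup>2) \<le> (\<Sum>j<D. (x j)\<^sup>2)"
      using yabs by (intro sum_mono) (simp add: abs_le_square_iff)
    thus ?thesis using x by (simp add: sparse_ball_def)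
  qed
  have yA: "{j. y j \<noteq> 0} \<subseteq> ?A" and rA: "{j. r j \<noteq> 0} \<subseteq> ?A" using z by auto
  have ball: "u \<in> sparse_ball D K" if "{j. u j \<noteq> 0} \<subseteq> ?A" "(\<Sum>j<D. (u j)\<^sup>2) \<le> 1" for u
    using that A cA card_mono[OF finA that(1)] by (force simp: sparse_ball_def)
  have r2: "(\<Sum>j<D. (r j)\<^sup>2) \<le> 1"
  proof -
    have "(\<Sum>j<D. (r j)\<^sup>2) = (\<Sum>j\<in>?A. (r j)\<^sup>2)"
      using A z by (intro sum.mono_neutral_right) auto
    also have "\<dots> \<le> (\<Sum>j\<in>?A. 256 * h\<^sup>2)"
    proof (rule sum_mono)
      fix j
      have "\<bar>x j - y j\<bar>\<^sup>2 \<le> h\<^sup>2" using d by (intro power_mono) auto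
      thus "(r j)\<^sup>2 \<le> 256 * h\<^sup>2" unfolding r_def power_mult_distrib by simp
    qed
    also have "\<dots> \<le> real K * (256 * h\<^sup>2)" using cA by (simp add: mult_right_mono)
    also have "\<dots> = (32 * real K / 2 ^ S)\<^sup>2"
      by (simp add: h_def mesh_def power2_eq_square)
    also have "\<dots> \<le> 1\<^sup>2"
    proof (intro power_mono)
      have "real (32 * K) \<le> real (2 ^ S)" using K(2) of_nat_le_iff by blast
      thus "32 * real K / 2 ^ S \<le> 1" by simp
    qed simp
    finally show ?thesis by simp
  qed
  have "n \<in> int_vecs D S"
  proof -
    have "h * real_of_int (\<Sum>j<D. \<bar>n j\<bar>) = (\<Sum>j<D. h * real_of_int \<bar>n j\<bar>)"
      by (simp add: sum_distrib_left)
    also have "\<dots> \<le> (\<Sum>j<D. \<bar>x j\<bar>)" unfolding nabs by (intro sum_mono fl)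
    also have "\<dots> \<le> sqrt K" by (rule sparse_ball_l1[OF x])
    also have "\<dots> < h * 2 ^ S" using K by (simp add: h_def mesh_def)
    finally have "real_of_int (\<Sum>j<D. \<bar>n j\<bar>) < 2 ^ S" using h by simp
    hence "(\<Sum>j<D. \<bar>n j\<bar>) < 2 ^ S" by (metis of_int_less_iff of_int_numeral of_int_power)
    moreover have "n j = 0" if "j \<ge> D" for j using that x by (simp add: n_def sparse_ball_def)
    ultimately show ?thesis by (simp add: int_vecs_def)
  qed
  hence "y \<in> sparse_net D K S"
    using ball[OF yA y2] by (auto simp: sparse_net_def y_def[abs_def] h_def)
  moreover have "r \<in> sparse_ball D K" by (rule ball[OF rA r2])
  moreover have "x = (\<lambda>j. y j + 1/16 * r j)" by (rule ext) (simp add: r_def field_simps)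
  ultimately show ?thesis using yA rA by blast
qed

text \<open>Let \<open>q\<close> be the supremum of \<open>\<bar>Q\<bar>\<close> over the ball,
  finite by \<open>bdd\<close>. Then x = y + r/16 gives q <= a + q/4 + q/256. The mixed term is at
  most \<open>2 * q\<close> by polarisation: y and r live on the support of x, so (y + r)/2 and (y -
  r)/2 are still in the ball.\<close>

lemma sparse_net_extension:
  fixes Q :: "(nat \<Rightarrow> real) \<Rightarrow> real"
  assumes K: "0 < K" "32 * K \<le> 2 ^ S"
    and hom: "\<And>c x. Q (\<lambda>j. c * x j) = c\<^sup>2 * Q x"
    and exp: "\<And>y r \<delta>. Q (\<lambda>j. y j + \<delta> * r j) = Q y + 2 * \<delta> * L y r + \<delta>\<^sup>2 * Q r"
    and bdd: "\<And>x. x \<in> sparse_ball D K \<Longrightarrow> \<bar>Q x\<bar> \<le> M"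
    and net: "\<And>y. y \<in> sparse_net D K S \<Longrightarrow> \<bar>Q y\<bar> \<le> a"
    and x: "x \<in> sparse_ball D K"
  shows "\<bar>Q x\<bar> \<le> 2 * a"
proof -
  define q where "q = (SUP x\<in>sparse_ball D K. \<bar>Q x\<bar>)"
  have bdd': "bdd_above ((\<lambda>x. \<bar>Q x\<bar>) ` sparse_ball D K)" using bdd by (intro bdd_aboveI2)
  have q: "\<bar>Q x\<bar> \<le> q" if "x \<in> sparse_ball D K" for x
    unfolding q_def by (rule cSUP_upper[OF that bdd'])
  have "\<bar>Q x\<bar> \<le> a + q / 2" if x: "x \<in> sparse_ball D K" for x
  proof -
    obtain y r where y: "y \<in> sparse_net D K S" and r: "r \<in> sparse_ball D K"
      and eq: "x = (\<lambda>j. y j + 1/16 * r j)"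
      and A: "{j. y j \<noteq> 0} \<subseteq> {j. x j \<noteq> 0}" "{j. r j \<noteq> 0} \<subseteq> {j. x j \<noteq> 0}"
      using sparse_net_rounding[OF K x] by blast
    have yb: "y \<in> sparse_ball D K" using y by (simp add: sparse_net_def)
    have finA: "finite {j. x j \<noteq> 0}"
    proof (rule finite_subset)
      show "{j. x j \<noteq> 0} \<subseteq> {..<D}" using x by (auto simp: sparse_ball_def) (meson leI)
    qed simp
    have half: "\<bar>Q (\<lambda>j. y j + \<delta> * r j)\<bar> \<le> 4 * q" if d: "\<bar>\<delta>\<bar> = 1" for \<delta>
    proof -
      have "(\<lambda>j. 1/2 * (y j + \<delta> * r j)) \<in> sparse_ball D K"
      proof -
        have "y j = 0 \<and> r j = 0" if "x j = 0" for j using A that by blast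
        hence sub: "{j. 1/2 * (y j + \<delta> * r j) \<noteq> 0} \<subseteq> {j. x j \<noteq> 0}" by auto
        have "card {j. x j \<noteq> 0} \<le> K" using x by (simp add: sparse_ball_def)
        with card_mono[OF finA sub] have "card {j. 1/2 * (y j + \<delta> * r j) \<noteq> 0} \<le> K" by (rule order_trans)
        moreover have "(\<Sum>j<D. (1/2 * (y j + \<delta> * r j))\<^sup>2) \<le> 1"
        proof -
          have d2: "\<delta>\<^sup>2 = 1" using d by (metis abs_1 power2_abs power_one)
          have "(1/2 * (y j + \<delta> * r j))\<^sup>2 \<le> 1/2 * ((y j)\<^sup>2 + (r j)\<^sup>2)" for j
          proof -
            have "0 \<le> (y j - \<delta> * r j)\<^sup>2" by simp
            hence "2 * (\<delta> * (y j * r j)) \<le> (y j)\<^sup>2 + \<delta>\<^sup>2 * (r j)\<^sup>2"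
              by (simp add: power2_diff power_mult_distrib algebra_simps)
            thus ?thesis using d2 by (simp add: power_mult_distrib power2_sum algebra_simps power_divide)
          qed
          hence "(\<Sum>j<D. (1/2 * (y j + \<delta> * r j))\<^sup>2) \<le> (\<Sum>j<D. 1/2 * ((y j)\<^sup>2 + (r j)\<^sup>2))"
            by (intro sum_mono)
          also have "\<dots> = 1/2 * ((\<Sum>j<D. (y j)\<^sup>2) + (\<Sum>j<D. (r j)\<^sup>2))"
            by (simp only: sum_distrib_left[symmetric] sum.distrib)
          also have "\<dots> \<le> 1" using yb r by (auto simp: sparse_ball_def)
          finally show ?thesis .
        qed
        moreover have "\<forall>j\<ge>D. 1/2 * (y j + \<delta> * r j) = 0" using yb r by (simp add: sparse_ball_def)
        ultimately show ?thesis unfolding sparse_ball_def by blast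
      qed
      from q[OF this] show ?thesis unfolding hom by (simp add: power_divide abs_mult)
    qed
    have "4 * L y r = Q (\<lambda>j. y j + 1 * r j) - Q (\<lambda>j. y j + -1 * r j)"
      unfolding exp by simp
    hence L: "\<bar>L y r\<bar> \<le> 2 * q" using half[of 1] half[of "-1"] by (simp add: abs_le_iff)
    have "Q x = Q y + 1/8 * L y r + 1/256 * Q r" unfolding eq exp by (simp add: power_divide)
    moreover have "\<bar>Q y\<bar> \<le> a" "\<bar>Q r\<bar> \<le> q" using net[OF y] q[OF r] by auto
    ultimately show ?thesis using L by linarith
  qed
  hence "q \<le> a + q / 2" unfolding q_def using x by (intro cSUP_least) auto
  thus ?thesis using q[OF x] by linarith
qed

section \<open>Maxima of finitely many Rademacher sums\<close>

definition maxf :: "'a set \<Rightarrow> ('a \<Rightarrow> real) \<Rightarrow> real" where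
  "maxf V f = Max (f ` V)"

lemma maxf_ge: "finite V \<Longrightarrow> v \<in> V \<Longrightarrow> f v \<le> maxf V f"
  unfolding maxf_def by (rule Max_ge) auto

lemma maxf_le: "finite V \<Longrightarrow> V \<noteq> {} \<Longrightarrow> (\<And>v. v \<in> V \<Longrightarrow> f v \<le> a) \<Longrightarrow> maxf V f \<le> a"
  unfolding maxf_def by (subst Max_le_iff) auto

lemma maxf_attained: "finite V \<Longrightarrow> V \<noteq> {} \<Longrightarrow> \<exists>v\<in>V. maxf V f = f v"
proof -
  assume "finite V" "V \<noteq> {}"
  hence "maxf V f \<in> f ` V" unfolding maxf_def by (intro Max_in) auto
  thus ?thesis by blast
qed

lemma maxf_nonneg: "finite V \<Longrightarrow> V \<noteq> {} \<Longrightarrow> (\<And>v. v \<in> V \<Longrightarrow> 0 \<le> f v) \<Longrightarrow> 0 \<le> maxf V f"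
  using maxf_attained[of V f] by auto

lemma maxf_mono: "finite V \<Longrightarrow> V \<noteq> {} \<Longrightarrow> (\<And>v. v \<in> V \<Longrightarrow> f v \<le> g v) \<Longrightarrow> maxf V f \<le> maxf V g"
  by (rule maxf_le) (auto intro: order_trans[OF _ maxf_ge])

lemma maxf_cong: "(\<And>v. v \<in> V \<Longrightarrow> f v = g v) \<Longrightarrow> maxf V f = maxf V g"
  unfolding maxf_def by (metis (no_types, lifting) image_cong)

text \<open>A union bound at order \<open>2 * (n * m)\<close>, where \<open>27 ^ (n * m)\<close>
  points cost a factor 27 and 27 * 18 = 486; Jensen then goes down to order \<open>2 * n\<close>.
  Having the same order for all \<open>m\<close> lets the levels of a chain be added by Minkowski's
  inequality.\<close>

lemma rademacher_max_moment:
  fixes w :: "'v \<Rightarrow> 'i \<Rightarrow> complex"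
  assumes I: "finite I" and V: "finite V" "V \<noteq> {}" "card V \<le> 27 ^ (n * m)" and nm: "0 < n" "0 < m"
    and W: "0 < W" "\<And>v. v \<in> V \<Longrightarrow> (\<Sum>i\<in>I. (cmod (w v i))\<^sup>2) \<le> W"
  shows "avg (Pow I) (\<lambda>X. maxf V (\<lambda>v. cmod (\<Sum>i\<in>I. eps X i * w v i)) ^ (2 * n)) \<le> (486 * real (n * m) * W) ^ n"
proof (rule avg_le_of_power)
  let ?Z = "\<lambda>X v. cmod (\<Sum>i\<in>I. eps X i * w v i)"
  have Z0: "0 \<le> maxf V (?Z X)" for X using V by (intro maxf_nonneg) auto
  have "avg (Pow I) (\<lambda>X. (maxf V (?Z X) ^ (2 * n)) ^ m) \<le> avg (Pow I) (\<lambda>X. \<Sum>v\<in>V. ?Z X v ^ (2 * (n * m)))"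
  proof (rule avg_mono)
    fix X
    obtain v where v: "v \<in> V" "maxf V (?Z X) = ?Z X v" using maxf_attained[OF V(1,2)] by blast
    have "(maxf V (?Z X) ^ (2 * n)) ^ m = ?Z X v ^ (2 * (n * m))"
      by (simp add: v power_mult[symmetric] mult.assoc)
    also have "\<dots> \<le> (\<Sum>v\<in>V. ?Z X v ^ (2 * (n * m)))"
      using V v by (intro member_le_sum) auto
    finally show "(maxf V (?Z X) ^ (2 * n)) ^ m \<le> (\<Sum>v\<in>V. ?Z X v ^ (2 * (n * m)))" .
  qed
  also have "\<dots> = (\<Sum>v\<in>V. avg (Pow I) (\<lambda>X. ?Z X v ^ (2 * (n * m))))" by (rule avg_sum)
  also have "\<dots> \<le> (\<Sum>v\<in>V. (18 * real (n * m) * W) ^ (n * m))"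
    using nm W by (intro sum_mono rademacher_scalar_moment[OF I]) auto
  also have "\<dots> \<le> 27 ^ (n * m) * (18 * real (n * m) * W) ^ (n * m)"
  proof -
    have "real (card V) \<le> real (27 ^ (n * m))" using V(3) by (rule of_nat_mono)
    hence "real (card V) * (18 * real (n * m) * W) ^ (n * m) \<le> 27 ^ (n * m) * (18 * real (n * m) * W) ^ (n * m)"
      using W by (intro mult_right_mono) (auto simp del: of_nat_mult)
    thus ?thesis by simp
  qed
  also have "\<dots> = ((486 * real (n * m) * W) ^ n) ^ m"
  proof -
    have "27 * (18 * real (n * m) * W) = 486 * real (n * m) * W" by simp
    thus ?thesis unfolding power_mult[symmetric] power_mult_distrib[symmetric] by (simp only:)
  qed
  finally show "avg (Pow I) (\<lambda>X. (maxf V (?Z X) ^ (2 * n)) ^ m) \<le> ((486 * real (n * m) * W) ^ n) ^ m" .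
qed (use I nm W in \<open>auto simp del: of_nat_mult\<close>)

lemma lin_add: "lin D v (\<lambda>j. x j + y j) = lin D v x + lin D v y"
  by (simp add: lin_def algebra_simps sum.distrib)

lemma lin_scale: "lin D v (\<lambda>j. h * x j) = complex_of_real h * lin D v x"
  by (simp add: lin_def algebra_simps sum_distrib_left)

lemma lin_minus: "lin D v (\<lambda>j. - x j) = - lin D v x"
  by (simp add: lin_def sum_negf)

lemma lin_diff: "lin D v (\<lambda>j. x j - y j) = lin D v x - lin D v y"
  by (simp add: lin_def algebra_simps sum_subtractf)

lemma lin_zero [simp]: "lin D v (\<lambda>_. 0) = 0"
  by (simp add: lin_def)

lemma lin_indicator:
  assumes "O' \<subseteq> {..<D}"
  shows "lin D v (\<lambda>j. if j \<in> O' then c j else 0) = (\<Sum>j\<in>O'. complex_of_real (c j) * v j)"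
proof -
  have "lin D v (\<lambda>j. if j \<in> O' then c j else 0) = (\<Sum>j<D. if j \<in> O' then complex_of_real (c j) * v j else 0)"
    unfolding lin_def by (rule sum.cong) auto
  also have "\<dots> = (\<Sum>j\<in>O'. complex_of_real (c j) * v j)"
    using assms by (simp add: sum.If_cases Int_absorb1)
  finally show ?thesis .
qed

text \<open>\<open>L\<close> is the real part of the sesquilinear form belonging to
  \<open>Q\<close>, and the crude bound \<open>M\<close> makes the supremum finite. The form covers
  both the sampled rows and the signed block sums.\<close>

lemma quadratic_form_extension:
  fixes v :: "'r \<Rightarrow> nat \<Rightarrow> complex" and \<kappa> c :: real
  assumes K: "0 < K" "32 * K \<le> 2 ^ S"
    and net: "\<And>y. y \<in> sparse_net D K S \<Longrightarrow> \<bar>\<kappa> * (\<Sum>r\<in>R. (cmod (lin D (v r) y))\<^sup>2) - c * (\<Sum>j<D. (y j)\<^sup>2)\<bar> \<le> a"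
    and x: "x \<in> sparse_ball D K"
  shows "\<bar>\<kappa> * (\<Sum>r\<in>R. (cmod (lin D (v r) x))\<^sup>2) - c * (\<Sum>j<D. (x j)\<^sup>2)\<bar> \<le> 2 * a"
proof -
  define Q where "Q x = \<kappa> * (\<Sum>r\<in>R. (cmod (lin D (v r) x))\<^sup>2) - c * (\<Sum>j<D. (x j)\<^sup>2)" for x
  define L where "L y z = \<kappa> * (\<Sum>r\<in>R. Re (lin D (v r) y * cnj (lin D (v r) z))) - c * (\<Sum>j<D. y j * z j)" for y z
  define M where "M = \<bar>\<kappa>\<bar> * (\<Sum>r\<in>R. (\<Sum>j<D. cmod (v r j))\<^sup>2) + \<bar>c\<bar>"
  have sq: "(cmod (z + complex_of_real \<delta> * w))\<^sup>2 = (cmod z)\<^sup>2 + 2 * \<delta> * Re (z * cnj w) + \<delta>\<^sup>2 * (cmod w)\<^sup>2" for z w \<delta>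
    by (simp add: cmod_power2) (simp add: power2_eq_square algebra_simps)
  have "\<bar>Q x\<bar> \<le> 2 * a"
  proof (rule sparse_net_extension[OF K, of Q L D M])
    show "Q (\<lambda>j. c * x j) = c\<^sup>2 * Q x" for c x
      by (simp add: Q_def lin_scale norm_mult power_mult_distrib sum_distrib_left[symmetric] algebra_simps)
    show "Q (\<lambda>j. y j + \<delta> * r j) = Q y + 2 * \<delta> * L y r + \<delta>\<^sup>2 * Q r" for y r \<delta>
    proof -
      have 1: "(\<Sum>i\<in>R. (cmod (lin D (v i) (\<lambda>j. y j + \<delta> * r j)))\<^sup>2) = (\<Sum>i\<in>R. (cmod (lin D (v i) y))\<^sup>2)
         + 2 * \<delta> * (\<Sum>i\<in>R. Re (lin D (v i) y * cnj (lin D (v i) r))) + \<delta>\<^sup>2 * (\<Sum>i\<in>R. (cmod (lin D (v i) r))\<^sup>2)"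
        unfolding lin_add lin_scale sq by (simp only: sum.distrib sum_distrib_left)
      have "(y j + \<delta> * r j)\<^sup>2 = (y j)\<^sup>2 + 2 * \<delta> * (y j * r j) + \<delta>\<^sup>2 * (r j)\<^sup>2" for j
        by (simp add: power2_eq_square algebra_simps)
      hence 2: "(\<Sum>j<D. (y j + \<delta> * r j)\<^sup>2) = (\<Sum>j<D. (y j)\<^sup>2) + 2 * \<delta> * (\<Sum>j<D. y j * r j) + \<delta>\<^sup>2 * (\<Sum>j<D. (r j)\<^sup>2)"
        by (simp only: sum.distrib sum_distrib_left)
      show ?thesis unfolding Q_def L_def 1 2 by (simp only: algebra_simps)
    qed
    show "\<bar>Q x\<bar> \<le> M" if x: "x \<in> sparse_ball D K" for x
    proof -
      have s1: "(\<Sum>j<D. (x j)\<^sup>2) \<le> 1" "0 \<le> (\<Sum>j<D. (x j)\<^sup>2)" using x by (auto simp: sparse_ball_def sum_nonneg)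
      have xj: "\<bar>x j\<bar> \<le> 1" if "j < D" for j
      proof -
        have "(x j)\<^sup>2 \<le> (\<Sum>j<D. (x j)\<^sup>2)" using that by (intro member_le_sum) auto
        hence "(x j)\<^sup>2 \<le> 1" using s1 by linarith
        thus ?thesis by (simp add: abs_square_le_1)
      qed
      have "cmod (lin D (v r) x) \<le> (\<Sum>j<D. cmod (v r j))" for r
        unfolding lin_def
        by (rule order_trans[OF norm_sum]) (intro sum_mono, simp add: norm_mult xj mult_left_le)
      hence "(\<Sum>r\<in>R. (cmod (lin D (v r) x))\<^sup>2) \<le> (\<Sum>r\<in>R. (\<Sum>j<D. cmod (v r j))\<^sup>2)"
        by (intro sum_mono power_mono) auto
      hence "\<bar>\<kappa> * (\<Sum>r\<in>R. (cmod (lin D (v r) x))\<^sup>2)\<bar> \<le> \<bar>\<kappa>\<bar> * (\<Sum>r\<in>R. (\<Sum>j<D. cmod (v r j))\<^sup>2)"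
        by (simp add: abs_mult sum_nonneg mult_left_mono)
      moreover have "\<bar>c * (\<Sum>j<D. (x j)\<^sup>2)\<bar> \<le> \<bar>c\<bar>" using s1 by (simp add: abs_mult mult_left_le)
      ultimately show ?thesis unfolding Q_def M_def by linarith
    qed
  qed (use net x in \<open>auto simp: Q_def\<close>)
  thus ?thesis by (simp add: Q_def)
qed

subsection \<open>Bounded orthonormal systems\<close>

lemma avg_PiE_insert:
  assumes "i \<notin> J"
  shows "avg (PiE (insert i J) T) f = avg (T i) (\<lambda>a. avg (PiE J T) (\<lambda>t. f (t(i := a))))"
proof -
  have "bij_betw (\<lambda>(y, g). g(i := y)) (T i \<times> PiE J T) (PiE (insert i J) T)"
    unfolding bij_betw_def using inj_combinator[OF assms, of T] PiE_insert_eq[of i J T] by blast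
  from avg_reindex[OF this, of f] show ?thesis by (simp add: avg_Times)
qed

lemma avg_PiE_coordinate:
  fixes T :: "'b set"
  assumes "finite J" "finite T" "T \<noteq> {}" "i \<in> J"
  shows "avg (PiE J (\<lambda>_. T)) (\<lambda>t. h (t i)) = avg T h"
proof -
  have J: "J = insert i (J - {i})" using assms by auto
  have "finite (PiE (J - {i}) (\<lambda>_. T))" "PiE (J - {i}) (\<lambda>_. T) \<noteq> {}"
    using assms by (auto intro!: finite_PiE simp: PiE_eq_empty_iff)
  thus ?thesis by (subst J, subst avg_PiE_insert) (simp_all add: avg_const)
qed

text \<open>An orthonormal system over the reals: \<open>lin\<close> takes real coefficients, and in
  the application \<open>D\<close> is twice \<open>d\<close>. \<open>n\<close> stands for ln d up to
  a constant: \<open>3 ^ n\<close> dominates the number of rows and the number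
  \<open>2 * D + 1\<close> of lattice moves.\<close>

locale bounded_orthonormal =
  fixes D d n :: nat and u :: "nat \<Rightarrow> nat \<Rightarrow> complex"
  assumes d_pos: "0 < d" and n_pos: "0 < n"
    and u_bound: "r < d \<Longrightarrow> j < D \<Longrightarrow> cmod (u r j) \<le> 1"
    and isometry: "(\<Sum>r<d. (cmod (lin D (u r) x))\<^sup>2) = real d * (\<Sum>j<D. (x j)\<^sup>2)"
    and d_le: "d \<le> 3 ^ n" and D_le: "2 * D + 1 \<le> 3 ^ n"
begin

lemma seminorm_sup: "seminorm_bound (\<lambda>z a. \<forall>r<d. cmod (lin D (u r) z) \<le> a)"
proof
  fix x a h assume "\<forall>r<d. cmod (lin D (u r) x) \<le> a" "0 < a" "0 < (h::real)"
  thus "\<forall>r<d. cmod (lin D (u r) (\<lambda>j. h * x j)) \<le> h * a"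
    by (simp add: lin_scale norm_mult)
next
  fix x y a b assume "\<forall>r<d. cmod (lin D (u r) x) \<le> a" "\<forall>r<d. cmod (lin D (u r) y) \<le> b"
  thus "\<forall>r<d. cmod (lin D (u r) (\<lambda>j. x j + y j)) \<le> a + b"
    unfolding lin_add by (auto intro!: norm_triangle_le add_mono)
qed (auto simp: lin_minus intro: order_trans)

text \<open>One signing has to serve all rows, so the moments of order \<open>2 * n\<close> are
  summed over the rows; this costs \<open>d \<le> 3 ^ n\<close>, and 3 * 18 = 54.\<close>

lemma sup_signing:
  assumes O: "O' \<subseteq> {..<D}" "card O' \<le> 2 ^ s"
  shows "\<exists>X\<subseteq>O'. \<forall>r<d. cmod (lin D (u r) (\<lambda>j. if j \<in> O' then eps X j else 0)) \<le> sqrt (54 * real n) * sqrt (2 ^ s)"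
proof -
  have fin: "finite O'" using O(1) finite_subset by blast
  let ?Z = "\<lambda>X r. cmod (\<Sum>j\<in>O'. eps X j * u r j)"
  have V: "(\<Sum>j\<in>O'. (cmod (u r j))\<^sup>2) \<le> 2 ^ s" if "r < d" for r
  proof -
    have "(\<Sum>j\<in>O'. (cmod (u r j))\<^sup>2) \<le> (\<Sum>j\<in>O'. 1)"
      using O u_bound[OF that] by (intro sum_mono) (auto simp: power_le_one)
    also have "\<dots> \<le> real (2 ^ s)" using O(2) by (simp del: of_nat_power)
    finally show ?thesis by simp
  qed
  have "avg (Pow O') (\<lambda>X. \<Sum>r<d. ?Z X r ^ (2 * n)) = (\<Sum>r<d. avg (Pow O') (\<lambda>X. ?Z X r ^ (2 * n)))"
    by (rule avg_sum)
  also have "\<dots> \<le> (\<Sum>r<d. (18 * real n * 2 ^ s) ^ n)"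
    using V n_pos by (intro sum_mono rademacher_scalar_moment[OF fin]) auto
  also have "\<dots> \<le> 3 ^ n * (18 * real n * 2 ^ s) ^ n"
  proof -
    have "real d \<le> 3 ^ n" using d_le by (metis of_nat_le_iff of_nat_numeral of_nat_power)
    thus ?thesis by (simp add: mult_right_mono)
  qed
  also have "\<dots> = (54 * real n * 2 ^ s) ^ n"
  proof -
    have "3 * (18 * real n * 2 ^ s) = 54 * real n * 2 ^ s" by simp
    thus ?thesis unfolding power_mult_distrib[symmetric] by (simp only:)
  qed
  finally have av: "avg (Pow O') (\<lambda>X. \<Sum>r<d. ?Z X r ^ (2 * n)) \<le> (54 * real n * 2 ^ s) ^ n" .
  obtain X where X: "X \<in> Pow O'"
    and le: "(\<Sum>r<d. ?Z X r ^ (2 * n)) \<le> avg (Pow O') (\<lambda>X. \<Sum>r<d. ?Z X r ^ (2 * n))"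
    using avg_attained[of "Pow O'" "\<lambda>X. \<Sum>r<d. ?Z X r ^ (2 * n)"] fin by auto
  have "?Z X r \<le> sqrt (54 * real n) * sqrt (2 ^ s)" if r: "r < d" for r
  proof -
    have "?Z X r ^ (2 * n) \<le> (\<Sum>r<d. ?Z X r ^ (2 * n))" using r by (intro member_le_sum) auto
    hence "((?Z X r)\<^sup>2) ^ n \<le> (54 * real n * 2 ^ s) ^ n"
      using le av by (simp add: power_mult[symmetric])
    hence "((?Z X r)\<^sup>2) ^ Suc (n - 1) \<le> (54 * real n * 2 ^ s) ^ Suc (n - 1)" using n_pos by simp
    hence "(?Z X r)\<^sup>2 \<le> 54 * real n * 2 ^ s" by (rule power_le_imp_le_base) simp
    thus ?thesis by (simp add: real_le_rsqrt real_sqrt_mult[symmetric])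
  qed
  thus ?thesis using X lin_indicator[OF O(1)] by auto
qed

lemma sup_chain:
  assumes "0 < K" "0 < S"
  shows "\<exists>\<pi>. net_chain D K S \<pi> \<and> (\<forall>s<S. \<forall>y\<in>sparse_net D K S. \<forall>r<d.
      cmod (lin D (u r) (\<pi> (Suc s) y) - lin D (u r) (\<pi> s y)) \<le> 32 * sqrt K * sqrt (54 * real n) / sqrt (2 ^ s))"
proof -
  interpret seminorm_bound "\<lambda>z a. \<forall>r<d. cmod (lin D (u r) z) \<le> a" by (rule seminorm_sup)
  have hyp: "\<exists>X\<subseteq>O'. \<forall>r<d. cmod (lin D (u r) (\<lambda>j. if j \<in> O' then eps X j else 0)) \<le> sqrt (54 * real n) * sqrt (2 ^ s)"
    if "s \<le> S" "O' \<subseteq> {..<D}" "card O' \<le> 2 ^ s" for s O'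
    using sup_signing that by blast
  have pos: "0 < sqrt (54 * real n)" using n_pos by simp
  show ?thesis
    using sparse_net_chain[OF assms pos order_refl hyp] by (simp only: lin_diff)
qed

end

section \<open>Links of chains and symmetrisation\<close>

text \<open>A link is a pair of consecutive approximants, hence described by
  \<open>2 ^ Suc s + 2 ^ s = 3 * 2 ^ s\<close> moves with at most \<open>3 ^ n\<close> choices each;
  the cube of 3 gives 27.\<close>

lemma card_chain_links:
  assumes D: "2 * D + 1 \<le> 3 ^ n" and ch: "net_chain D K S \<pi>" and s: "s < S"
  shows "card ((\<lambda>y. (\<pi> (Suc s) y, \<pi> s y)) ` sparse_net D K S) \<le> 27 ^ (n * 2 ^ s)"
proof -
  define F where "F = sparse_net D K S"
  have F: "finite F" by (simp add: F_def finite_sparse_net)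
  have c: "card (\<pi> s ` F) \<le> (2 * D + 1) ^ (2 ^ s)" "card (\<pi> (Suc s) ` F) \<le> (2 * D + 1) ^ (2 ^ Suc s)"
    using ch s unfolding net_chain_def F_def by (meson less_imp_le Suc_leI)+
  have "card ((\<lambda>y. (\<pi> (Suc s) y, \<pi> s y)) ` F) \<le> card ((\<pi> (Suc s) ` F) \<times> (\<pi> s ` F))"
    using F by (intro card_mono) auto
  also have "\<dots> \<le> (2 * D + 1) ^ (2 ^ Suc s) * (2 * D + 1) ^ (2 ^ s)"
    unfolding card_cartesian_product by (rule mult_le_mono[OF c(2) c(1)])
  also have "\<dots> = (2 * D + 1) ^ (3 * 2 ^ s)" by (simp add: power_add[symmetric])
  also have "\<dots> \<le> (3 ^ n) ^ (3 * 2 ^ s)" using D by (rule power_mono) simp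
  also have "\<dots> = (3 ^ 3) ^ (n * 2 ^ s)" unfolding power_mult[symmetric] by (simp only: mult_ac)
  finally show ?thesis by (simp add: F_def)
qed

lemma sparse_net_nonempty: "sparse_net D K S \<noteq> {}"
  by (metis empty_iff zero_in_sparse_net)

lemma net_chainD:
  assumes "net_chain D K S \<pi>" "y \<in> sparse_net D K S"
  shows "\<pi> 0 y = (\<lambda>_. 0)" "\<pi> S y = y" "\<pi> s y \<in> sparse_net D K S"
  using assms by (auto simp: net_chain_def)

lemma chain_telescope:
  fixes Z :: "(nat \<Rightarrow> real) \<Rightarrow> real"
  assumes ch: "net_chain D K S \<pi>" and y: "y \<in> sparse_net D K S" and Z0: "Z (\<lambda>_. 0) = 0"
  shows "\<bar>Z y\<bar> \<le> (\<Sum>s<S. \<bar>Z (\<pi> (Suc s) y) - Z (\<pi> s y)\<bar>)"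
proof -
  have "Z y = (\<Sum>s<S. Z (\<pi> (Suc s) y) - Z (\<pi> s y))"
    using sum_lessThan_telescope[of "\<lambda>s. Z (\<pi> s y)" S] by (simp add: net_chainD[OF ch y] Z0)
  thus ?thesis using sum_abs[of "\<lambda>s. Z (\<pi> (Suc s) y) - Z (\<pi> s y)" "{..<S}"] by simp
qed

text \<open>The increment of a squared modulus factors into a difference, charged to the supremum
  metric, and a sum, charged to the energies of the two endpoints.\<close>

lemma cmod_sq_diff_le:
  assumes "cmod (a - b) \<le> \<rho>"
  shows "((cmod a)\<^sup>2 - (cmod b)\<^sup>2)\<^sup>2 \<le> \<rho>\<^sup>2 * (2 * ((cmod a)\<^sup>2 + (cmod b)\<^sup>2))"
proof -
  have "\<bar>cmod a - cmod b\<bar> \<le> \<rho>" using assms norm_triangle_ineq3 order_trans by blast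
  hence 1: "(cmod a - cmod b)\<^sup>2 \<le> \<rho>\<^sup>2" using abs_le_square_iff[of "cmod a - cmod b" \<rho>] by simp
  have 2: "(cmod a + cmod b)\<^sup>2 \<le> 2 * ((cmod a)\<^sup>2 + (cmod b)\<^sup>2)"
    using zero_le_power2[of "cmod a - cmod b"] by (simp add: power2_sum power2_diff)
  have "((cmod a)\<^sup>2 - (cmod b)\<^sup>2)\<^sup>2 = (cmod a - cmod b)\<^sup>2 * (cmod a + cmod b)\<^sup>2"
    by (simp add: power_mult_distrib[symmetric] power2_eq_square algebra_simps)
  also have "\<dots> \<le> \<rho>\<^sup>2 * (2 * ((cmod a)\<^sup>2 + (cmod b)\<^sup>2))" using 1 2 by (intro mult_mono) auto
  finally show ?thesis .
qed

lemma add_power_le: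
  fixes a b :: real assumes "0 \<le> a" "0 \<le> b" shows "(a + b) ^ n \<le> (2 * a) ^ n + (2 * b) ^ n"
proof -
  have "(a + b) ^ n \<le> (2 * max a b) ^ n" using assms by (intro power_mono) auto
  also have "\<dots> \<le> (2 * a) ^ n + (2 * b) ^ n" using assms by (simp add: max_def)
  finally show ?thesis .
qed

text \<open>Exchanging the coordinates outside \<open>X\<close> between two independent samples is
  an involution of the product space.\<close>

lemma avg_PiE_symmetrize:
  fixes T :: "'b set" and G :: "('i \<Rightarrow> 'b) \<Rightarrow> ('i \<Rightarrow> 'b) \<Rightarrow> real" and I0 :: "'i set"
  defines "\<Omega> \<equiv> PiE I0 (\<lambda>_. T)"
  shows "avg \<Omega> (\<lambda>t. avg \<Omega> (\<lambda>t'. G t t')) =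
    avg \<Omega> (\<lambda>t. avg \<Omega> (\<lambda>t'. G (\<lambda>i. if i \<in> X then t i else t' i) (\<lambda>i. if i \<in> X then t' i else t i)))"
proof -
  define h where "h = (\<lambda>(t :: 'i \<Rightarrow> 'b, t' :: 'i \<Rightarrow> 'b).
    ((\<lambda>i. if i \<in> X then t i else t' i), (\<lambda>i. if i \<in> X then t' i else t i)))"
  have hh: "h (h p) = p" for p by (cases p) (auto simp: h_def fun_eq_iff)
  have "h p \<in> \<Omega> \<times> \<Omega>" if "p \<in> \<Omega> \<times> \<Omega>" for p
    using that by (cases p) (auto simp: h_def \<Omega>_def PiE_iff extensional_def)
  hence "bij_betw h (\<Omega> \<times> \<Omega>) (\<Omega> \<times> \<Omega>)" by (intro bij_betwI[where g = h]) (auto simp: hh)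
  from avg_reindex[OF this, of "\<lambda>(t, t'). G t t'"] show ?thesis
    by (simp add: avg_Times h_def)
qed

section \<open>Deviation of the energy of sampled rows\<close>

context bounded_orthonormal
begin

definition energy :: "('i \<Rightarrow> nat) \<Rightarrow> 'i set \<Rightarrow> (nat \<Rightarrow> real) \<Rightarrow> real" where
  "energy t I y = (\<Sum>i\<in>I. (cmod (lin D (u (t i)) y))\<^sup>2)"

text \<open>The constant comes from \<open>486 * 4 * 32\<^sup>2 * 54 = 10368\<^sup>2\<close>.\<close>

lemma rademacher_energy_moment:
  assumes K: "0 < K" and S: "0 < S" and I: "finite I" and t: "\<And>i. i \<in> I \<Longrightarrow> t i < d"
    and V: "0 < V" "\<And>y. y \<in> sparse_net D K S \<Longrightarrow> energy t I y \<le> V"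
  shows "avg (Pow I) (\<lambda>X. maxf (sparse_net D K S)
      (\<lambda>y. \<bar>\<Sum>i\<in>I. eps X i * (cmod (lin D (u (t i)) y))\<^sup>2\<bar>) ^ (2 * n))
    \<le> ((10368 * real S * real n * sqrt K)\<^sup>2 * V) ^ n"
proof -
  let ?F = "sparse_net D K S"
  have F: "finite ?F" "?F \<noteq> {}" using finite_sparse_net sparse_net_nonempty by auto
  obtain \<pi> where ch: "net_chain D K S \<pi>" and inc: "\<And>s y r. s < S \<Longrightarrow> y \<in> ?F \<Longrightarrow> r < d \<Longrightarrow>
      cmod (lin D (u r) (\<pi> (Suc s) y) - lin D (u r) (\<pi> s y)) \<le> 32 * sqrt K * sqrt (54 * real n) / sqrt (2 ^ s)"
    using sup_chain[OF K S] by blast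
  define g where "g y i = (cmod (lin D (u (t i)) y))\<^sup>2" for y i
  define Z where "Z X y = (\<Sum>i\<in>I. eps X i * g y i)" for X y
  define P where "P s = (\<lambda>y. (\<pi> (Suc s) y, \<pi> s y)) ` ?F" for s
  define w where "w v i = complex_of_real (g (fst v) i - g (snd v) i)" for v i
  define M where "M s X = maxf (P s) (\<lambda>v. cmod (\<Sum>i\<in>I. eps X i * w v i))" for s X
  have P: "finite (P s)" "P s \<noteq> {}" for s using F by (auto simp: P_def)
  define \<alpha> where "\<alpha> = 10368 * real n * sqrt K * sqrt V"
  have \<alpha>0: "0 < \<alpha>" using K V n_pos by (simp add: \<alpha>_def)
  have Mm: "avg (Pow I) (\<lambda>X. M s X ^ (2 * n)) \<le> \<alpha> ^ (2 * n)" if s: "s < S" for s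
  proof -
    define \<rho> where "\<rho> = 32 * sqrt K * sqrt (54 * real n) / sqrt (2 ^ s)"
    have \<rho>0: "0 < \<rho>" using K n_pos by (simp add: \<rho>_def)
    have W: "(\<Sum>i\<in>I. (cmod (w v i))\<^sup>2) \<le> 4 * \<rho>\<^sup>2 * V" if v: "v \<in> P s" for v
    proof -
      obtain y where y: "y \<in> ?F" "v = (\<pi> (Suc s) y, \<pi> s y)" using v by (auto simp: P_def)
      have "(\<Sum>i\<in>I. (cmod (w v i))\<^sup>2) \<le> (\<Sum>i\<in>I. \<rho>\<^sup>2 * (2 * (g (fst v) i + g (snd v) i)))"
        unfolding w_def norm_of_real g_def power2_abs using inc[OF s y(1)] t
        by (intro sum_mono cmod_sq_diff_le) (simp add: y(2) \<rho>_def)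
      also have "\<dots> = 2 * \<rho>\<^sup>2 * (energy t I (fst v) + energy t I (snd v))"
        by (simp add: energy_def g_def sum.distrib sum_distrib_left distrib_left mult.assoc mult.left_commute)
      also have "\<dots> \<le> 2 * \<rho>\<^sup>2 * (V + V)"
        using V(2) net_chainD(3)[OF ch y(1)] y(2) by (intro mult_left_mono add_mono) auto
      finally show ?thesis by simp
    qed
    have W0: "0 < 4 * \<rho>\<^sup>2 * V" using \<rho>0 V by simp
    have c: "card (P s) \<le> 27 ^ (n * 2 ^ s)" unfolding P_def by (rule card_chain_links[OF D_le ch s])
    have "avg (Pow I) (\<lambda>X. M s X ^ (2 * n)) \<le> (486 * real (n * 2 ^ s) * (4 * \<rho>\<^sup>2 * V)) ^ n"
      unfolding M_def by (rule rademacher_max_moment[OF I P c n_pos _ W0 W]) simp_all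
    \<comment> \<open>The factor \<open>2 ^ s\<close> from the number of links cancels the
      denominator of \<open>\<rho>\<^sup>2\<close>, so all \<open>S\<close> levels contribute the
      same \<open>\<alpha>\<close>.\<close>
    also have "486 * real (n * 2 ^ s) * (4 * \<rho>\<^sup>2 * V) = \<alpha>\<^sup>2"
      using V(1) by (simp add: \<rho>_def \<alpha>_def power_mult_distrib power_divide)
        (simp add: power2_eq_square)
    finally show ?thesis by (simp add: power_mult)
  qed
  have "avg (Pow I) (\<lambda>X. maxf ?F (\<lambda>y. \<bar>Z X y\<bar>) ^ (2 * n)) \<le> avg (Pow I) (\<lambda>X. (\<Sum>s<S. M s X) ^ (2 * n))"
  proof (intro avg_mono power_mono maxf_nonneg maxf_le F)
    fix X y assume y: "y \<in> ?F"
    have "\<bar>Z X y\<bar> \<le> (\<Sum>s<S. \<bar>Z X (\<pi> (Suc s) y) - Z X (\<pi> s y)\<bar>)"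
      by (rule chain_telescope[OF ch y]) (simp add: Z_def g_def)
    also have "\<dots> \<le> (\<Sum>s<S. M s X)"
    proof (rule sum_mono)
      fix s
      let ?v = "(\<pi> (Suc s) y, \<pi> s y)"
      have "complex_of_real (Z X (\<pi> (Suc s) y) - Z X (\<pi> s y)) = (\<Sum>i\<in>I. eps X i * w ?v i)"
        by (simp add: Z_def w_def sum_subtractf right_diff_distrib)
      hence "\<bar>Z X (\<pi> (Suc s) y) - Z X (\<pi> s y)\<bar> = cmod (\<Sum>i\<in>I. eps X i * w ?v i)"
        by (metis norm_of_real)
      also have "\<dots> \<le> M s X"
        unfolding M_def by (rule maxf_ge[OF P(1)]) (use y in \<open>auto simp: P_def\<close>)
      finally show "\<bar>Z X (\<pi> (Suc s) y) - Z X (\<pi> s y)\<bar> \<le> M s X" .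
    qed
    finally show "\<bar>Z X y\<bar> \<le> (\<Sum>s<S. M s X)" .
  qed simp
  also have "\<dots> \<le> (\<Sum>s<S. \<alpha>) ^ (2 * n)"
    by (rule minkowski_avg_sum) (use I \<alpha>0 Mm S P in \<open>auto simp: M_def intro!: maxf_nonneg\<close>)
  also have "\<dots> = ((10368 * real S * real n * sqrt K)\<^sup>2 * V) ^ n"
  proof -
    have "(\<Sum>s<S. \<alpha>)\<^sup>2 = (10368 * real S * real n * sqrt K)\<^sup>2 * V"
      using V(1) by (simp add: \<alpha>_def power_mult_distrib)
    thus ?thesis by (simp only: power_mult)
  qed
  finally show ?thesis by (simp add: Z_def g_def)
qed

definition deviation :: "nat \<Rightarrow> nat \<Rightarrow> ('i \<Rightarrow> nat) \<Rightarrow> 'i set \<Rightarrow> real" where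
  "deviation K S t I = maxf (sparse_net D K S) (\<lambda>y. \<bar>energy t I y - real (card I) * (\<Sum>j<D. (y j)\<^sup>2)\<bar>)"

lemma deviation_nonneg: "0 \<le> deviation K S t I"
  unfolding deviation_def using sparse_net_nonempty finite_sparse_net by (intro maxf_nonneg) auto

text \<open>By Jensen the mean is replaced by an independent sample, exchanging coordinates
  introduces the signs, and the triangle inequality separates the two samples. Convexity bounds
  \<open>(R X t + R X t') ^ (2 * n)\<close> by \<open>4 ^ n\<close> times the mean of the two
  powers.\<close>

lemma deviation_symmetrization:
  fixes I0 :: "'i set"
  assumes I0: "finite I0" "I \<subseteq> I0"
  defines "\<Omega> \<equiv> PiE I0 (\<lambda>_. {..<d})"
  shows "avg \<Omega> (\<lambda>t. deviation K S t I ^ (2 * n)) \<le> 4 ^ n * avg \<Omega> (\<lambda>t. avg (Pow I) (\<lambda>X.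
    maxf (sparse_net D K S) (\<lambda>y. \<bar>\<Sum>i\<in>I. eps X i * (cmod (lin D (u (t i)) y))\<^sup>2\<bar>) ^ (2 * n)))"
proof -
  let ?F = "sparse_net D K S"
  have F: "finite ?F" "?F \<noteq> {}" using finite_sparse_net sparse_net_nonempty by auto
  have I: "finite I" using I0 finite_subset by blast
  have \<Omega>: "finite \<Omega>" "\<Omega> \<noteq> {}"
    using I0 d_pos by (auto simp: \<Omega>_def PiE_eq_empty_iff intro!: finite_PiE)
  define g where "g t y i = (cmod (lin D (u (t i)) y))\<^sup>2" for t :: "'i \<Rightarrow> nat" and y i
  define R where "R X t = maxf ?F (\<lambda>y. \<bar>\<Sum>i\<in>I. eps X i * g t y i\<bar>)" for X t
  define G where "G t t' = maxf ?F (\<lambda>y. \<bar>\<Sum>i\<in>I. g t y i - g t' y i\<bar>)" for t t'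
  have G0: "0 \<le> G t t'" for t t' unfolding G_def using F by (intro maxf_nonneg) auto
  have R0: "0 \<le> R X t" for X t unfolding R_def using F by (intro maxf_nonneg) auto
  have mean: "avg \<Omega> (\<lambda>t'. \<Sum>i\<in>I. g t' y i) = real (card I) * (\<Sum>j<D. (y j)\<^sup>2)" for y
  proof -
    have "avg \<Omega> (\<lambda>t'. g t' y i) = (\<Sum>j<D. (y j)\<^sup>2)" if "i \<in> I" for i
    proof -
      have "avg \<Omega> (\<lambda>t'. g t' y i) = avg {..<d} (\<lambda>r. (cmod (lin D (u r) y))\<^sup>2)"
        unfolding \<Omega>_def g_def using I0 that d_pos by (intro avg_PiE_coordinate) auto
      thus ?thesis using isometry[of y] d_pos by (simp add: avg_def)
    qed
    thus ?thesis by (simp add: avg_sum)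
  qed
  have dev: "deviation K S t I ^ (2 * n) \<le> avg \<Omega> (\<lambda>t'. G t t' ^ (2 * n))" for t
  proof -
    have "deviation K S t I \<le> avg \<Omega> (G t)"
      unfolding deviation_def
    proof (rule maxf_le[OF F])
      fix y assume y: "y \<in> ?F"
      have "energy t I y - real (card I) * (\<Sum>j<D. (y j)\<^sup>2) = avg \<Omega> (\<lambda>t'. \<Sum>i\<in>I. g t y i - g t' y i)"
        unfolding mean[symmetric] sum_subtractf avg_diff by (simp add: avg_const[OF \<Omega>] energy_def g_def)
      also have "\<bar>\<dots>\<bar> \<le> avg \<Omega> (\<lambda>t'. \<bar>\<Sum>i\<in>I. g t y i - g t' y i\<bar>)"
        unfolding avg_def abs_divide by (simp add: divide_right_mono)
      also have "\<dots> \<le> avg \<Omega> (G t)"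
        unfolding G_def using y F by (intro avg_mono maxf_ge)
      finally show "\<bar>energy t I y - real (card I) * (\<Sum>j<D. (y j)\<^sup>2)\<bar> \<le> avg \<Omega> (G t)" .
    qed
    hence "deviation K S t I ^ (2 * n) \<le> avg \<Omega> (G t) ^ (2 * n)"
      by (intro power_mono deviation_nonneg)
    also have "\<dots> \<le> avg \<Omega> (\<lambda>t'. G t t' ^ (2 * n))" by (rule avg_power_le[OF \<Omega> G0])
    finally show ?thesis .
  qed
  have sw: "avg \<Omega> (\<lambda>t. avg \<Omega> (\<lambda>t'. G t t' ^ (2 * n))) \<le>
      avg \<Omega> (\<lambda>t. avg \<Omega> (\<lambda>t'. (4 ^ n / 2) * (R X t ^ (2 * n) + R X t' ^ (2 * n))))" for X
  proof -
    have "avg \<Omega> (\<lambda>t. avg \<Omega> (\<lambda>t'. G t t' ^ (2 * n))) = avg \<Omega> (\<lambda>t. avg \<Omega> (\<lambda>t'.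
       G (\<lambda>i. if i \<in> X then t i else t' i) (\<lambda>i. if i \<in> X then t' i else t i) ^ (2 * n)))"
      unfolding \<Omega>_def by (rule avg_PiE_symmetrize)
    also have "\<dots> \<le> avg \<Omega> (\<lambda>t. avg \<Omega> (\<lambda>t'. (4 ^ n / 2) * (R X t ^ (2 * n) + R X t' ^ (2 * n))))"
    proof (intro avg_mono)
      fix t t' :: "'i \<Rightarrow> nat"
      let ?t = "\<lambda>i. if i \<in> X then t i else t' i" and ?t' = "\<lambda>i. if i \<in> X then t' i else t i"
      have "G ?t ?t' \<le> R X t + R X t'"
        unfolding G_def
      proof (rule maxf_le[OF F])
        fix y assume y: "y \<in> ?F"
        have "(\<Sum>i\<in>I. g ?t y i - g ?t' y i) = (\<Sum>i\<in>I. eps X i * g t y i) - (\<Sum>i\<in>I. eps X i * g t' y i)"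
          unfolding sum_subtractf[symmetric] by (rule sum.cong) (auto simp: g_def eps_def)
        hence "\<bar>\<Sum>i\<in>I. g ?t y i - g ?t' y i\<bar> \<le> \<bar>\<Sum>i\<in>I. eps X i * g t y i\<bar> + \<bar>\<Sum>i\<in>I. eps X i * g t' y i\<bar>"
          by simp
        also have "\<dots> \<le> R X t + R X t'" unfolding R_def using y F by (intro add_mono maxf_ge)
        finally show "\<bar>\<Sum>i\<in>I. g ?t y i - g ?t' y i\<bar> \<le> R X t + R X t'" .
      qed
      hence "G ?t ?t' ^ (2 * n) \<le> (R X t + R X t') ^ (2 * n)" by (intro power_mono G0)
      also have "\<dots> = 4 ^ n * (1/2 * R X t + 1/2 * R X t') ^ (2 * n)"
        by (simp add: power_mult power_mult_distrib[symmetric] power2_eq_square algebra_simps)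
      also have "(1/2 * R X t + 1/2 * R X t') ^ (2 * n) \<le> 1/2 * R X t ^ (2 * n) + 1/2 * R X t' ^ (2 * n)"
        using convex_onD[OF convex_on_power[of "2 * n"], of "1/2" "R X t" "R X t'"] R0 by simp
      finally show "G ?t ?t' ^ (2 * n) \<le> (4 ^ n / 2) * (R X t ^ (2 * n) + R X t' ^ (2 * n))"
        by (simp add: algebra_simps)
    qed
    finally show ?thesis .
  qed
  have sw': "avg \<Omega> (\<lambda>t. avg \<Omega> (\<lambda>t'. G t t' ^ (2 * n))) \<le> 4 ^ n * avg \<Omega> (\<lambda>t. R X t ^ (2 * n))" for X
  proof -
    have "avg \<Omega> (\<lambda>t. avg \<Omega> (\<lambda>t'. (4 ^ n / 2) * (R X t ^ (2 * n) + R X t' ^ (2 * n))))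
      = (4 ^ n / 2) * (avg \<Omega> (\<lambda>t. R X t ^ (2 * n)) + avg \<Omega> (\<lambda>t'. R X t' ^ (2 * n)))"
      by (simp only: avg_cmult avg_add avg_const[OF \<Omega>])
    thus ?thesis using sw[of X] by simp
  qed
  have "avg \<Omega> (\<lambda>t. deviation K S t I ^ (2 * n)) \<le> avg \<Omega> (\<lambda>t. avg \<Omega> (\<lambda>t'. G t t' ^ (2 * n)))"
    by (rule avg_mono) (rule dev)
  also have "\<dots> = avg (Pow I) (\<lambda>X. avg \<Omega> (\<lambda>t. avg \<Omega> (\<lambda>t'. G t t' ^ (2 * n))))"
    using I by simp
  also have "\<dots> \<le> avg (Pow I) (\<lambda>X. 4 ^ n * avg \<Omega> (\<lambda>t. R X t ^ (2 * n)))"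
    by (rule avg_mono) (rule sw')
  also have "\<dots> = 4 ^ n * avg \<Omega> (\<lambda>t. avg (Pow I) (\<lambda>X. R X t ^ (2 * n)))"
    by (simp only: avg_cmult, subst avg_swap, rule refl)
  finally show ?thesis unfolding R_def g_def .
qed

text \<open>The energy in the symmetrised bound is at most \<open>card I + \<Delta>\<close> with
  \<open>\<Delta>\<close> the deviation itself. By \<open>4 * \<Gamma>\<^sup>2 * \<Delta> \<le> 16 *
  \<Gamma> ^ 4 + \<Delta>\<^sup>2 / 4\<close> only half of the moment reappears on the right, where
  it can be absorbed.\<close>

theorem deviation_moment:
  fixes I0 :: "'i set"
  assumes K: "0 < K" and S: "0 < S" and I0: "finite I0" "I \<subseteq> I0" "I \<noteq> {}"
  defines "\<Omega> \<equiv> PiE I0 (\<lambda>_. {..<d})" and "\<Gamma> \<equiv> 10368 * real S * real n * sqrt K"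
  shows "avg \<Omega> (\<lambda>t. deviation K S t I ^ (2 * n)) \<le> 2 * (8 * \<Gamma>\<^sup>2 * real (card I) + 32 * \<Gamma> ^ 4) ^ n"
proof -
  have I: "finite I" using I0 finite_subset by blast
  have cI: "0 < real (card I)" using I I0(3) by (simp add: card_gt_0_iff)
  define B where "B = 8 * \<Gamma>\<^sup>2 * real (card I) + 32 * \<Gamma> ^ 4"
  let ?E = "avg \<Omega> (\<lambda>t. deviation K S t I ^ (2 * n))"
  have \<Omega>: "finite \<Omega>" "\<Omega> \<noteq> {}"
    using I0 d_pos by (auto simp: \<Omega>_def PiE_eq_empty_iff intro!: finite_PiE)
  have pt: "4 ^ n * avg (Pow I) (\<lambda>X. maxf (sparse_net D K S)
      (\<lambda>y. \<bar>\<Sum>i\<in>I. eps X i * (cmod (lin D (u (t i)) y))\<^sup>2\<bar>) ^ (2 * n))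
      \<le> B ^ n + 1/2 * deviation K S t I ^ (2 * n)" if t: "t \<in> \<Omega>" for t
  proof -
    define \<Delta> where "\<Delta> = deviation K S t I"
    define V where "V = real (card I) + \<Delta>"
    have \<Delta>0: "0 \<le> \<Delta>" by (simp add: \<Delta>_def deviation_nonneg)
    have V0: "0 < V" using cI \<Delta>0 by (simp add: V_def)
    have V: "energy t I y \<le> V" if y: "y \<in> sparse_net D K S" for y
    proof -
      have "\<bar>energy t I y - real (card I) * (\<Sum>j<D. (y j)\<^sup>2)\<bar> \<le> \<Delta>"
        unfolding \<Delta>_def deviation_def by (rule maxf_ge[OF finite_sparse_net y])
      moreover have "real (card I) * (\<Sum>j<D. (y j)\<^sup>2) \<le> real (card I) * 1"
        using y by (intro mult_left_mono) (auto simp: sparse_net_def sparse_ball_def)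
      ultimately show ?thesis unfolding V_def by linarith
    qed
    have td: "t i < d" if "i \<in> I" for i using t that I0 by (auto simp: \<Omega>_def PiE_iff)
    have "4 ^ n * avg (Pow I) (\<lambda>X. maxf (sparse_net D K S)
      (\<lambda>y. \<bar>\<Sum>i\<in>I. eps X i * (cmod (lin D (u (t i)) y))\<^sup>2\<bar>) ^ (2 * n)) \<le> 4 ^ n * (\<Gamma>\<^sup>2 * V) ^ n"
      unfolding \<Gamma>_def by (intro mult_left_mono rademacher_energy_moment[OF K S I td V0 V]) auto
    also have "\<dots> = (4 * (\<Gamma>\<^sup>2 * V)) ^ n" by (simp only: power_mult_distrib)
    also have "\<dots> \<le> ((4 * \<Gamma>\<^sup>2 * real (card I) + 16 * \<Gamma> ^ 4) + \<Delta>\<^sup>2 / 4) ^ n"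
    proof (rule power_mono)
      have "0 \<le> (4 * \<Gamma>\<^sup>2 - \<Delta> / 2)\<^sup>2" by simp
      also have "\<dots> = 16 * \<Gamma> ^ 4 - 4 * \<Gamma>\<^sup>2 * \<Delta> + \<Delta>\<^sup>2 / 4"
        by (simp add: power2_eq_square power4_eq_xxxx algebra_simps)
      finally show "4 * (\<Gamma>\<^sup>2 * V) \<le> (4 * \<Gamma>\<^sup>2 * real (card I) + 16 * \<Gamma> ^ 4) + \<Delta>\<^sup>2 / 4"
        by (simp add: V_def algebra_simps)
    qed (use V0 in simp)
    also have "\<dots> \<le> (2 * (4 * \<Gamma>\<^sup>2 * real (card I) + 16 * \<Gamma> ^ 4)) ^ n + (2 * (\<Delta>\<^sup>2 / 4)) ^ n"
      by (rule add_power_le) auto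
    also have "(2 * (\<Delta>\<^sup>2 / 4)) ^ n \<le> 1/2 * \<Delta> ^ (2 * n)"
    proof -
      have "(2 * (\<Delta>\<^sup>2 / 4)) ^ n = (1/2) ^ n * \<Delta> ^ (2 * n)"
        unfolding power_mult power_mult_distrib[symmetric] by simp
      also have "\<dots> \<le> 1/2 * \<Delta> ^ (2 * n)"
      proof (rule mult_right_mono)
        show "(1/2) ^ n \<le> (1/2 :: real)" using power_decreasing[of 1 n "1/2::real"] n_pos by simp
      qed (use \<Delta>0 in simp)
      finally show ?thesis .
    qed
    finally show ?thesis by (simp add: B_def \<Delta>_def algebra_simps)
  qed
  have "?E \<le> 4 ^ n * avg \<Omega> (\<lambda>t. avg (Pow I) (\<lambda>X.
    maxf (sparse_net D K S) (\<lambda>y. \<bar>\<Sum>i\<in>I. eps X i * (cmod (lin D (u (t i)) y))\<^sup>2\<bar>) ^ (2 * n)))"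
    unfolding \<Omega>_def by (rule deviation_symmetrization[OF I0(1,2)])
  also have "\<dots> \<le> avg \<Omega> (\<lambda>t. B ^ n + 1/2 * deviation K S t I ^ (2 * n))"
    unfolding avg_cmult[of \<Omega>, symmetric] by (rule avg_mono) (rule pt)
  also have "\<dots> = B ^ n + 1/2 * ?E" by (simp only: avg_add avg_cmult avg_const[OF \<Omega>])
  finally show ?thesis unfolding B_def by linarith
qed

end

subsection \<open>The chaos of a signed block construction\<close>

text \<open>Of the four ways in which a random set meets two distinct cells, exactly one contains
  \<open>k\<close> and avoids \<open>k'\<close>; a cell is never separated from itself.\<close>

lemma decoupling_weight:
  assumes "finite L" "k \<in> L" "k' \<in> L"
  shows "avg (Pow L) (\<lambda>I. if k \<in> I \<and> k' \<notin> I then c else 0) = (if k = k' then 0 else c / 4)"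
proof (cases "k = k'")
  case False
  define L' where "L' = L - {k, k'}"
  have L: "L = insert k (insert k' L')" "finite L'" "k \<notin> insert k' L'" "k' \<notin> L'"
    using assms False by (auto simp: L'_def)
  have "avg (Pow L) (\<lambda>I. if k \<in> I \<and> k' \<notin> I then c else 0) = avg (Pow L') (\<lambda>I. c / 4)"
    unfolding L(1) using L False
    by (simp add: avg_Pow_insert del: avg_Pow_const) (intro avg_cong, auto)
  thus ?thesis using L(2) False by simp
qed (use assms in simp)

text \<open>The tangent of the square root at \<open>c\<close>. It plays the part of Jensen's
  inequality for a concave function and keeps the bounds affine in the mean error.\<close>

lemma sqrt_le_linear:
  assumes "0 < c" "0 \<le> x" shows "sqrt x \<le> x / (2 * sqrt c) + sqrt c / 2"
proof -
  have "0 \<le> (sqrt x - sqrt c)\<^sup>2" by simp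
  hence "2 * (sqrt x * sqrt c) \<le> x + c" using assms by (simp add: power2_diff)
  hence "sqrt x * sqrt c \<le> (x + sqrt c * sqrt c) / 2" using assms by simp
  hence "sqrt x \<le> (x + sqrt c * sqrt c) / 2 / sqrt c" using assms by (simp add: pos_le_divide_eq)
  also have "\<dots> = x / (2 * sqrt c) + sqrt c / 2" using assms by (simp add: add_divide_distrib real_div_sqrt)
  finally show ?thesis .
qed

text \<open>The rows are frozen and only the signs remain random. \<open>signing\<close> is the
  input for chaining in the normalised mean over the blocks, raised to the power
  \<open>2 * p\<close>; \<open>BK\<close> is what allows this mean to replace the maximum.\<close>

locale signed_blocks =
  fixes D m B n K S p :: nat and a :: "nat \<times> nat \<Rightarrow> nat \<Rightarrow> complex" and \<beta> :: "nat \<Rightarrow> real"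
  assumes pos: "0 < m" "0 < B" "0 < n" "0 < K" "0 < S" "0 < p"
    and entry: "b < m \<Longrightarrow> i < B \<Longrightarrow> j < D \<Longrightarrow> cmod (a (b, i) j) \<le> 1"
    and D_le: "2 * D + 1 \<le> 3 ^ n"
    and BK: "B * K \<le> 2 ^ (p - 1)"
    and beta_pos: "0 < \<beta> s" and beta_anti: "\<beta> (Suc s) \<le> \<beta> s"
    and signing: "s \<le> S \<Longrightarrow> O' \<subseteq> {..<D} \<Longrightarrow> card O' \<le> 2 ^ s \<Longrightarrow>
      \<exists>X\<subseteq>O'. (\<Sum>b<m. (\<Sum>i<B. (cmod (lin D (a (b, i)) (\<lambda>j. if j \<in> O' then eps X j else 0)))\<^sup>2) ^ p)
        \<le> real m * real B ^ p * (\<beta> s * sqrt (2 ^ s)) ^ (2 * p)"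
    and total_energy: "y \<in> sparse_net D K S \<Longrightarrow> (\<Sum>b<m. \<Sum>i<B. (cmod (lin D (a (b, i)) y))\<^sup>2) \<le> 2 * real (m * B)"
begin

definition cells :: "(nat \<times> nat) set" where "cells = {..<m} \<times> {..<B}"

definition bnorm :: "(nat \<Rightarrow> real) \<Rightarrow> nat \<Rightarrow> real" where
  "bnorm z b = L2_set (\<lambda>i. cmod (lin D (a (b, i)) z)) {..<B}"

lemma bnorm_sq: "(bnorm z b)\<^sup>2 = (\<Sum>i<B. (cmod (lin D (a (b, i)) z))\<^sup>2)"
  unfolding bnorm_def L2_set_def by (simp add: sum_nonneg)

lemma bnorm_nonneg: "0 \<le> bnorm z b" by (simp add: bnorm_def)

text \<open>The predicate says that \<open>(bnorm z b / sqrt B) ^ (2 * p)\<close> has average at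
  most \<open>\<alpha> ^ (2 * p)\<close> over the blocks, so the triangle inequality is Minkowski's
  with \<open>c = m * B ^ p\<close>.\<close>

lemma seminorm_blocks: "seminorm_bound (\<lambda>z \<alpha>. (\<Sum>b<m. bnorm z b ^ (2 * p)) \<le> (real m * real B ^ p) * \<alpha> ^ (2 * p))"
proof
  fix x y and \<alpha> \<gamma> :: real
  assume *: "(\<Sum>b<m. bnorm x b ^ (2 * p)) \<le> (real m * real B ^ p) * \<alpha> ^ (2 * p)"
    "(\<Sum>b<m. bnorm y b ^ (2 * p)) \<le> (real m * real B ^ p) * \<gamma> ^ (2 * p)" "0 < \<alpha>" "0 < \<gamma>"
  have "bnorm (\<lambda>j. x j + y j) b \<le> bnorm x b + bnorm y b" for b
    unfolding bnorm_def lin_add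
    by (rule order_trans[OF L2_set_mono L2_set_triangle_ineq]) (auto intro: norm_triangle_ineq)
  hence "(\<Sum>b<m. bnorm (\<lambda>j. x j + y j) b ^ (2 * p)) \<le> (\<Sum>b<m. (bnorm x b + bnorm y b) ^ (2 * p))"
    by (intro sum_mono power_mono bnorm_nonneg)
  also have "\<dots> \<le> (real m * real B ^ p) * (\<alpha> + \<gamma>) ^ (2 * p)"
    using * by (intro minkowski_sum_power bnorm_nonneg)
  finally show "(\<Sum>b<m. bnorm (\<lambda>j. x j + y j) b ^ (2 * p)) \<le> (real m * real B ^ p) * (\<alpha> + \<gamma>) ^ (2 * p)" .
next
  fix x and \<alpha> h :: real
  assume *: "(\<Sum>b<m. bnorm x b ^ (2 * p)) \<le> (real m * real B ^ p) * \<alpha> ^ (2 * p)" "0 < \<alpha>" "0 < h"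
  have "bnorm (\<lambda>j. h * x j) b = h * bnorm x b" for b
    using *(3) by (simp add: bnorm_def lin_scale norm_mult L2_set_right_distrib)
  hence "(\<Sum>b<m. bnorm (\<lambda>j. h * x j) b ^ (2 * p)) = h ^ (2 * p) * (\<Sum>b<m. bnorm x b ^ (2 * p))"
    by (simp add: power_mult_distrib sum_distrib_left)
  also have "\<dots> \<le> h ^ (2 * p) * ((real m * real B ^ p) * \<alpha> ^ (2 * p))" using * by (intro mult_left_mono) auto
  finally show "(\<Sum>b<m. bnorm (\<lambda>j. h * x j) b ^ (2 * p)) \<le> (real m * real B ^ p) * (h * \<alpha>) ^ (2 * p)"
    by (simp add: power_mult_distrib mult_ac)
next
  fix x and \<alpha> \<gamma> :: real
  assume *: "(\<Sum>b<m. bnorm x b ^ (2 * p)) \<le> (real m * real B ^ p) * \<alpha> ^ (2 * p)" "0 < \<alpha>" "\<alpha> \<le> \<gamma>"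
  have "(real m * real B ^ p) * \<alpha> ^ (2 * p) \<le> (real m * real B ^ p) * \<gamma> ^ (2 * p)"
    using * by (intro mult_left_mono power_mono) auto
  with *(1) show "(\<Sum>b<m. bnorm x b ^ (2 * p)) \<le> (real m * real B ^ p) * \<gamma> ^ (2 * p)" by linarith
next
  fix \<alpha> :: real assume "0 < \<alpha>"
  thus "(\<Sum>b<m. bnorm (\<lambda>_. 0) b ^ (2 * p)) \<le> (real m * real B ^ p) * \<alpha> ^ (2 * p)"
    using pos by (simp add: bnorm_def L2_set_def power_0_left)
qed (simp add: bnorm_def lin_minus)

lemma block_chain:
  "\<exists>\<pi>. net_chain D K S \<pi> \<and> (\<forall>s<S. \<forall>y\<in>sparse_net D K S.
    (\<Sum>b<m. bnorm (\<lambda>j. \<pi> (Suc s) y j - \<pi> s y j) b ^ (2 * p))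
      \<le> (real m * real B ^ p) * (32 * sqrt K * \<beta> s / sqrt (2 ^ s)) ^ (2 * p))"
proof -
  interpret seminorm_bound "\<lambda>z \<alpha>. (\<Sum>b<m. bnorm z b ^ (2 * p)) \<le> (real m * real B ^ p) * \<alpha> ^ (2 * p)"
    by (rule seminorm_blocks)
  have "\<exists>X\<subseteq>O'. (\<Sum>b<m. bnorm (\<lambda>j. if j \<in> O' then eps X j else 0) b ^ (2 * p))
     \<le> (real m * real B ^ p) * (\<beta> s * sqrt (2 ^ s)) ^ (2 * p)"
    if "s \<le> S" "O' \<subseteq> {..<D}" "card O' \<le> 2 ^ s" for s O'
    using signing[OF that] unfolding bnorm_sq[symmetric] power_mult[symmetric] by simp
  from sparse_net_chain[OF pos(4,5) beta_pos beta_anti this] show ?thesis .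
qed

section \<open>Partial signed sums and their links\<close>

text \<open>For \<open>T = cells\<close> this is coordinate \<open>b\<close> of the signed matrix
  applied to \<open>y\<close>; other \<open>T\<close> give the two halves of the random
  split.\<close>

definition phi :: "(nat \<times> nat) set \<Rightarrow> (nat \<times> nat) set \<Rightarrow> nat \<Rightarrow> (nat \<Rightarrow> real) \<Rightarrow> complex" where
  "phi T X b y = (\<Sum>i<B. complex_of_real (if (b, i) \<in> T then eps X (b, i) else 0) * lin D (a (b, i)) y)"

lemma phi_diff: "phi T X b (\<lambda>j. x j - y j) = phi T X b x - phi T X b y"
  by (simp add: phi_def lin_diff right_diff_distrib sum_subtractf)

lemma phi_zero: "phi T X b (\<lambda>_. 0) = 0"
  by (simp add: phi_def)

lemma phi_Un:
  assumes "T \<inter> Y = {}" shows "phi T (X \<union> Y) b y = phi T X b y"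
  unfolding phi_def using assms by (intro sum.cong) (auto simp: eps_def)

lemma phi_compl: "phi T (T - X) b y = - phi T X b y"
  unfolding phi_def sum_negf[symmetric] by (intro sum.cong) (auto simp: eps_def)

lemma phi_split:
  assumes "T \<inter> J = {}" shows "phi (T \<union> J) X b y = phi T X b y + phi J X b y"
  unfolding phi_def sum.distrib[symmetric] using assms by (intro sum.cong) auto

lemma cmod_lin_le:
  assumes y: "y \<in> sparse_net D K S" and "b < m" "i < B"
  shows "cmod (lin D (a (b, i)) y) \<le> sqrt K"
proof -
  have "cmod (lin D (a (b, i)) y) \<le> (\<Sum>j<D. cmod (a (b, i) j) * \<bar>y j\<bar>)"
    unfolding lin_def by (rule order_trans[OF norm_sum]) (simp add: norm_mult)
  also have "\<dots> \<le> (\<Sum>j<D. 1 * \<bar>y j\<bar>)"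
    using assms entry by (intro sum_mono mult_right_mono) auto
  also have "\<dots> \<le> sqrt K" using sparse_ball_l1[of y D K] y by (simp add: sparse_net_def)
  finally show ?thesis .
qed

lemma cmod_phi_le:
  assumes y: "y \<in> sparse_net D K S" and b: "b < m"
  shows "(cmod (phi T X b y))\<^sup>2 \<le> real B * real (B * K)"
proof -
  have "cmod (phi T X b y) \<le> (\<Sum>i<B. sqrt K)"
    unfolding phi_def
    by (rule order_trans[OF norm_sum], rule sum_mono)
      (use cmod_lin_le[OF y b] in \<open>auto simp: norm_mult\<close>)
  hence "(cmod (phi T X b y))\<^sup>2 \<le> (real B * sqrt K)\<^sup>2" by (intro power_mono) auto
  thus ?thesis by (simp add: power_mult_distrib power2_eq_square mult_ac)
qed

text \<open>The inequality \<open>w * v \<le> 2 * v + w ^ p\<close> for \<open>v \<le> 2 ^ (p - 1)\<close> takes the place of Hoelder's inequality.\<close>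

lemma block_product_le:
  assumes \<rho>: "0 < \<rho>" and z: "(\<Sum>b<m. bnorm z b ^ (2 * p)) \<le> (real m * real B ^ p) * \<rho> ^ (2 * p)"
    and f0: "\<And>b. b < m \<Longrightarrow> 0 \<le> f b" and fBK: "\<And>b. b < m \<Longrightarrow> f b \<le> real B * real (B * K)"
    and G: "(\<Sum>b<m. f b) \<le> G"
  shows "(\<Sum>b<m. (bnorm z b)\<^sup>2 * f b) \<le> real B * \<rho>\<^sup>2 * (2 * G + real (m * B))"
proof -
  \<comment> \<open>The squared block norm in units of \<open>B * \<rho>\<^sup>2\<close>, so that
    the p-th powers average at most 1 over the blocks.\<close>
  define \<omega> where "\<omega> b = (bnorm z b)\<^sup>2 / (real B * \<rho>\<^sup>2)" for b
  define v where "v b = f b / real B" for b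
  have B0: "0 < real B" using pos by simp
  have \<omega>0: "0 \<le> \<omega> b" for b using \<rho> by (simp add: \<omega>_def)
  have pt: "\<omega> b * v b \<le> 2 * v b + \<omega> b ^ p" if b: "b < m" for b
  proof (cases "\<omega> b \<le> 2")
    case True
    hence "\<omega> b * v b \<le> 2 * v b" using f0[OF b] B0 by (intro mult_right_mono) (auto simp: v_def)
    thus ?thesis using \<omega>0[of b] by (simp add: add_increasing2)
  next
    case False
    have "v b \<le> real (B * K)" using fBK[OF b] B0 by (simp add: v_def divide_le_eq mult.commute)
    also have "\<dots> \<le> real (2 ^ (p - 1))" using BK by (rule of_nat_mono)
    also have "\<dots> \<le> \<omega> b ^ (p - 1)" using False by (simp add: power_mono)
    finally have "\<omega> b * v b \<le> \<omega> b * \<omega> b ^ (p - 1)" using \<omega>0 by (intro mult_left_mono)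
    also have "\<dots> = \<omega> b ^ p" using pos(6) by (cases p) auto
    finally show ?thesis using f0[OF b] B0 by (simp add: v_def add_increasing)
  qed
  have \<omega>p: "(\<Sum>b<m. \<omega> b ^ p) \<le> real m"
  proof -
    have "(\<Sum>b<m. \<omega> b ^ p) = (\<Sum>b<m. bnorm z b ^ (2 * p)) / (real B ^ p * \<rho> ^ (2 * p))"
      by (simp add: \<omega>_def power_divide power_mult_distrib power_mult sum_divide_distrib)
    also have "\<dots> \<le> real m" using z B0 \<rho> by (simp add: divide_le_eq mult_ac)
    finally show ?thesis .
  qed
  have "(\<Sum>b<m. \<omega> b * v b) \<le> (\<Sum>b<m. 2 * v b + \<omega> b ^ p)" by (intro sum_mono pt) simp
  also have "\<dots> = 2 * (\<Sum>b<m. f b) / real B + (\<Sum>b<m. \<omega> b ^ p)"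
    by (simp add: v_def sum.distrib sum_distrib_left sum_divide_distrib)
  also have "\<dots> \<le> 2 * G / real B + real m"
    using G \<omega>p B0 by (intro add_mono divide_right_mono) auto
  finally have "(\<Sum>b<m. \<omega> b * v b) \<le> 2 * G / real B + real m" .
  hence "(real B * real B * \<rho>\<^sup>2) * (\<Sum>b<m. \<omega> b * v b) \<le> (real B * real B * \<rho>\<^sup>2) * (2 * G / real B + real m)"
    using B0 by (intro mult_left_mono) auto
  moreover have "(real B * real B * \<rho>\<^sup>2) * (\<Sum>b<m. \<omega> b * v b) = (\<Sum>b<m. (bnorm z b)\<^sup>2 * f b)"
    unfolding sum_distrib_left using B0 \<rho> by (intro sum.cong) (auto simp: \<omega>_def v_def)
  moreover have "(real B * real B * \<rho>\<^sup>2) * (2 * G / real B + real m) = real B * \<rho>\<^sup>2 * (2 * G + real (m * B))"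
    using B0 by (simp add: field_simps)
  ultimately show ?thesis by simp
qed

text \<open>The constant comes from \<open>486 * 32\<^sup>2 \<le> 736\<^sup>2\<close>.\<close>

definition link_bound :: "nat \<Rightarrow> real \<Rightarrow> real" where
  "link_bound s G = 736 * \<beta> s * sqrt (real (n * K * B)) * sqrt (2 * G + real (m * B))"

text \<open>\<open>\<psi>\<close> stands for the signed sums over the complementary cells, frozen
  while the signs in \<open>T\<close> vary, and \<open>sel\<close> selects the endpoint of the link
  at which they are taken. What remains is a Rademacher sum with coefficients \<open>w v\<close>,
  whose square sum is bounded by \<open>block_product_le\<close>; as before \<open>2 ^ s\<close>
  cancels against the metric.\<close>

lemma link_moment:
  fixes \<psi> :: "nat \<Rightarrow> (nat \<Rightarrow> real) \<Rightarrow> complex"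
  assumes ch: "net_chain D K S \<pi>" and s: "s < S"
    and inc: "\<And>y. y \<in> sparse_net D K S \<Longrightarrow> (\<Sum>b<m. bnorm (\<lambda>j. \<pi> (Suc s) y j - \<pi> s y j) b ^ (2 * p))
      \<le> (real m * real B ^ p) * (32 * sqrt K * \<beta> s / sqrt (2 ^ s)) ^ (2 * p)"
    and T: "T \<subseteq> cells" and sel: "\<And>v. v \<in> P \<Longrightarrow> sel v \<in> sparse_net D K S"
    and P: "P = (\<lambda>y. (\<pi> (Suc s) y, \<pi> s y)) ` sparse_net D K S"
    and \<psi>: "\<And>b y. b < m \<Longrightarrow> y \<in> sparse_net D K S \<Longrightarrow> (cmod (\<psi> b y))\<^sup>2 \<le> real B * real (B * K)"
    and G: "\<And>y. y \<in> sparse_net D K S \<Longrightarrow> (\<Sum>b<m. (cmod (\<psi> b y))\<^sup>2) \<le> G"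
  shows "avg (Pow T) (\<lambda>X. maxf P (\<lambda>v. \<bar>\<Sum>b<m. Re (phi T X b (\<lambda>j. fst v j - snd v j) * cnj (\<psi> b (sel v)))\<bar>))
    \<le> link_bound s G"
proof -
  define \<rho> where "\<rho> = 32 * sqrt K * \<beta> s / sqrt (2 ^ s)"
  have \<rho>0: "0 < \<rho>" using pos beta_pos by (simp add: \<rho>_def)
  have T': "finite T" using T finite_subset[of T cells] by (simp add: cells_def)
  have G0: "0 \<le> G" using G[OF zero_in_sparse_net] order_trans[OF sum_nonneg] by (metis zero_le_power2)
  have P': "finite P" "P \<noteq> {}" using finite_sparse_net sparse_net_nonempty by (auto simp: P)
  have cP: "card P \<le> 27 ^ (n * 2 ^ s)" unfolding P by (rule card_chain_links[OF D_le ch s])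
  define W where "W = real B * \<rho>\<^sup>2 * (2 * G + real (m * B))"
  have W0: "0 < W" using pos \<rho>0 G0 by (simp add: W_def add_nonneg_pos)
  define w where "w v k = lin D (a k) (\<lambda>j. fst v j - snd v j) * cnj (\<psi> (fst k) (sel v))" for v k
  have Ww: "(\<Sum>k\<in>T. (cmod (w v k))\<^sup>2) \<le> W" if v: "v \<in> P" for v
  proof -
    let ?z = "\<lambda>j. fst v j - snd v j"
    obtain y where y: "y \<in> sparse_net D K S" "v = (\<pi> (Suc s) y, \<pi> s y)" using v by (auto simp: P)
    have "(\<Sum>k\<in>T. (cmod (w v k))\<^sup>2) \<le> (\<Sum>k\<in>cells. (cmod (w v k))\<^sup>2)"
      using T by (intro sum_mono2) (auto simp: cells_def)
    also have "\<dots> = (\<Sum>b<m. \<Sum>i<B. (cmod (w v (b, i)))\<^sup>2)"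
      unfolding cells_def sum.cartesian_product by simp
    also have "\<dots> = (\<Sum>b<m. (bnorm ?z b)\<^sup>2 * (cmod (\<psi> b (sel v)))\<^sup>2)"
      unfolding bnorm_sq by (simp add: w_def norm_mult power_mult_distrib sum_distrib_right)
    also have "\<dots> \<le> W"
      unfolding W_def
    proof (rule block_product_le[OF \<rho>0])
      show "(\<Sum>b<m. bnorm ?z b ^ (2 * p)) \<le> real m * real B ^ p * \<rho> ^ (2 * p)"
        using inc[OF y(1)] by (simp add: y(2) \<rho>_def)
    qed (use \<psi> G sel[OF v] in auto)
    finally show ?thesis .
  qed
  let ?M = "\<lambda>X. maxf P (\<lambda>v. cmod (\<Sum>k\<in>T. eps X k * w v k))"
  have M0: "0 \<le> ?M X" for X using P' by (intro maxf_nonneg) auto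
  have lb: "0 \<le> link_bound s G" using beta_pos[of s] G0 by (simp add: link_bound_def)
  have "avg (Pow T) (\<lambda>X. ?M X ^ (2 * n)) \<le> (486 * real (n * 2 ^ s) * W) ^ n"
    by (rule rademacher_max_moment[OF T' P' cP pos(3) _ W0 Ww]) simp_all
  also have "\<dots> \<le> ((link_bound s G)\<^sup>2) ^ n"
  proof (rule power_mono)
    have "486 * real (n * 2 ^ s) * W = 497664 * (\<beta> s)\<^sup>2 * real (n * K * B) * (2 * G + real (m * B))"
      by (simp add: W_def \<rho>_def power_mult_distrib power_divide)
    also have "\<dots> \<le> 541696 * (\<beta> s)\<^sup>2 * real (n * K * B) * (2 * G + real (m * B))"
      using G0 by (intro mult_right_mono) auto
    also have "\<dots> = (link_bound s G)\<^sup>2"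
      using G0 unfolding link_bound_def power_mult_distrib by simp
    finally show "486 * real (n * 2 ^ s) * W \<le> (link_bound s G)\<^sup>2" .
  qed (use W0 in simp)
  finally have le: "avg (Pow T) (\<lambda>X. ?M X ^ (2 * n)) \<le> link_bound s G ^ (2 * n)" by (simp add: power_mult)
  have "avg (Pow T) ?M \<le> link_bound s G"
    by (rule avg_le_of_power[OF _ _ M0 lb _ le]) (use T' pos in auto)
  moreover have "avg (Pow T) (\<lambda>X. maxf P (\<lambda>v. \<bar>\<Sum>b<m. Re (phi T X b (\<lambda>j. fst v j - snd v j) * cnj (\<psi> b (sel v)))\<bar>))
      \<le> avg (Pow T) ?M"
  proof (intro avg_mono maxf_mono P')
    fix X and v :: "(nat \<Rightarrow> real) \<times> (nat \<Rightarrow> real)"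
    let ?z = "\<lambda>j. fst v j - snd v j"
    have "(\<Sum>k\<in>T. eps X k * w v k) = (\<Sum>k\<in>cells. complex_of_real (if k \<in> T then eps X k else 0) * w v k)"
      using T by (intro sum.mono_neutral_cong_left) (auto simp: cells_def)
    also have "\<dots> = (\<Sum>b<m. \<Sum>i<B. complex_of_real (if (b, i) \<in> T then eps X (b, i) else 0) * w v (b, i))"
      unfolding cells_def sum.cartesian_product by simp
    also have "\<dots> = (\<Sum>b<m. phi T X b ?z * cnj (\<psi> b (sel v)))"
      by (simp add: phi_def w_def sum_distrib_right mult.assoc)
    finally have "(\<Sum>b<m. Re (phi T X b ?z * cnj (\<psi> b (sel v)))) = Re (\<Sum>k\<in>T. eps X k * w v k)"
      by simp
    thus "\<bar>\<Sum>b<m. Re (phi T X b ?z * cnj (\<psi> b (sel v)))\<bar> \<le> cmod (\<Sum>k\<in>T. eps X k * w v k)"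
      by (metis abs_Re_le_cmod)
  qed
  ultimately show ?thesis by linarith
qed

section \<open>Decoupling and the self-bounding mean error\<close>

definition block_power :: "(nat \<times> nat) set \<Rightarrow> (nat \<times> nat) set \<Rightarrow> (nat \<Rightarrow> real) \<Rightarrow> real" where
  "block_power T X y = (\<Sum>b<m. (cmod (phi T X b y))\<^sup>2)"

definition row_energy :: "(nat \<Rightarrow> real) \<Rightarrow> real" where
  "row_energy y = (\<Sum>b<m. \<Sum>i<B. (cmod (lin D (a (b, i)) y))\<^sup>2)"

text \<open>The two halves have separate sign sets so that one can be frozen while the other is
  averaged.\<close>

definition chaos :: "(nat \<times> nat) set \<Rightarrow> (nat \<times> nat) set \<Rightarrow> (nat \<times> nat) set \<Rightarrow> (nat \<times> nat) set \<Rightarrow> (nat \<Rightarrow> real) \<Rightarrow> real" where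
  "chaos I X J Y y = (\<Sum>b<m. Re (phi I X b y * cnj (phi J Y b y)))"

definition mean_error :: real where
  "mean_error = avg (Pow cells) (\<lambda>X. maxf (sparse_net D K S) (\<lambda>y. \<bar>block_power cells X y - row_energy y\<bar>))"

lemma finite_cells [simp]: "finite cells" by (simp add: cells_def)

lemma net_finite_nonempty: "finite (sparse_net D K S)" "sparse_net D K S \<noteq> {}"
  by (rule finite_sparse_net, rule sparse_net_nonempty)

text \<open>Jensen: a partial block sum is a conditional expectation of the full one.\<close>

lemma avg_partial_power_le:
  assumes T: "T \<subseteq> cells"
  shows "avg (Pow T) (\<lambda>Y. maxf (sparse_net D K S) (block_power T Y))
    \<le> avg (Pow cells) (\<lambda>X. maxf (sparse_net D K S) (block_power cells X))"
proof -
  let ?F = "sparse_net D K S"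
  define I where "I = cells - T"
  have U: "cells = T \<union> I" "T \<inter> I = {}" using T by (auto simp: I_def)
  have fin: "finite I" by (simp add: I_def)
  have split: "phi cells (Y \<union> X) b y = phi T Y b y + phi I X b y" if "Y \<subseteq> T" "X \<subseteq> I" for X Y b y
  proof -
    have "T \<inter> X = {}" "I \<inter> Y = {}" using that U(2) by auto
    thus ?thesis using phi_Un[of T X Y b y] phi_Un[of I Y X b y]
      unfolding U(1) phi_split[OF U(2)] by (simp add: Un_commute)
  qed
  have "avg (Pow T) (\<lambda>Y. maxf ?F (block_power T Y))
      \<le> avg (Pow T) (\<lambda>Y. avg (Pow I) (\<lambda>X. maxf ?F (block_power cells (Y \<union> X))))"
  proof (intro avg_mono maxf_le net_finite_nonempty)
    fix Y y assume Y: "Y \<in> Pow T" and y: "y \<in> ?F"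
    let ?f = "\<lambda>X. block_power cells (Y \<union> X) y"
    have "2 * block_power T Y y \<le> ?f X + ?f (I - X)" if X: "X \<in> Pow I" for X
    proof -
      have "2 * (cmod z)\<^sup>2 \<le> (cmod (z + w))\<^sup>2 + (cmod (z - w))\<^sup>2" for z w
        by (simp add: cmod_power2) (simp add: power2_eq_square algebra_simps)
      hence "(\<Sum>b<m. 2 * (cmod (phi T Y b y))\<^sup>2)
          \<le> (\<Sum>b<m. (cmod (phi T Y b y + phi I X b y))\<^sup>2 + (cmod (phi T Y b y - phi I X b y))\<^sup>2)"
        by (intro sum_mono)
      moreover have "?f X = (\<Sum>b<m. (cmod (phi T Y b y + phi I X b y))\<^sup>2)"
        unfolding block_power_def using X Y by (intro sum.cong refl) (subst split, auto)
      moreover have "?f (I - X) = (\<Sum>b<m. (cmod (phi T Y b y - phi I X b y))\<^sup>2)"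
        unfolding block_power_def using X Y by (intro sum.cong refl) (subst split, auto simp: phi_compl)
      ultimately show ?thesis unfolding block_power_def by (simp add: sum.distrib sum_distrib_left)
    qed
    hence "avg (Pow I) (\<lambda>_. 2 * block_power T Y y) \<le> avg (Pow I) (\<lambda>X. ?f X + ?f (I - X))"
      by (intro avg_mono)
    also have "\<dots> = 2 * avg (Pow I) ?f" using avg_Pow_compl[of I ?f] by (simp add: avg_add)
    finally have "block_power T Y y \<le> avg (Pow I) ?f" using fin by simp
    also have "\<dots> \<le> avg (Pow I) (\<lambda>X. maxf ?F (block_power cells (Y \<union> X)))"
      using y by (intro avg_mono maxf_ge net_finite_nonempty)
    finally show "block_power T Y y \<le> avg (Pow I) (\<lambda>X. maxf ?F (block_power cells (Y \<union> X)))" .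
  qed
  also have "\<dots> = avg (Pow cells) (\<lambda>X. maxf ?F (block_power cells X))"
    unfolding U(1) by (rule avg_Pow_union[OF U(2), symmetric])
  finally show ?thesis .
qed

lemma avg_link_bound_le:
  assumes T: "T \<subseteq> cells"
  shows "avg (Pow T) (\<lambda>Y. link_bound s (maxf (sparse_net D K S) (block_power T Y)))
    \<le> 736 * \<beta> s * sqrt (real (n * K * B)) * ((mean_error + 3 * real (m * B)) / sqrt (real (m * B)))"
proof -
  let ?F = "sparse_net D K S"
  define c where "c = real (m * B)"
  have c: "0 < c" using pos by (simp add: c_def)
  define g where "g Y = maxf ?F (block_power T Y)" for Y
  have g0: "0 \<le> g Y" for Y unfolding g_def
    by (intro maxf_nonneg net_finite_nonempty) (simp add: block_power_def sum_nonneg)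
  have finT: "finite T" using T finite_subset by (auto simp: cells_def)
  have "avg (Pow cells) (\<lambda>X. maxf ?F (block_power cells X))
      \<le> avg (Pow cells) (\<lambda>X. maxf ?F (\<lambda>y. \<bar>block_power cells X y - row_energy y\<bar>) + 2 * c)"
  proof (intro avg_mono maxf_le net_finite_nonempty)
    fix X y assume y: "y \<in> ?F"
    have "\<bar>block_power cells X y - row_energy y\<bar> \<le> maxf ?F (\<lambda>y. \<bar>block_power cells X y - row_energy y\<bar>)"
      using maxf_ge[OF net_finite_nonempty(1) y, of "\<lambda>y. \<bar>block_power cells X y - row_energy y\<bar>"] by simp
    moreover have "row_energy y \<le> 2 * c" using total_energy[OF y] by (simp add: row_energy_def c_def)
    ultimately show "block_power cells X y \<le> maxf ?F (\<lambda>y. \<bar>block_power cells X y - row_energy y\<bar>) + 2 * c"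
      by linarith
  qed
  also have "\<dots> = mean_error + 2 * c" by (simp add: avg_add mean_error_def)
  finally have G: "avg (Pow T) g \<le> mean_error + 2 * c"
    using avg_partial_power_le[OF T] unfolding g_def by linarith
  have "avg (Pow T) (\<lambda>Y. sqrt (2 * g Y + c)) \<le> avg (Pow T) (\<lambda>Y. 1 / sqrt c * g Y + sqrt c)"
  proof (rule avg_mono)
    fix Y
    have "sqrt (2 * g Y + c) \<le> (2 * g Y + c) / (2 * sqrt c) + sqrt c / 2"
      using c g0[of Y] by (intro sqrt_le_linear) auto
    also have "\<dots> = 1 / sqrt c * g Y + (c / sqrt c) / 2 + sqrt c / 2"
      by (simp add: add_divide_distrib)
    also have "\<dots> = 1 / sqrt c * g Y + sqrt c"
      using c by (simp add: real_div_sqrt)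
    finally show "sqrt (2 * g Y + c) \<le> 1 / sqrt c * g Y + sqrt c" .
  qed
  also have "\<dots> = 1 / sqrt c * avg (Pow T) g + sqrt c"
    using finT by (simp only: avg_add avg_cmult avg_Pow_const)
  also have "\<dots> \<le> 1 / sqrt c * (mean_error + 2 * c) + c / sqrt c"
    using c G by (intro add_mono mult_left_mono) (auto simp: real_div_sqrt)
  also have "\<dots> = (mean_error + 3 * c) / sqrt c" by (simp add: add_divide_distrib)
  finally have "avg (Pow T) (\<lambda>Y. sqrt (2 * g Y + c)) \<le> (mean_error + 3 * c) / sqrt c" .
  hence "736 * \<beta> s * sqrt (real (n * K * B)) * avg (Pow T) (\<lambda>Y. sqrt (2 * g Y + c))
     \<le> 736 * \<beta> s * sqrt (real (n * K * B)) * ((mean_error + 3 * c) / sqrt c)"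
    using beta_pos[of s] by (intro mult_left_mono) auto
  thus ?thesis unfolding link_bound_def avg_cmult by (simp only: g_def c_def)
qed

text \<open>Up to conjugation an increment is z1 w1 - z0 w0 = (z1 - z0) w1 + (w1 - w0) z0, so each
  part pairs a link in one half with an endpoint in the other. The signs of the halves are
  independent, and each part is averaged over the half of its link first; 1472 is 2 * 736.\<close>

lemma avg_chaos_le:
  assumes I: "I \<subseteq> cells"
  defines "J \<equiv> cells - I"
  shows "avg (Pow cells) (\<lambda>X. maxf (sparse_net D K S) (\<lambda>y. \<bar>chaos I X J X y\<bar>))
    \<le> 1472 * (\<Sum>s<S. \<beta> s) * sqrt (real (n * K * B)) * ((mean_error + 3 * real (m * B)) / sqrt (real (m * B)))"
proof -
  let ?F = "sparse_net D K S"
  obtain \<pi> where ch: "net_chain D K S \<pi>" and inc: "\<And>s y. s < S \<Longrightarrow> y \<in> ?F \<Longrightarrow>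
    (\<Sum>b<m. bnorm (\<lambda>j. \<pi> (Suc s) y j - \<pi> s y j) b ^ (2 * p))
      \<le> (real m * real B ^ p) * (32 * sqrt K * \<beta> s / sqrt (2 ^ s)) ^ (2 * p)"
    using block_chain by blast
  have U: "cells = I \<union> J" "I \<inter> J = {}" "J \<subseteq> cells" using I by (auto simp: J_def)
  define P where "P s = (\<lambda>y. (\<pi> (Suc s) y, \<pi> s y)) ` ?F" for s
  have P: "finite (P s)" "P s \<noteq> {}" for s using net_finite_nonempty by (auto simp: P_def)
  have PF: "fst v \<in> ?F" "snd v \<in> ?F" if "v \<in> P s" for v s
    using that net_chainD(3)[OF ch] by (auto simp: P_def)
  define A where "A T X R Y s sel = maxf (P s)
    (\<lambda>v. \<bar>\<Sum>b<m. Re (phi T X b (\<lambda>j. fst v j - snd v j) * cnj (phi R Y b (sel v)))\<bar>)"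
    for T X R Y s and sel :: "(nat \<Rightarrow> real) \<times> (nat \<Rightarrow> real) \<Rightarrow> nat \<Rightarrow> real"
  have link: "avg (Pow T) (\<lambda>X. A T X R Y s sel) \<le> link_bound s (maxf ?F (block_power R Y))"
    if "T \<subseteq> cells" "s < S" "\<And>v. v \<in> P s \<Longrightarrow> sel v \<in> ?F" for T R Y s sel
    unfolding A_def
  proof (rule link_moment[OF ch that(2) inc[OF that(2)] that(1) that(3) P_def cmod_phi_le])
    show "(\<Sum>b<m. (cmod (phi R Y b y))\<^sup>2) \<le> maxf ?F (block_power R Y)" if "y \<in> ?F" for y
      using maxf_ge[OF net_finite_nonempty(1) that, of "block_power R Y"] by (simp add: block_power_def)
  qed
  have pt: "maxf ?F (\<lambda>y. \<bar>chaos I X J Y y\<bar>) \<le> (\<Sum>s<S. A I X J Y s fst + A J Y I X s snd)" for X Y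
  proof (rule maxf_le[OF net_finite_nonempty])
    fix y assume y: "y \<in> ?F"
    have "\<bar>chaos I X J Y y\<bar> \<le> (\<Sum>s<S. \<bar>chaos I X J Y (\<pi> (Suc s) y) - chaos I X J Y (\<pi> s y)\<bar>)"
      by (rule chain_telescope[OF ch y]) (simp add: chaos_def phi_zero)
    also have "\<dots> \<le> (\<Sum>s<S. A I X J Y s fst + A J Y I X s snd)"
    proof (rule sum_mono)
      fix s
      let ?v = "(\<pi> (Suc s) y, \<pi> s y)"
      have v: "?v \<in> P s" using y by (auto simp: P_def)
      have "Re (z1 * cnj w1) - Re (z0 * cnj w0) = Re ((z1 - z0) * cnj w1) + Re ((w1 - w0) * cnj z0)" for z1 z0 w1 w0
        by (simp add: algebra_simps)
      hence "chaos I X J Y (\<pi> (Suc s) y) - chaos I X J Y (\<pi> s y)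
        = (\<Sum>b<m. Re (phi I X b (\<lambda>j. fst ?v j - snd ?v j) * cnj (phi J Y b (fst ?v))))
        + (\<Sum>b<m. Re (phi J Y b (\<lambda>j. fst ?v j - snd ?v j) * cnj (phi I X b (snd ?v))))"
        by (simp only: chaos_def sum_subtractf[symmetric] sum.distrib[symmetric] phi_diff fst_conv snd_conv)
      hence "\<bar>chaos I X J Y (\<pi> (Suc s) y) - chaos I X J Y (\<pi> s y)\<bar>
        \<le> \<bar>\<Sum>b<m. Re (phi I X b (\<lambda>j. fst ?v j - snd ?v j) * cnj (phi J Y b (fst ?v)))\<bar>
        + \<bar>\<Sum>b<m. Re (phi J Y b (\<lambda>j. fst ?v j - snd ?v j) * cnj (phi I X b (snd ?v)))\<bar>"
        by (simp only: abs_triangle_ineq)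
      also have "\<dots> \<le> A I X J Y s fst + A J Y I X s snd"
        unfolding A_def by (rule add_mono; rule maxf_ge[OF P(1) v])
      finally show "\<bar>chaos I X J Y (\<pi> (Suc s) y) - chaos I X J Y (\<pi> s y)\<bar> \<le> A I X J Y s fst + A J Y I X s snd" .
    qed
    finally show "\<bar>chaos I X J Y y\<bar> \<le> (\<Sum>s<S. A I X J Y s fst + A J Y I X s snd)" .
  qed
  define H where "H s = 736 * \<beta> s * sqrt (real (n * K * B)) * ((mean_error + 3 * real (m * B)) / sqrt (real (m * B)))" for s
  have "avg (Pow cells) (\<lambda>X. maxf ?F (\<lambda>y. \<bar>chaos I X J X y\<bar>))
     = avg (Pow I) (\<lambda>X. avg (Pow J) (\<lambda>Y. maxf ?F (\<lambda>y. \<bar>chaos I (X \<union> Y) J (X \<union> Y) y\<bar>)))"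
    using avg_Pow_union[OF U(2)] unfolding U(1)[symmetric] .
  also have "\<dots> = avg (Pow I) (\<lambda>X. avg (Pow J) (\<lambda>Y. maxf ?F (\<lambda>y. \<bar>chaos I X J Y y\<bar>)))"
  proof (intro avg_cong maxf_cong)
    fix X Y y assume "X \<in> Pow I" "Y \<in> Pow J"
    hence "I \<inter> Y = {}" "J \<inter> X = {}" using U(2) by auto
    hence "phi I (X \<union> Y) b y = phi I X b y" "phi J (X \<union> Y) b y = phi J Y b y" for b
      using phi_Un[of I Y X b y] phi_Un[of J X Y b y] by (auto simp: Un_commute)
    thus "\<bar>chaos I (X \<union> Y) J (X \<union> Y) y\<bar> = \<bar>chaos I X J Y y\<bar>" by (simp add: chaos_def)
  qed
  also have "\<dots> \<le> avg (Pow I) (\<lambda>X. avg (Pow J) (\<lambda>Y. \<Sum>s<S. A I X J Y s fst + A J Y I X s snd))"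
    by (intro avg_mono pt)
  also have "\<dots> = (\<Sum>s<S. avg (Pow J) (\<lambda>Y. avg (Pow I) (\<lambda>X. A I X J Y s fst))
      + avg (Pow I) (\<lambda>X. avg (Pow J) (\<lambda>Y. A J Y I X s snd)))"
    by (subst avg_swap[of "Pow J" "Pow I"]) (simp only: avg_sum avg_add)
  also have "\<dots> \<le> (\<Sum>s<S. H s + H s)"
  proof (intro sum_mono add_mono)
    fix s assume "s \<in> {..<S}"
    hence s: "s < S" by simp
    have "avg (Pow J) (\<lambda>Y. avg (Pow I) (\<lambda>X. A I X J Y s fst))
       \<le> avg (Pow J) (\<lambda>Y. link_bound s (maxf ?F (block_power J Y)))"
      by (intro avg_mono link[OF I s] PF)
    also have "\<dots> \<le> H s" unfolding H_def by (rule avg_link_bound_le[OF U(3)])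
    finally show "avg (Pow J) (\<lambda>Y. avg (Pow I) (\<lambda>X. A I X J Y s fst)) \<le> H s" .
    have "avg (Pow I) (\<lambda>X. avg (Pow J) (\<lambda>Y. A J Y I X s snd))
       \<le> avg (Pow I) (\<lambda>X. link_bound s (maxf ?F (block_power I X)))"
      by (intro avg_mono link[OF U(3) s] PF)
    also have "\<dots> \<le> H s" unfolding H_def by (rule avg_link_bound_le[OF I])
    finally show "avg (Pow I) (\<lambda>X. avg (Pow J) (\<lambda>Y. A J Y I X s snd)) \<le> H s" .
  qed
  also have "\<dots> = 1472 * (\<Sum>s<S. \<beta> s) * sqrt (real (n * K * B)) * ((mean_error + 3 * real (m * B)) / sqrt (real (m * B)))"
    unfolding H_def sum.distrib sum_distrib_right[symmetric] sum_distrib_left[symmetric] by simp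
  finally show ?thesis .
qed

text \<open>An ordered pair of distinct cells is split by a quarter of all sets \<open>I\<close>,
  whence the factor 4. The diagonal is never split, and in each block it is the energy of the rows;
  the identity is exact for every \<open>X\<close>.\<close>

lemma decoupling:
  "block_power cells X y - row_energy y = 4 * avg (Pow cells) (\<lambda>I. chaos I X (cells - I) X y)"
proof -
  let ?w = "\<lambda>b i. lin D (a (b, i)) y"
  let ?e = "\<lambda>b i. eps X (b, i)"
  let ?R = "\<lambda>b i i'. Re (?w b i * cnj (?w b i'))"
  have 1: "avg (Pow cells) (\<lambda>I. Re (phi I X b y * cnj (phi (cells - I) X b y)))
      = ((cmod (phi cells X b y))\<^sup>2 - (\<Sum>i<B. (cmod (?w b i))\<^sup>2)) / 4" if b: "b < m" for b
  proof -
    define f where "f i i' = (\<lambda>I. if (b, i) \<in> I \<and> (b, i') \<notin> I then ?e b i * ?e b i' * ?R b i i' else 0)" for i i'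
    have e: "Re (phi I X b y * cnj (phi (cells - I) X b y)) = (\<Sum>i<B. \<Sum>i'<B. f i i' I)" for I
    proof -
      have "phi I X b y * cnj (phi (cells - I) X b y) = (\<Sum>i<B. \<Sum>i'<B.
         (complex_of_real (if (b, i) \<in> I then ?e b i else 0) * ?w b i) *
         cnj (complex_of_real (if (b, i') \<in> cells - I then ?e b i' else 0) * ?w b i'))"
        unfolding phi_def cnj_sum sum_product ..
      hence "Re (phi I X b y * cnj (phi (cells - I) X b y)) = (\<Sum>i<B. \<Sum>i'<B.
         Re ((complex_of_real (if (b, i) \<in> I then ?e b i else 0) * ?w b i) *
         cnj (complex_of_real (if (b, i') \<in> cells - I then ?e b i' else 0) * ?w b i')))"
        by (simp only: Re_sum)
      also have "\<dots> = (\<Sum>i<B. \<Sum>i'<B. f i i' I)"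
        using b by (intro sum.cong refl) (auto simp: f_def cells_def algebra_simps)
      finally show ?thesis .
    qed
    have ff: "avg (Pow cells) (f i i') = (if i = i' then 0 else ?e b i * ?e b i' * ?R b i i' / 4)"
      if "i < B" "i' < B" for i i'
      unfolding f_def using decoupling_weight[of cells "(b, i)" "(b, i')"] that b by (simp add: cells_def)
    have "avg (Pow cells) (\<lambda>I. Re (phi I X b y * cnj (phi (cells - I) X b y)))
      = (\<Sum>i<B. \<Sum>i'<B. avg (Pow cells) (f i i'))"
      unfolding e avg_sum ..
    also have "\<dots> = (\<Sum>i<B. \<Sum>i'<B. ?e b i * ?e b i' * ?R b i i' / 4 - (if i' = i then (cmod (?w b i))\<^sup>2 / 4 else 0))"
    proof (intro sum.cong refl)
      fix i i' assume i: "i \<in> {..<B}" "i' \<in> {..<B}"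
      have R: "?R b i i = (cmod (?w b i))\<^sup>2"
        by (simp add: cmod_power2) (simp add: power2_eq_square)
      show "avg (Pow cells) (f i i') = ?e b i * ?e b i' * ?R b i i' / 4 - (if i' = i then (cmod (?w b i))\<^sup>2 / 4 else 0)"
      proof (cases "i' = i")
        case True
        show ?thesis unfolding True R eps_sq using ff[of i i] i by simp
      qed (use ff[of i i'] i in auto)
    qed
    also have "\<dots> = (\<Sum>i<B. \<Sum>i'<B. ?e b i * ?e b i' * ?R b i i') / 4 - (\<Sum>i<B. (cmod (?w b i))\<^sup>2) / 4"
      by (simp add: sum_subtractf sum_divide_distrib)
    also have "(\<Sum>i<B. \<Sum>i'<B. ?e b i * ?e b i' * ?R b i i') = (cmod (phi cells X b y))\<^sup>2"
    proof -
      have "phi cells X b y = (\<Sum>i<B. complex_of_real (?e b i) * ?w b i)"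
        unfolding phi_def using b by (intro sum.cong) (auto simp: cells_def)
      thus ?thesis by (simp only: norm_sum_sq_expand)
    qed
    finally show ?thesis by (simp add: diff_divide_distrib)
  qed
  have "avg (Pow cells) (\<lambda>I. chaos I X (cells - I) X y)
      = (\<Sum>b<m. ((cmod (phi cells X b y))\<^sup>2 - (\<Sum>i<B. (cmod (?w b i))\<^sup>2)) / 4)"
    unfolding chaos_def avg_sum by (intro sum.cong refl 1) simp
  also have "\<dots> = (block_power cells X y - row_energy y) / 4"
    by (simp add: block_power_def row_energy_def sum_divide_distrib[symmetric] sum_subtractf)
  finally show ?thesis by simp
qed

text \<open>Here 5888 = 4 * 1472, and \<open>B\<close> cancels between
  \<open>sqrt (n * K * B)\<close> and \<open>sqrt (m * B)\<close>. The mean error on the right can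
  be absorbed as soon as its factor is small.\<close>

theorem mean_error_le:
  "mean_error \<le> 5888 * (\<Sum>s<S. \<beta> s) * sqrt (real (n * K) / real m) * (mean_error + 3 * real (m * B))"
proof -
  let ?F = "sparse_net D K S"
  let ?M = "\<lambda>I X. maxf ?F (\<lambda>y. \<bar>chaos I X (cells - I) X y\<bar>)"
  have "mean_error \<le> avg (Pow cells) (\<lambda>X. 4 * avg (Pow cells) (\<lambda>I. ?M I X))"
    unfolding mean_error_def
  proof (intro avg_mono maxf_le net_finite_nonempty)
    fix X y assume y: "y \<in> ?F"
    have "\<bar>avg (Pow cells) (\<lambda>I. chaos I X (cells - I) X y)\<bar> \<le> avg (Pow cells) (\<lambda>I. \<bar>chaos I X (cells - I) X y\<bar>)"
      unfolding avg_def abs_divide by (simp add: divide_right_mono)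
    also have "\<dots> \<le> avg (Pow cells) (\<lambda>I. ?M I X)"
      using y by (intro avg_mono maxf_ge net_finite_nonempty)
    finally show "\<bar>block_power cells X y - row_energy y\<bar> \<le> 4 * avg (Pow cells) (\<lambda>I. ?M I X)"
      unfolding decoupling by (simp add: abs_mult)
  qed
  also have "\<dots> = 4 * avg (Pow cells) (\<lambda>I. avg (Pow cells) (\<lambda>X. ?M I X))"
    unfolding avg_cmult by (subst avg_swap) (rule refl)
  also have "avg (Pow cells) (\<lambda>I. avg (Pow cells) (\<lambda>X. ?M I X)) \<le> avg (Pow cells) (\<lambda>I.
      1472 * (\<Sum>s<S. \<beta> s) * sqrt (real (n * K * B)) * ((mean_error + 3 * real (m * B)) / sqrt (real (m * B))))"
    by (rule avg_mono) (rule avg_chaos_le, simp)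
  also have "4 * \<dots> = 5888 * (\<Sum>s<S. \<beta> s) * sqrt (real (n * K) / real m) * (mean_error + 3 * real (m * B))"
    using pos by (simp add: real_sqrt_divide real_sqrt_mult)
  finally show ?thesis by simp
qed

end

subsection \<open>Good rows and good signs\<close>

definition blk :: "nat \<Rightarrow> nat \<Rightarrow> nat set" where
  "blk B b = {b * B..<b * B + B}"

lemma finite_blk [simp]: "finite (blk B b)" and card_blk [simp]: "card (blk B b) = B"
  by (simp_all add: blk_def)

lemma blk_subset: "b < m \<Longrightarrow> blk B b \<subseteq> {..<m * B}"
proof -
  assume "b < m"
  hence "(b + 1) * B \<le> m * B" by (intro mult_le_mono) auto
  thus ?thesis by (auto simp: blk_def)
qed

lemma sum_blk: "(\<Sum>k\<in>blk B b. f k) = (\<Sum>i<B. f (B * b + i))"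
proof -
  have "blk B b = (\<lambda>i. B * b + i) ` {..<B}"
  proof (intro subset_antisym subsetI)
    fix x assume "x \<in> blk B b"
    hence "x = B * b + (x - B * b)" "x - B * b \<in> {..<B}" by (auto simp: blk_def mult.commute)
    thus "x \<in> (\<lambda>i. B * b + i) ` {..<B}" by (rule image_eqI)
  qed (auto simp: blk_def mult.commute)
  moreover have "inj_on (\<lambda>i. B * b + i) {..<B}" by (simp add: inj_on_def)
  ultimately show ?thesis by (simp add: sum.reindex)
qed

lemma sum_blk_total: "(\<Sum>b<m. \<Sum>k\<in>blk B b. f k) = (\<Sum>k<m * B. f k)"
  unfolding blk_def by (rule sum.nat_group)

section \<open>Column bounds and signings for sampled blocks\<close>

context bounded_orthonormal
begin

lemma energy_blk: "(\<Sum>i<B. (cmod (lin D (u (t (B * b + i))) y))\<^sup>2) = energy t (blk B b) y"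
  unfolding energy_def by (rule sum_blk[symmetric])

text \<open>Block \<open>b\<close> restricted to the columns \<open>O'\<close> has squared Frobenius
  norm at most \<open>B * 2 ^ s\<close>, by the bound on the entries, and squared operator norm at
  most \<open>W b\<close>. The p-th powers are summed over the blocks before the signing is chosen,
  so one signing serves all blocks.\<close>

lemma block_signing:
  fixes W :: "nat \<Rightarrow> real"
  assumes t: "\<And>k. k < m * B \<Longrightarrow> t k < d" and O: "O' \<subseteq> {..<D}" "card O' \<le> 2 ^ s"
    and W0: "\<And>b. b < m \<Longrightarrow> 0 < W b"
    and W: "\<And>b c. b < m \<Longrightarrow> (\<Sum>k\<in>blk B b. (cmod (\<Sum>j\<in>O'. complex_of_real (c j) * u (t k) j))\<^sup>2) \<le> W b * (\<Sum>j\<in>O'. (c j)\<^sup>2)"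
  shows "\<exists>X\<subseteq>O'. (\<Sum>b<m. energy t (blk B b) (\<lambda>j. if j \<in> O' then eps X j else 0) ^ p)
    \<le> (\<Sum>b<m. (2 * (real B * 2 ^ s) + 16 * real p * W b) ^ p)"
proof -
  have fin: "finite O'" using O(1) finite_subset by blast
  have e: "energy t (blk B b) (\<lambda>j. if j \<in> O' then eps X j else 0)
     = (\<Sum>k\<in>blk B b. (cmod (\<Sum>j\<in>O'. complex_of_real (eps X j) * u (t k) j))\<^sup>2)" for b X
    unfolding energy_def lin_indicator[OF O(1)] ..
  have "avg (Pow O') (\<lambda>X. \<Sum>b<m. energy t (blk B b) (\<lambda>j. if j \<in> O' then eps X j else 0) ^ p)
     \<le> (\<Sum>b<m. (2 * (real B * 2 ^ s) + 16 * real p * W b) ^ p)"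
    unfolding avg_sum
  proof (rule sum_mono)
    fix b assume "b \<in> {..<m}"
    hence b: "b < m" by simp
    have "(\<Sum>k\<in>blk B b. \<Sum>j\<in>O'. (cmod (u (t k) j))\<^sup>2) \<le> (\<Sum>k\<in>blk B b. \<Sum>j\<in>O'. 1)"
      using t blk_subset[OF b] O(1) u_bound
      by (intro sum_mono) (auto simp: power_le_one subset_iff)
    also have "\<dots> \<le> real B * 2 ^ s"
    proof -
      have "real (card O') \<le> real (2 ^ s)" using O(2) by (rule of_nat_mono)
      thus ?thesis by (simp add: mult_left_mono)
    qed
    finally have T: "(\<Sum>k\<in>blk B b. \<Sum>j\<in>O'. (cmod (u (t k) j))\<^sup>2) \<le> real B * 2 ^ s" .
    show "avg (Pow O') (\<lambda>X. energy t (blk B b) (\<lambda>j. if j \<in> O' then eps X j else 0) ^ p)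
       \<le> (2 * (real B * 2 ^ s) + 16 * real p * W b) ^ p"
      unfolding e by (rule rademacher_vector_moment[OF fin W0[OF b] W[OF b] T])
  qed
  moreover obtain X where "X \<in> Pow O'" "(\<Sum>b<m. energy t (blk B b) (\<lambda>j. if j \<in> O' then eps X j else 0) ^ p)
    \<le> avg (Pow O') (\<lambda>X. \<Sum>b<m. energy t (blk B b) (\<lambda>j. if j \<in> O' then eps X j else 0) ^ p)"
    using avg_attained[of "Pow O'" "\<lambda>X. \<Sum>b<m. energy t (blk B b) (\<lambda>j. if j \<in> O' then eps X j else 0) ^ p"] fin by auto
  ultimately show ?thesis by (intro exI[of _ X]) auto
qed

text \<open>Cauchy-Schwarz and entries of modulus at most 1 bound the operator norm by the Frobenius
  bound; this is used at the levels with \<open>2 ^ s < p\<close>.\<close>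

lemma column_bound_trivial:
  assumes t: "\<And>k. k \<in> I \<Longrightarrow> t k < d" and O: "O' \<subseteq> {..<D}" "card O' \<le> 2 ^ s"
  shows "(\<Sum>k\<in>I. (cmod (\<Sum>j\<in>O'. complex_of_real (c j) * u (t k) j))\<^sup>2) \<le> real (card I) * 2 ^ s * (\<Sum>j\<in>O'. (c j)\<^sup>2)"
proof -
  have "(cmod (\<Sum>j\<in>O'. complex_of_real (c j) * u (t k) j))\<^sup>2 \<le> 2 ^ s * (\<Sum>j\<in>O'. (c j)\<^sup>2)" if k: "k \<in> I" for k
  proof -
    have "cmod (\<Sum>j\<in>O'. complex_of_real (c j) * u (t k) j) \<le> (\<Sum>j\<in>O'. \<bar>c j\<bar> * cmod (u (t k) j))"
      by (rule order_trans[OF norm_sum]) (simp add: norm_mult)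
    also have "\<dots> \<le> (\<Sum>j\<in>O'. \<bar>c j\<bar> * 1)"
      using u_bound[OF t[OF k]] O(1) by (intro sum_mono mult_left_mono) auto
    finally have "(cmod (\<Sum>j\<in>O'. complex_of_real (c j) * u (t k) j))\<^sup>2 \<le> (\<Sum>j\<in>O'. \<bar>c j\<bar> * 1)\<^sup>2"
      by (intro power_mono) auto
    also have "\<dots> \<le> (\<Sum>j\<in>O'. \<bar>c j\<bar>\<^sup>2) * (\<Sum>j\<in>O'. 1\<^sup>2)" by (rule Cauchy_Schwarz_ineq_sum)
    also have "\<dots> = real (card O') * (\<Sum>j\<in>O'. (c j)\<^sup>2)" by simp
    also have "\<dots> \<le> real (2 ^ s) * (\<Sum>j\<in>O'. (c j)\<^sup>2)"
      using O(2) by (intro mult_right_mono of_nat_mono sum_nonneg) auto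
    finally show ?thesis by simp
  qed
  hence "(\<Sum>k\<in>I. (cmod (\<Sum>j\<in>O'. complex_of_real (c j) * u (t k) j))\<^sup>2) \<le> (\<Sum>k\<in>I. 2 ^ s * (\<Sum>j\<in>O'. (c j)\<^sup>2))"
    by (intro sum_mono)
  thus ?thesis by (simp add: mult_ac)
qed

lemma energy_deviation:
  assumes K: "0 < K" "32 * K \<le> 2 ^ S" and x: "x \<in> sparse_ball D K"
  shows "\<bar>energy t I x - real (card I) * (\<Sum>j<D. (x j)\<^sup>2)\<bar> \<le> 2 * deviation K S t I"
proof -
  have "\<bar>1 * (\<Sum>i\<in>I. (cmod (lin D ((\<lambda>i. u (t i)) i) x))\<^sup>2) - real (card I) * (\<Sum>j<D. (x j)\<^sup>2)\<bar> \<le> 2 * deviation K S t I"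
  proof (rule quadratic_form_extension[OF K _ x])
    fix y assume "y \<in> sparse_net D K S"
    from maxf_ge[OF finite_sparse_net this, of "\<lambda>y. \<bar>energy t I y - real (card I) * (\<Sum>j<D. (y j)\<^sup>2)\<bar>"]
    show "\<bar>1 * (\<Sum>i\<in>I. (cmod (lin D ((\<lambda>i. u (t i)) i) y))\<^sup>2) - real (card I) * (\<Sum>j<D. (y j)\<^sup>2)\<bar> \<le> deviation K S t I"
      by (simp add: deviation_def energy_def)
  qed
  thus ?thesis by (simp add: energy_def)
qed

text \<open>The normalised coefficient vector is a \<open>2 ^ s\<close>-sparse unit vector, so the
  upper isometry bound for the rows controls the columns. The depth is \<open>s + 5\<close> because
  \<open>32 * 2 ^ s = 2 ^ (s + 5)\<close>.\<close>

lemma column_bound_deviation: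
  assumes O: "O' \<subseteq> {..<D}" "card O' \<le> 2 ^ s"
  shows "(\<Sum>k\<in>I. (cmod (\<Sum>j\<in>O'. complex_of_real (c j) * u (t k) j))\<^sup>2)
    \<le> (real (card I) + 2 * deviation (2 ^ s) (s + 5) t I) * (\<Sum>j\<in>O'. (c j)\<^sup>2)"
proof -
  have fin: "finite O'" using O(1) finite_subset by blast
  define R where "R = (\<Sum>j\<in>O'. (c j)\<^sup>2)"
  have R0: "0 \<le> R" by (simp add: R_def sum_nonneg)
  show ?thesis
  proof (cases "R = 0")
    case True
    hence "\<forall>j\<in>O'. c j = 0" using fin by (simp add: R_def sum_nonneg_eq_0_iff)
    thus ?thesis by simp
  next
    case False
    hence Rp: "0 < R" using R0 by simp
    define x where "x j = (if j \<in> O' then c j / sqrt R else 0)" for j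
    have x2: "(\<Sum>j<D. (x j)\<^sup>2) = 1"
    proof -
      have "(\<Sum>j<D. (x j)\<^sup>2) = (\<Sum>j\<in>O'. (x j)\<^sup>2)"
        using O(1) by (intro sum.mono_neutral_right) (auto simp: x_def)
      also have "\<dots> = (\<Sum>j\<in>O'. (c j)\<^sup>2 / R)" using R0 by (intro sum.cong) (auto simp: x_def power_divide)
      also have "\<dots> = R / R" by (simp only: sum_divide_distrib[symmetric] R_def)
      finally show ?thesis using Rp by simp
    qed
    have "{j. x j \<noteq> 0} \<subseteq> O'" by (auto simp: x_def)
    hence "card {j. x j \<noteq> 0} \<le> 2 ^ s" using card_mono[OF fin] O(2) order_trans by blast
    moreover have "\<forall>j\<ge>D. x j = 0" using O(1) by (auto simp: x_def)
    ultimately have xb: "x \<in> sparse_ball D (2 ^ s)" using x2 unfolding sparse_ball_def by simp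
    have K: "0 < (2::nat) ^ s" "32 * (2::nat) ^ s \<le> 2 ^ (s + 5)" by (auto simp: power_add)
    have "energy t I x \<le> real (card I) + 2 * deviation (2 ^ s) (s + 5) t I"
      using energy_deviation[OF K xb, of t I] x2 by (simp add: abs_le_iff)
    hence "R * energy t I x \<le> R * (real (card I) + 2 * deviation (2 ^ s) (s + 5) t I)"
      using Rp by (intro mult_left_mono) auto
    moreover have "R * energy t I x = (\<Sum>k\<in>I. (cmod (\<Sum>j\<in>O'. complex_of_real (c j) * u (t k) j))\<^sup>2)"
      unfolding energy_def sum_distrib_left
    proof (rule sum.cong[OF refl])
      fix k
      have "lin D (u (t k)) x = (\<Sum>j\<in>O'. complex_of_real (c j / sqrt R) * u (t k) j)"
        unfolding x_def by (rule lin_indicator[OF O(1)])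
      also have "\<dots> = complex_of_real (1 / sqrt R) * (\<Sum>j\<in>O'. complex_of_real (c j) * u (t k) j)"
        unfolding sum_distrib_left by (intro sum.cong) auto
      finally have "(cmod (lin D (u (t k)) x))\<^sup>2 = (1 / sqrt R)\<^sup>2 * (cmod (\<Sum>j\<in>O'. complex_of_real (c j) * u (t k) j))\<^sup>2"
        by (simp only: norm_mult norm_of_real power_mult_distrib power2_abs)
      thus "R * (cmod (lin D (u (t k)) x))\<^sup>2 = (cmod (\<Sum>j\<in>O'. complex_of_real (c j) * u (t k) j))\<^sup>2"
        using Rp by (simp add: power_divide)
    qed
    ultimately show ?thesis by (simp add: R_def mult.commute)
  qed
qed

text \<open>Here \<open>107495424 = 10368\<^sup>2\<close>, \<open>288 = 8 * 36\<close> and \<open>41472 = 32 * 36\<^sup>2\<close>.\<close>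

lemma block_deviation_moment:
  fixes \<kappa> :: real
  assumes B: "0 < B" and p: "0 < p" "s \<le> p" and kap: "real p ^ 4 * (real n)\<^sup>2 \<le> \<kappa> * real B" and b: "b < m"
    and \<theta>: "0 < \<theta>" "\<theta>\<^sup>2 = 288 * 107495424 * \<kappa> + 41472 * 107495424\<^sup>2 * \<kappa>\<^sup>2"
  shows "avg (PiE {..<m * B} (\<lambda>_. {..<d}))
    (\<lambda>t. (real p * deviation (2 ^ s) (s + 5) t (blk B b) / (real B * 2 ^ s) / \<theta>) ^ (2 * n)) \<le> 2"
proof -
  define \<Gamma> where "\<Gamma> = 10368 * real (s + 5) * real n * sqrt (real (2 ^ s))"
  define g where "g = real p / (real B * 2 ^ s) / \<theta>"
  have B0: "0 < real B" using B by simp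
  have g0: "0 \<le> g" using \<theta> by (simp add: g_def)
  have \<Gamma>2: "\<Gamma>\<^sup>2 = 107495424 * (real (s + 5))\<^sup>2 * (real n)\<^sup>2 * 2 ^ s"
    unfolding \<Gamma>_def power_mult_distrib by simp
  have s6: "real (s + 5) \<le> 6 * real p" using p by simp
  \<comment> \<open>Up to constants \<open>\<Gamma>\<^sup>2\<close> is at most
    \<open>p\<^sup>2 * n\<^sup>2 * 2 ^ s\<close>, and the weight \<open>p\<close> of the deviation,
    squared, raises this to \<open>p ^ 4 * n\<^sup>2\<close>, the quantity that \<open>kap\<close>
    compares with \<open>B\<close>.\<close>
  have q: "(real p)\<^sup>2 * \<Gamma>\<^sup>2 \<le> 36 * 107495424 * \<kappa> * real B * 2 ^ s"
  proof -
    have "(real (s + 5))\<^sup>2 \<le> (6 * real p)\<^sup>2" using s6 by (intro power_mono) auto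
    hence "(real p)\<^sup>2 * \<Gamma>\<^sup>2 \<le> (real p)\<^sup>2 * (107495424 * (6 * real p)\<^sup>2 * (real n)\<^sup>2 * 2 ^ s)"
      unfolding \<Gamma>2 by (intro mult_left_mono mult_right_mono) auto
    also have "\<dots> = 36 * 107495424 * 2 ^ s * (real p ^ 4 * (real n)\<^sup>2)"
      by (simp add: power4_eq_xxxx power2_eq_square)
    also have "\<dots> \<le> 36 * 107495424 * 2 ^ s * (\<kappa> * real B)" using kap by (intro mult_left_mono) auto
    finally show ?thesis by (simp add: mult_ac)
  qed
  have \<kappa>0: "0 \<le> \<kappa>"
  proof -
    have "0 \<le> \<kappa> * real B" using kap by (rule order_trans[rotated]) simp
    thus ?thesis using B0 by (simp add: zero_le_mult_iff)
  qed
  have key: "(8 * \<Gamma>\<^sup>2 * real B + 32 * \<Gamma> ^ 4) * g\<^sup>2 \<le> 1"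
  proof -
    define P where "P = (real p)\<^sup>2"
    define x where "x = real B * 2 ^ s"
    have x0: "0 < x" using B0 by (simp add: x_def)
    have P1: "1 \<le> P" using p(1) by (simp add: P_def)
    have q': "P * \<Gamma>\<^sup>2 \<le> 36 * 107495424 * \<kappa> * x" using q by (simp add: P_def x_def mult_ac)
    have "P * (8 * \<Gamma>\<^sup>2 * real B) = 8 * real B * (P * \<Gamma>\<^sup>2)" by simp
    also have "\<dots> \<le> 8 * real B * (36 * 107495424 * \<kappa> * x)" by (rule mult_left_mono[OF q']) simp
    also have "\<dots> \<le> 8 * x * (36 * 107495424 * \<kappa> * x)"
    proof (rule mult_right_mono)
      have "real B * 1 \<le> real B * 2 ^ s" by (rule mult_left_mono) auto
      thus "8 * real B \<le> 8 * x" by (simp add: x_def)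
    qed (use \<kappa>0 x0 in simp)
    finally have 1: "P * (8 * \<Gamma>\<^sup>2 * real B) \<le> 288 * 107495424 * \<kappa> * x\<^sup>2" by (simp add: power2_eq_square)
    have "P * (32 * \<Gamma> ^ 4) \<le> P * (P * (32 * \<Gamma> ^ 4))" using P1 mult_right_mono[OF P1, of "\<Gamma> ^ 4"] by simp
    also have "\<dots> = 32 * (P * \<Gamma>\<^sup>2)\<^sup>2" by (simp add: power2_eq_square power4_eq_xxxx)
    also have "\<dots> \<le> 32 * (36 * 107495424 * \<kappa> * x)\<^sup>2"
      using q' by (intro mult_left_mono power_mono) (auto simp: P_def)
    finally have 2: "P * (32 * \<Gamma> ^ 4) \<le> 41472 * 107495424\<^sup>2 * \<kappa>\<^sup>2 * x\<^sup>2" by (simp add: power_mult_distrib)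
    have "P * (8 * \<Gamma>\<^sup>2 * real B + 32 * \<Gamma> ^ 4) \<le> \<theta>\<^sup>2 * x\<^sup>2"
      unfolding \<theta>(2) distrib_left distrib_right using 1 2 by (rule add_mono)
    moreover have "(8 * \<Gamma>\<^sup>2 * real B + 32 * \<Gamma> ^ 4) * g\<^sup>2 = P * (8 * \<Gamma>\<^sup>2 * real B + 32 * \<Gamma> ^ 4) / (\<theta>\<^sup>2 * x\<^sup>2)"
      by (simp add: g_def P_def x_def[symmetric] power_divide power_mult_distrib mult.commute)
    ultimately show ?thesis using \<theta>(1) x0 by (simp add: divide_le_eq)
  qed
  have "avg (PiE {..<m * B} (\<lambda>_. {..<d})) (\<lambda>t. deviation (2 ^ s) (s + 5) t (blk B b) ^ (2 * n))
     \<le> 2 * (8 * \<Gamma>\<^sup>2 * real (card (blk B b)) + 32 * \<Gamma> ^ 4) ^ n"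
    unfolding \<Gamma>_def using B blk_subset[OF b] by (intro deviation_moment) (auto simp: blk_def)
  hence dm: "avg (PiE {..<m * B} (\<lambda>_. {..<d})) (\<lambda>t. deviation (2 ^ s) (s + 5) t (blk B b) ^ (2 * n))
     \<le> 2 * (8 * \<Gamma>\<^sup>2 * real B + 32 * \<Gamma> ^ 4) ^ n" by simp
  have "(real p * \<delta> / (real B * 2 ^ s) / \<theta>) ^ (2 * n) = g ^ (2 * n) * \<delta> ^ (2 * n)" for \<delta>
    unfolding g_def power_mult_distrib[symmetric] by simp
  hence "avg (PiE {..<m * B} (\<lambda>_. {..<d}))
    (\<lambda>t. (real p * deviation (2 ^ s) (s + 5) t (blk B b) / (real B * 2 ^ s) / \<theta>) ^ (2 * n))
    = g ^ (2 * n) * avg (PiE {..<m * B} (\<lambda>_. {..<d})) (\<lambda>t. deviation (2 ^ s) (s + 5) t (blk B b) ^ (2 * n))"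
    by (simp only: avg_cmult)
  also have "\<dots> \<le> g ^ (2 * n) * (2 * (8 * \<Gamma>\<^sup>2 * real B + 32 * \<Gamma> ^ 4) ^ n)"
    using g0 by (intro mult_left_mono dm) auto
  also have "\<dots> = 2 * ((8 * \<Gamma>\<^sup>2 * real B + 32 * \<Gamma> ^ 4) * g\<^sup>2) ^ n"
    unfolding power_mult[of g 2 n] power_mult_distrib[of _ "g\<^sup>2"] by (simp only: mult_ac)
  also have "\<dots> \<le> 2 * 1" using key B0 by (intro mult_left_mono power_le_one) auto
  finally show ?thesis by simp
qed

text \<open>The two terms of the chaining factor belong to two ranges of levels. For
  \<open>2 ^ s \<ge> p\<close> the high moments of the block deviations make the operator norm
  harmless and the factor is constant. For \<open>2 ^ s < p\<close> the trivial column bound gives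
  order \<open>sqrt p\<close>, which is at most \<open>p / sqrt (2 ^ s)\<close> and thus sums to
  order \<open>p\<close>.\<close>

lemma signed_blocks_of_deviation:
  fixes \<theta> :: real
  assumes pos: "0 < m" "0 < B" "0 < K" "0 < S" "0 < p" and Sp: "S \<le> p" and pn: "p \<le> 2 * n"
    and BK: "B * K \<le> 2 ^ (p - 1)" and \<theta>: "0 < \<theta>"
    and t: "\<And>k. k < m * B \<Longrightarrow> t k < d"
    and dev: "\<And>s. s \<le> S \<Longrightarrow> (\<Sum>b<m. (real p * deviation (2 ^ s) (s + 5) t (blk B b) / (real B * 2 ^ s) / \<theta>) ^ (2 * n))
      \<le> 32 * real (S + 1) * real m"
    and tot: "deviation K S t {..<m * B} \<le> real (m * B)"
  shows "signed_blocks D m B n K S p (\<lambda>k. u (t (B * fst k + snd k)))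
    (\<lambda>s. sqrt (130 * (18 + 32 * \<theta>)) + 5 * real p / sqrt (2 ^ s))"
proof
  define \<beta> where "\<beta> s = sqrt (130 * (18 + 32 * \<theta>)) + 5 * real p / sqrt (2 ^ s)" for s :: nat
  have B0: "0 < real B" and p0: "0 < real p" using pos by auto
  show "0 < sqrt (130 * (18 + 32 * \<theta>)) + 5 * real p / sqrt (2 ^ s)" for s
    using \<theta> p0 by (intro add_pos_pos) auto
  show "sqrt (130 * (18 + 32 * \<theta>)) + 5 * real p / sqrt (2 ^ Suc s) \<le> sqrt (130 * (18 + 32 * \<theta>)) + 5 * real p / sqrt (2 ^ s)" for s
    using p0 by (intro add_left_mono frac_le) auto
  show "cmod (u (t (B * fst (b, i) + snd (b, i))) j) \<le> 1" if "b < m" "i < B" "j < D" for b i j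
  proof -
    have "B * b + i \<in> blk B b" using that by (simp add: blk_def mult.commute)
    hence "B * b + i < m * B" using blk_subset[OF that(1)] by auto
    thus ?thesis using u_bound[OF t that(3)] by simp
  qed
  show "(\<Sum>b<m. \<Sum>i<B. (cmod (lin D (u (t (B * fst (b, i) + snd (b, i)))) y))\<^sup>2) \<le> 2 * real (m * B)"
    if y: "y \<in> sparse_net D K S" for y
  proof -
    have "\<bar>energy t {..<m * B} y - real (card {..<m * B}) * (\<Sum>j<D. (y j)\<^sup>2)\<bar> \<le> deviation K S t {..<m * B}"
      unfolding deviation_def by (rule maxf_ge[OF finite_sparse_net y])
    moreover have "real (m * B) * (\<Sum>j<D. (y j)\<^sup>2) \<le> real (m * B) * 1"
      using y by (intro mult_left_mono) (auto simp: sparse_net_def sparse_ball_def)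
    ultimately have "energy t {..<m * B} y \<le> 2 * real (m * B)" using tot by simp
    moreover have "(\<Sum>b<m. energy t (blk B b) y) = energy t {..<m * B} y"
      unfolding energy_def by (rule sum_blk_total)
    ultimately show ?thesis by (simp add: energy_blk)
  qed
  fix s O' assume s: "s \<le> S" and O: "O' \<subseteq> {..<D}" "card O' \<le> 2 ^ s"
  have tb: "t k < d" if "b < m" "k \<in> blk B b" for b k using t[of k] blk_subset[OF that(1), of B] that(2) by auto
  define x where "x = real B * 2 ^ s"
  have x0: "0 < x" using B0 by (simp add: x_def)
  have \<beta>0: "0 \<le> \<beta> s" using \<theta> by (simp add: \<beta>_def)
  have "\<exists>X\<subseteq>O'. (\<Sum>b<m. energy t (blk B b) (\<lambda>j. if j \<in> O' then eps X j else 0) ^ p) \<le> real m * (x * (\<beta> s)\<^sup>2) ^ p"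
  proof (cases "2 ^ s < p")
    case True
    have "\<exists>X\<subseteq>O'. (\<Sum>b<m. energy t (blk B b) (\<lambda>j. if j \<in> O' then eps X j else 0) ^ p)
      \<le> (\<Sum>b<m. (2 * (real B * 2 ^ s) + 16 * real p * (real B * 2 ^ s)) ^ p)"
    proof (rule block_signing[OF t O])
      fix b c assume b: "b < m"
      show "0 < real B * 2 ^ s" using B0 by simp
      show "(\<Sum>k\<in>blk B b. (cmod (\<Sum>j\<in>O'. complex_of_real (c j) * u (t k) j))\<^sup>2) \<le> real B * 2 ^ s * (\<Sum>j\<in>O'. (c j)\<^sup>2)"
        using column_bound_trivial[where I = "blk B b" and c = c and t = t, OF tb[OF b] O] by simp
    qed
    then obtain X where X: "X \<subseteq> O'" and le1: "(\<Sum>b<m. energy t (blk B b) (\<lambda>j. if j \<in> O' then eps X j else 0) ^ p)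
      \<le> (\<Sum>b<m. (2 * (real B * 2 ^ s) + 16 * real p * (real B * 2 ^ s)) ^ p)" by blast
    have "(\<Sum>b<m. (2 * (real B * 2 ^ s) + 16 * real p * (real B * 2 ^ s)) ^ p) \<le> (\<Sum>b<m. (x * (\<beta> s)\<^sup>2) ^ p)"
    proof (intro sum_mono power_mono)
      have "2 + 16 * real p \<le> 25 * real p" using pos(5) by linarith
      also have "\<dots> \<le> 25 * (real p)\<^sup>2 / 2 ^ s"
      proof -
        have "real (2 ^ s) \<le> real p" using True by (intro of_nat_mono) simp
        hence "25 * real p * 2 ^ s \<le> 25 * real p * real p" using p0 by (intro mult_left_mono) auto
        thus ?thesis by (simp add: pos_le_divide_eq power2_eq_square)
      qed
      also have "\<dots> = (5 * real p / sqrt (2 ^ s))\<^sup>2" by (simp add: power_divide power_mult_distrib)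
      also have "\<dots> \<le> (\<beta> s)\<^sup>2" using \<theta> p0 by (intro power_mono) (auto simp: \<beta>_def)
      finally have "x * (2 + 16 * real p) \<le> x * (\<beta> s)\<^sup>2" using x0 by (intro mult_left_mono) auto
      thus "2 * (real B * 2 ^ s) + 16 * real p * (real B * 2 ^ s) \<le> x * (\<beta> s)\<^sup>2"
        by (simp add: x_def algebra_simps)
    qed (use B0 p0 in simp)
    with le1 X show ?thesis by (intro exI[of _ X]) simp
  next
    case False
    hence ps: "real p \<le> 2 ^ s" by (metis linorder_not_less of_nat_le_iff of_nat_numeral of_nat_power)
    define L where "L = 18 + 32 * \<theta>"
    have L0: "0 < L" using \<theta> by (simp add: L_def)
    define V where "V b = real p * deviation (2 ^ s) (s + 5) t (blk B b) / (real B * 2 ^ s) / \<theta>" for b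
    have V0: "0 \<le> V b" for b using \<theta> by (simp add: V_def deviation_nonneg)
    define W where "W b = real B + 2 * deviation (2 ^ s) (s + 5) t (blk B b)" for b
    have "\<exists>X\<subseteq>O'. (\<Sum>b<m. energy t (blk B b) (\<lambda>j. if j \<in> O' then eps X j else 0) ^ p)
      \<le> (\<Sum>b<m. (2 * (real B * 2 ^ s) + 16 * real p * W b) ^ p)"
    proof (rule block_signing[OF t O])
      fix b c assume b: "b < m"
      show "0 < W b" using B0 deviation_nonneg[of "2 ^ s" "s + 5" t "blk B b"] by (simp add: W_def)
      show "(\<Sum>k\<in>blk B b. (cmod (\<Sum>j\<in>O'. complex_of_real (c j) * u (t k) j))\<^sup>2) \<le> W b * (\<Sum>j\<in>O'. (c j)\<^sup>2)"
        using column_bound_deviation[OF O, where t = t and I = "blk B b" and c = c] by (simp add: W_def)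
    qed
    then obtain X where X: "X \<subseteq> O'" and le1: "(\<Sum>b<m. energy t (blk B b) (\<lambda>j. if j \<in> O' then eps X j else 0) ^ p)
      \<le> (\<Sum>b<m. (2 * (real B * 2 ^ s) + 16 * real p * W b) ^ p)" by blast
    have "(\<Sum>b<m. (2 * (real B * 2 ^ s) + 16 * real p * W b) ^ p) \<le> real m * (x * (\<beta> s)\<^sup>2) ^ p"
    proof -
      have pt: "(2 * (real B * 2 ^ s) + 16 * real p * W b) ^ p \<le> (x * L) ^ p * (1 + V b ^ (2 * n))" for b
      proof -
        have "2 * (real B * 2 ^ s) + 16 * real p * W b = 2 * x + 16 * real B * real p + 32 * \<theta> * V b * x"
          using B0 \<theta> by (simp add: x_def W_def V_def field_simps)
        also have "\<dots> \<le> 2 * x + 16 * real B * 2 ^ s + 32 * \<theta> * V b * x"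
          using mult_left_mono[OF ps, of "16 * real B"] by simp
        also have "\<dots> = x * (18 + 32 * \<theta> * V b)" by (simp add: x_def algebra_simps)
        \<comment> \<open>The maximum with 1 makes the base at least 1, so that the exponent can be
          raised from \<open>p\<close> to \<open>2 * n\<close>, the order at which the moments are
          known.\<close>
        also have "\<dots> \<le> x * (L * max 1 (V b))"
        proof (rule mult_left_mono)
          have "18 * 1 \<le> 18 * max 1 (V b)" "32 * \<theta> * V b \<le> 32 * \<theta> * max 1 (V b)"
            using \<theta> by (intro mult_left_mono, auto)+
          thus "18 + 32 * \<theta> * V b \<le> L * max 1 (V b)" by (simp only: L_def distrib_right)
        qed (use x0 in simp)
        finally have "(2 * (real B * 2 ^ s) + 16 * real p * W b) ^ p \<le> (x * (L * max 1 (V b))) ^ p"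
          using B0 deviation_nonneg[of "2 ^ s" "s + 5" t "blk B b"] by (intro power_mono) (auto simp: W_def)
        also have "\<dots> = (x * L) ^ p * max 1 (V b) ^ p" by (simp add: power_mult_distrib)
        also have "\<dots> \<le> (x * L) ^ p * max 1 (V b) ^ (2 * n)"
          using pn x0 L0 by (intro mult_left_mono power_increasing) auto
        also have "\<dots> \<le> (x * L) ^ p * (1 + V b ^ (2 * n))"
          using x0 L0 V0 by (intro mult_left_mono) (auto simp: max_def)
        finally show ?thesis .
      qed
      have "(\<Sum>b<m. (2 * (real B * 2 ^ s) + 16 * real p * W b) ^ p) \<le> (\<Sum>b<m. (x * L) ^ p * (1 + V b ^ (2 * n)))"
        by (intro sum_mono pt)
      also have "\<dots> = (x * L) ^ p * (real m + (\<Sum>b<m. V b ^ (2 * n)))"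
        by (simp add: sum_distrib_left[symmetric] sum.distrib)
      also have "\<dots> \<le> (x * L) ^ p * (real m + 32 * real (S + 1) * real m)"
        using dev[OF s] x0 L0 unfolding V_def by (intro mult_left_mono add_left_mono) auto
      \<comment> \<open>The number of levels in \<open>dev\<close> is absorbed by a p-th power,
        since \<open>S \<le> p < 2 ^ p\<close>.\<close>
      also have "\<dots> \<le> (x * L) ^ p * (130 ^ p * real m)"
      proof (rule mult_left_mono)
        have "p < 2 ^ p" by simp
        hence "real p + 1 \<le> 2 ^ p" by (metis Suc_eq_plus1 Suc_leI of_nat_1 of_nat_add of_nat_le_iff of_nat_numeral of_nat_power)
        hence "1 + 32 * real (S + 1) \<le> 65 * 2 ^ p" using Sp pos(5) by simp
        also have "(65 :: real) \<le> 65 ^ p" using pos(5) self_le_power[of "65::real" p] by simp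
        hence "65 * 2 ^ p \<le> 65 ^ p * (2 ^ p :: real)" by (intro mult_right_mono) auto
        also have "\<dots> = 130 ^ p" by (simp add: power_mult_distrib[symmetric])
        finally have "(1 + 32 * real (S + 1)) * real m \<le> 130 ^ p * real m" by (intro mult_right_mono) auto
        thus "real m + 32 * real (S + 1) * real m \<le> 130 ^ p * real m" by (simp only: distrib_right mult_1)
      qed (use x0 L0 in simp)
      also have "\<dots> = real m * (x * (130 * L)) ^ p" by (simp add: power_mult_distrib)
      also have "\<dots> \<le> real m * (x * (\<beta> s)\<^sup>2) ^ p"
      proof (intro mult_left_mono power_mono)
        have "130 * L = (sqrt (130 * L))\<^sup>2" using L0 by simp
        also have "\<dots> \<le> (\<beta> s)\<^sup>2" using L0 p0 by (intro power_mono) (auto simp: \<beta>_def L_def)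
        finally show "130 * L \<le> (\<beta> s)\<^sup>2" .
      qed (use x0 L0 in auto)
      finally show ?thesis .
    qed
    from order_trans[OF le1 this] X show ?thesis by blast
  qed
  moreover have "real m * (x * (\<beta> s)\<^sup>2) ^ p = real m * real B ^ p * (\<beta> s * sqrt (2 ^ s)) ^ (2 * p)"
  proof -
    have "(\<beta> s * sqrt (2 ^ s))\<^sup>2 = (\<beta> s)\<^sup>2 * 2 ^ s" by (simp add: power_mult_distrib)
    moreover have "x * (\<beta> s)\<^sup>2 = real B * ((\<beta> s)\<^sup>2 * 2 ^ s)" by (simp add: x_def)
    ultimately show ?thesis
      unfolding power_mult[of "\<beta> s * sqrt (2 ^ s)" 2 p] by (simp only: power_mult_distrib[of "real B"] mult.assoc)
  qed
  ultimately show "\<exists>X\<subseteq>O'. (\<Sum>b<m. (\<Sum>i<B. (cmod (lin D (u (t (B * fst (b, i) + snd (b, i)))) (\<lambda>j. if j \<in> O' then eps X j else 0)))\<^sup>2) ^ p)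
     \<le> real m * real B ^ p * ((sqrt (130 * (18 + 32 * \<theta>)) + 5 * real p / sqrt (2 ^ s)) * sqrt (2 ^ s)) ^ (2 * p)"
    unfolding fst_conv snd_conv energy_blk \<beta>_def[symmetric] by simp
qed (use pos n_pos D_le BK in auto)

end

text \<open>The subtracted term carries the induction: \<open>4 / sqrt 2 \<le> 3\<close> leaves room
  for the next summand.\<close>

lemma sum_inverse_sqrt_pow2_le: "(\<Sum>s<S. 1 / sqrt (2 ^ s)) \<le> 4 - 4 / sqrt (2 ^ S)"
proof (induction S)
  case (Suc S)
  have r2: "4 / 3 \<le> sqrt 2" by (rule real_le_rsqrt) (simp add: power2_eq_square)
  hence "4 / sqrt 2 \<le> 3" by (simp add: divide_le_eq)
  hence "4 / sqrt 2 * (1 / sqrt (2 ^ S)) \<le> 3 * (1 / sqrt (2 ^ S))" by (intro mult_right_mono) auto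
  hence "4 / sqrt (2 ^ Suc S) \<le> 3 / sqrt (2 ^ S)" by (simp add: real_sqrt_mult)
  moreover have "4 / sqrt (2 ^ S) = 3 / sqrt (2 ^ S) + 1 / sqrt (2 ^ S)" by (simp add: add_divide_distrib[symmetric])
  ultimately show ?case using Suc by simp
qed simp

section \<open>Good signs, good rows and the isometry count\<close>

context signed_blocks
begin

lemma mean_error_nonneg: "0 \<le> mean_error"
  unfolding mean_error_def by (intro avg_nonneg maxf_nonneg net_finite_nonempty) auto

text \<open>Solving the self-bounding inequality gives at most 3/1599 of
  \<open>\<epsilon> * (m * B)\<close>, which is below 1/500.\<close>

lemma mean_error_small:
  fixes \<epsilon> :: real
  assumes eps: "0 < \<epsilon>" "\<epsilon> < 1" and small: "5888 * (\<Sum>s<S. \<beta> s) * sqrt (real (n * K) / real m) \<le> \<epsilon> / 1600"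
  shows "mean_error \<le> \<epsilon> * real (m * B) / 500"
proof -
  have "mean_error \<le> \<epsilon> / 1600 * (mean_error + 3 * real (m * B))"
    using mean_error_le mult_right_mono[OF small, of "mean_error + 3 * real (m * B)"] mean_error_nonneg by simp
  also have "\<dots> \<le> 1 / 1600 * mean_error + \<epsilon> / 1600 * (3 * real (m * B))"
    unfolding distrib_left using eps mean_error_nonneg by (intro add_right_mono mult_right_mono) auto
  also have "\<epsilon> / 1600 * (3 * real (m * B)) = 3 / 1600 * (\<epsilon> * real (m * B))" by simp
  finally have "mean_error \<le> 1 / 1600 * mean_error + 3 / 1600 * (\<epsilon> * real (m * B))" .
  moreover have "0 \<le> \<epsilon> * real (m * B)" using eps by simp
  ultimately show ?thesis by linarith
qed

text \<open>Markov's inequality for the mean error: 8/500 is below 1/16.\<close>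

lemma good_signs:
  fixes \<epsilon> :: real
  assumes eps: "0 < \<epsilon>" "\<epsilon> < 1" and small: "5888 * (\<Sum>s<S. \<beta> s) * sqrt (real (n * K) / real m) \<le> \<epsilon> / 1600"
  defines "G \<equiv> {X \<in> Pow cells. \<forall>y\<in>sparse_net D K S. \<bar>block_power cells X y - row_energy y\<bar> \<le> \<epsilon> * real (m * B) / 8}"
  shows "15 / 16 * real (card (Pow cells)) \<le> real (card G)"
proof -
  define f where "f X = maxf (sparse_net D K S) (\<lambda>y. \<bar>block_power cells X y - row_energy y\<bar>)" for X
  define \<alpha> where "\<alpha> = \<epsilon> * real (m * B) / 8"
  have a0: "0 < \<alpha>" using eps pos by (simp add: \<alpha>_def)
  have f0: "0 \<le> f X" for X unfolding f_def by (intro maxf_nonneg net_finite_nonempty) auto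
  have "real (card {X \<in> Pow cells. \<alpha> < f X}) \<le> avg (Pow cells) f / \<alpha> * real (card (Pow cells))"
    by (rule avg_markov) (use a0 f0 in auto)
  also have "\<dots> \<le> 1 / 16 * real (card (Pow cells))"
  proof (rule mult_right_mono)
    have "avg (Pow cells) f \<le> \<epsilon> * real (m * B) / 500"
      using mean_error_small[OF eps small] by (simp add: mean_error_def f_def[abs_def])
    also have "\<dots> \<le> 1 / 16 * \<alpha>" using eps by (simp add: \<alpha>_def)
    finally show "avg (Pow cells) f / \<alpha> \<le> 1 / 16" using a0 by (simp add: divide_le_eq)
  qed simp
  finally have bad: "real (card {X \<in> Pow cells. \<alpha> < f X}) \<le> 1 / 16 * real (card (Pow cells))" .
  have sub: "Pow cells - {X \<in> Pow cells. \<alpha> < f X} \<subseteq> G"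
  proof
    fix X assume X: "X \<in> Pow cells - {X \<in> Pow cells. \<alpha> < f X}"
    have "\<bar>block_power cells X y - row_energy y\<bar> \<le> \<alpha>" if y: "y \<in> sparse_net D K S" for y
      using maxf_ge[OF net_finite_nonempty(1) y, of "\<lambda>y. \<bar>block_power cells X y - row_energy y\<bar>"] X
      by (auto simp: f_def)
    thus "X \<in> G" using X by (simp add: G_def \<alpha>_def)
  qed
  have "card (Pow cells) - card {X \<in> Pow cells. \<alpha> < f X} \<le> card (Pow cells - {X \<in> Pow cells. \<alpha> < f X})"
    by (intro diff_card_le_card_Diff) simp
  also have "\<dots> \<le> card G" by (rule card_mono[OF _ sub]) (simp add: G_def)
  finally have "real (card (Pow cells)) - real (card {X \<in> Pow cells. \<alpha> < f X}) \<le> real (card G)" by linarith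
  thus ?thesis using bad by linarith
qed

text \<open>\<open>v\<close> lists the rows of the signed matrix, so that the block power becomes a
  sum of squared linear forms and extends from the net to the ball.\<close>

lemma isometry_of_net:
  fixes M :: real
  assumes S: "32 * K \<le> 2 ^ S" and net: "\<And>y. y \<in> sparse_net D K S \<Longrightarrow> \<bar>block_power cells X y - M * (\<Sum>j<D. (y j)\<^sup>2)\<bar> \<le> \<delta>"
    and x: "x \<in> sparse_ball D K"
  shows "\<bar>block_power cells X x - M * (\<Sum>j<D. (x j)\<^sup>2)\<bar> \<le> 2 * \<delta>"
proof -
  define v where "v b j = (\<Sum>i<B. complex_of_real (eps X (b, i)) * a (b, i) j)" for b j
  have v: "lin D (v b) y = phi cells X b y" if "b < m" for b y
  proof -
    have "lin D (v b) y = (\<Sum>j<D. \<Sum>i<B. complex_of_real (eps X (b, i)) * (a (b, i) j * complex_of_real (y j)))"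
      by (simp add: lin_def v_def sum_distrib_right mult.assoc)
    also have "\<dots> = (\<Sum>i<B. \<Sum>j<D. complex_of_real (eps X (b, i)) * (a (b, i) j * complex_of_real (y j)))"
      by (rule sum.swap)
    also have "\<dots> = phi cells X b y"
      using that by (simp add: phi_def lin_def sum_distrib_left cells_def)
    finally show ?thesis .
  qed
  have e: "block_power cells X y = 1 * (\<Sum>b\<in>{..<m}. (cmod (lin D (v b) y))\<^sup>2)" for y
    by (simp add: block_power_def v)
  show ?thesis
    using quadratic_form_extension[OF pos(4) S _ x, of 1 v "{..<m}" M \<delta>] net unfolding e by blast
qed

end

lemma card_Sigma_ge:
  fixes c :: real
  assumes "finite A" "\<And>x. x \<in> A \<Longrightarrow> finite (B x)" "\<And>x. x \<in> A \<Longrightarrow> c \<le> real (card (B x))"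
  shows "real (card A) * c \<le> real (card (SIGMA x:A. B x))"
  using assms by (simp add: card_SigmaI sum_bounded_below)

context bounded_orthonormal
begin

text \<open>Two applications of Markov's inequality, each losing 1/16. The moments of the block
  deviations are summed over all levels, with mean at most \<open>2 * (S + 1) * m\<close>, so
  sixteen times this mean is a threshold that holds at every level at once. The deviation of all
  rows together is treated at order \<open>2 * n\<close>.\<close>

lemma good_rows:
  fixes \<epsilon> \<theta> \<kappa> :: real
  assumes pos: "0 < m" "0 < B" "0 < K" "0 < S" "0 < p" and Sp: "S \<le> p"
    and kap: "real p ^ 4 * (real n)\<^sup>2 \<le> \<kappa> * real B"
    and \<theta>: "0 < \<theta>" "\<theta>\<^sup>2 = 288 * 107495424 * \<kappa> + 41472 * 107495424\<^sup>2 * \<kappa>\<^sup>2"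
    and eps: "0 < \<epsilon>" "\<epsilon> < 1"
    and m: "100000 * 107495424 * \<kappa> * real (n * K * p\<^sup>2) \<le> \<epsilon>\<^sup>2 * real m"
  defines "\<Omega> \<equiv> PiE {..<m * B} (\<lambda>_. {..<d})"
  defines "G \<equiv> {t \<in> \<Omega>. deviation K S t {..<m * B} \<le> \<epsilon> * real (m * B) / 8 \<and>
    (\<forall>s\<le>S. (\<Sum>b<m. (real p * deviation (2 ^ s) (s + 5) t (blk B b) / (real B * 2 ^ s) / \<theta>) ^ (2 * n))
      \<le> 32 * real (S + 1) * real m)}"
  shows "7 / 8 * real (card \<Omega>) \<le> real (card G)"
proof -
  have \<Omega>: "finite \<Omega>" "\<Omega> \<noteq> {}"
    using d_pos by (auto simp: \<Omega>_def PiE_eq_empty_iff intro!: finite_PiE)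
  define h where "h s t = (\<Sum>b<m. (real p * deviation (2 ^ s) (s + 5) t (blk B b) / (real B * 2 ^ s) / \<theta>) ^ (2 * n))" for s t
  define f where "f t = (\<Sum>s\<in>{..S}. h s t)" for t
  have h0: "0 \<le> h s t" for s t
    unfolding h_def using \<theta> by (intro sum_nonneg zero_le_power divide_nonneg_nonneg mult_nonneg_nonneg deviation_nonneg) auto
  define A where "A = 32 * real (S + 1) * real m"
  have A0: "0 < A" using pos by (simp add: A_def)
  define D1 where "D1 t = deviation K S t {..<m * B}" for t
  define M where "M = real (m * B)"
  have M0: "0 < M" using pos by (simp add: M_def)
  define \<Gamma> where "\<Gamma> = 10368 * real S * real n * sqrt K"
  have "avg \<Omega> f = (\<Sum>s\<in>{..S}. \<Sum>b<m. avg \<Omega> (\<lambda>t. (real p * deviation (2 ^ s) (s + 5) t (blk B b) / (real B * 2 ^ s) / \<theta>) ^ (2 * n)))"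
    unfolding f_def h_def avg_sum ..
  also have "\<dots> \<le> (\<Sum>s\<in>{..S}. \<Sum>b<m. 2)"
    unfolding \<Omega>_def using pos Sp by (intro sum_mono block_deviation_moment[OF _ _ _ kap _ \<theta>]) auto
  also have "\<dots> = 1 / 16 * A" by (simp add: A_def)
  finally have "avg \<Omega> f / A \<le> 1 / 16" using A0 by (simp add: divide_le_eq)
  moreover have "real (card {t \<in> \<Omega>. A < f t}) \<le> avg \<Omega> f / A * real (card \<Omega>)"
    by (rule avg_markov[OF \<Omega>(1) _ A0]) (simp add: f_def h0 sum_nonneg)
  ultimately have bad1: "real (card {t \<in> \<Omega>. A < f t}) \<le> 1 / 16 * real (card \<Omega>)"
    by (meson mult_right_mono of_nat_0_le_iff order_trans)
  have \<kappa>0: "0 \<le> \<kappa>"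
  proof -
    have "0 \<le> \<kappa> * real B" using kap by (rule order_trans[rotated]) simp
    thus ?thesis using pos by (simp add: zero_le_mult_iff)
  qed
  define \<tau> where "\<tau> = \<epsilon>\<^sup>2 * M / 100000"
  have \<Gamma>2: "\<Gamma>\<^sup>2 \<le> \<tau>"
  proof -
    \<comment> \<open>\<open>\<Gamma>\<^sup>2\<close> has one factor \<open>n\<close> more than the
      hypothesis on \<open>m\<close> provides; the \<open>B\<close> rows of each block pay for
      it.\<close>
    have "real n \<le> \<kappa> * real B"
    proof -
      have "real n * 1 \<le> real n * (real n * real p ^ 4)"
      proof (rule mult_left_mono)
        have "1 \<le> real n" "1 \<le> real p ^ 4" using n_pos pos by (auto intro: one_le_power)
        thus "1 \<le> real n * real p ^ 4" using mult_mono[of 1 "real n" 1 "real p ^ 4"] by simp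
      qed simp
      also have "\<dots> \<le> \<kappa> * real B" using kap by (simp add: power2_eq_square mult_ac)
      finally show ?thesis by simp
    qed
    hence nB: "real n * real (n * K * p\<^sup>2) \<le> \<kappa> * real B * real (n * K * p\<^sup>2)" by (intro mult_right_mono) auto
    have "\<Gamma>\<^sup>2 = 107495424 * ((real S)\<^sup>2 * (real n)\<^sup>2 * real K)"
      by (simp add: \<Gamma>_def power_mult_distrib)
    also have "\<dots> \<le> 107495424 * ((real p)\<^sup>2 * (real n)\<^sup>2 * real K)"
      using Sp by (intro mult_left_mono mult_right_mono power_mono) auto
    also have "\<dots> = 107495424 * (real n * real (n * K * p\<^sup>2))" by (simp add: power2_eq_square)
    also have "\<dots> \<le> 107495424 * (\<kappa> * real B * real (n * K * p\<^sup>2))" using nB by (intro mult_left_mono) auto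
    also have "\<dots> = (100000 * 107495424 * \<kappa> * real (n * K * p\<^sup>2)) * real B / 100000" by simp
    also have "\<dots> \<le> (\<epsilon>\<^sup>2 * real m) * real B / 100000"
      using m by (intro divide_right_mono mult_right_mono) auto
    finally show ?thesis by (simp add: \<tau>_def M_def)
  qed
  have \<Gamma>M: "8 * \<Gamma>\<^sup>2 * M + 32 * \<Gamma> ^ 4 \<le> (\<epsilon> * M / 8)\<^sup>2 * (1 / 64)"
  proof -
    have e1: "\<epsilon>\<^sup>2 \<le> 1" using eps by (simp add: power_le_one)
    have "\<Gamma> ^ 4 = (\<Gamma>\<^sup>2)\<^sup>2" by simp
    also have "\<dots> \<le> \<tau>\<^sup>2" using \<Gamma>2 by (intro power_mono) auto
    also have "\<dots> = \<epsilon>\<^sup>2 * (\<epsilon>\<^sup>2 * M\<^sup>2) / 10000000000" by (simp add: \<tau>_def power2_eq_square)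
    also have "\<dots> \<le> 1 * (\<epsilon>\<^sup>2 * M\<^sup>2) / 10000000000"
      using e1 by (intro divide_right_mono mult_right_mono) auto
    finally have 1: "\<Gamma> ^ 4 \<le> (\<epsilon>\<^sup>2 * M\<^sup>2) / 10000000000" by simp
    have "\<Gamma>\<^sup>2 * M \<le> \<tau> * M" using \<Gamma>2 M0 by (intro mult_right_mono) auto
    also have "\<dots> = (\<epsilon>\<^sup>2 * M\<^sup>2) / 100000" by (simp add: \<tau>_def power2_eq_square)
    finally have 2: "\<Gamma>\<^sup>2 * M \<le> (\<epsilon>\<^sup>2 * M\<^sup>2) / 100000" .
    have 3: "(\<epsilon> * M / 8)\<^sup>2 * (1 / 64) = (\<epsilon>\<^sup>2 * M\<^sup>2) / 4096" by (simp add: power_divide power_mult_distrib)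
    have "0 \<le> \<epsilon>\<^sup>2 * M\<^sup>2" by simp
    with 1 2 show ?thesis unfolding 3 by linarith
  qed
  define a where "a = (\<epsilon> * M / 8) ^ (2 * n)"
  have a0: "0 < a" using eps M0 by (simp add: a_def)
  have "avg \<Omega> (\<lambda>t. D1 t ^ (2 * n)) \<le> 2 * (8 * \<Gamma>\<^sup>2 * real (card {..<m * B}) + 32 * \<Gamma> ^ 4) ^ n"
    unfolding \<Omega>_def D1_def \<Gamma>_def using pos
    by (intro deviation_moment) (auto simp: lessThan_empty_iff)
  also have "\<dots> = 2 * (8 * \<Gamma>\<^sup>2 * M + 32 * \<Gamma> ^ 4) ^ n" by (simp add: M_def)
  also have "\<dots> \<le> 2 * ((\<epsilon> * M / 8)\<^sup>2 * (1 / 64)) ^ n"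
    using \<Gamma>M M0 by (intro mult_left_mono power_mono) auto
  also have "\<dots> = 2 * (a * (1 / 64) ^ n)" unfolding a_def power_mult power_mult_distrib ..
  also have "\<dots> \<le> 2 * (a * (1 / 64))"
    using a0 power_decreasing[of 1 n "1/64::real"] n_pos by (intro mult_left_mono) auto
  finally have "avg \<Omega> (\<lambda>t. D1 t ^ (2 * n)) / a \<le> 1 / 16" using a0 by (simp add: divide_le_eq)
  moreover have "real (card {t \<in> \<Omega>. a < D1 t ^ (2 * n)}) \<le> avg \<Omega> (\<lambda>t. D1 t ^ (2 * n)) / a * real (card \<Omega>)"
    by (rule avg_markov[OF \<Omega>(1) _ a0]) (simp add: D1_def deviation_nonneg)
  ultimately have bad2: "real (card {t \<in> \<Omega>. a < D1 t ^ (2 * n)}) \<le> 1 / 16 * real (card \<Omega>)"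
    by (meson mult_right_mono of_nat_0_le_iff order_trans)
  let ?B1 = "{t \<in> \<Omega>. A < f t}" and ?B2 = "{t \<in> \<Omega>. a < D1 t ^ (2 * n)}"
  have sub: "\<Omega> - (?B1 \<union> ?B2) \<subseteq> G"
  proof
    fix t assume t: "t \<in> \<Omega> - (?B1 \<union> ?B2)"
    have "h s t \<le> A" if "s \<le> S" for s
    proof -
      have "h s t \<le> f t" unfolding f_def using that h0 by (intro member_le_sum) auto
      moreover have "f t \<le> A" using t by auto
      ultimately show ?thesis by linarith
    qed
    moreover have "D1 t \<le> \<epsilon> * M / 8"
    proof (rule power_le_imp_le_base)
      have "D1 t ^ (2 * n) \<le> a" using t by auto
      thus "D1 t ^ Suc (2 * n - 1) \<le> (\<epsilon> * M / 8) ^ Suc (2 * n - 1)"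
        using n_pos by (simp add: a_def)
    qed (use eps M0 in simp)
    ultimately show "t \<in> G" using t by (simp add: G_def h_def A_def D1_def M_def)
  qed
  have "card \<Omega> - card (?B1 \<union> ?B2) \<le> card (\<Omega> - (?B1 \<union> ?B2))"
    using \<Omega> by (intro diff_card_le_card_Diff) auto
  also have "\<dots> \<le> card G" by (rule card_mono[OF _ sub]) (simp add: G_def \<Omega>)
  finally have "real (card \<Omega>) - real (card (?B1 \<union> ?B2)) \<le> real (card G)" by linarith
  moreover have "real (card (?B1 \<union> ?B2)) \<le> real (card ?B1) + real (card ?B2)"
    using card_Un_le[of ?B1 ?B2] by linarith
  ultimately show ?thesis using bad1 bad2 by linarith
qed

text \<open>At least 7/8 of the row choices are good, and for each of them at least 15/16 of the
  signs; the product exceeds 3/4. On the net rows and signs each contribute an error \<epsilon>/8,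
  and the passage to the ball doubles the sum.\<close>

theorem signed_block_isometry:
  fixes \<epsilon> \<theta> \<kappa> :: real
  assumes pos: "0 < m" "0 < B" "0 < K" "0 < S" "0 < p" and S: "32 * K \<le> 2 ^ S" and Sp: "S \<le> p" and pn: "p \<le> 2 * n"
    and BK: "B * K \<le> 2 ^ (p - 1)"
    and kap: "real p ^ 4 * (real n)\<^sup>2 \<le> \<kappa> * real B"
    and \<theta>: "0 < \<theta>" "\<theta>\<^sup>2 = 288 * 107495424 * \<kappa> + 41472 * 107495424\<^sup>2 * \<kappa>\<^sup>2"
    and eps: "0 < \<epsilon>" "\<epsilon> < 1"
    and m: "(100000 * 107495424 * \<kappa> + (1600 * 5888 * (sqrt (130 * (18 + 32 * \<theta>)) + 20))\<^sup>2) * real (n * K * p\<^sup>2) \<le> \<epsilon>\<^sup>2 * real m"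
  defines "\<Omega> \<equiv> PiE {..<m * B} (\<lambda>_. {..<d})" and "\<Sigma> \<equiv> Pow ({..<m} \<times> {..<B})"
  shows "3 / 4 * real (card (\<Omega> \<times> \<Sigma>)) \<le> real (card {(t, X) \<in> \<Omega> \<times> \<Sigma>. \<forall>x\<in>sparse_ball D K.
    \<bar>(\<Sum>b<m. (cmod (\<Sum>i<B. complex_of_real (eps X (b, i)) * lin D (u (t (B * b + i))) x))\<^sup>2)
      - real (m * B) * (\<Sum>j<D. (x j)\<^sup>2)\<bar> \<le> \<epsilon> * real (m * B)})"
    (is "_ \<le> real (card ?R)")
proof -
  have \<Omega>: "finite \<Omega>" by (auto simp: \<Omega>_def intro!: finite_PiE)
  have \<kappa>0: "0 \<le> \<kappa>"
  proof -
    have "0 \<le> \<kappa> * real B" using kap by (rule order_trans[rotated]) simp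
    thus ?thesis using pos by (simp add: zero_le_mult_iff)
  qed
  define L where "L = sqrt (130 * (18 + 32 * \<theta>))"
  have L0: "0 \<le> L" using \<theta> by (simp add: L_def)
  define N where "N = real (n * K * p\<^sup>2)"
  have m1: "100000 * 107495424 * \<kappa> * N \<le> \<epsilon>\<^sup>2 * real m"
    and m2: "(1600 * 5888 * (L + 20))\<^sup>2 * N \<le> \<epsilon>\<^sup>2 * real m"
  proof -
    have "0 \<le> (1600 * 5888 * (L + 20))\<^sup>2 * N" "0 \<le> 100000 * 107495424 * \<kappa> * N"
      using \<kappa>0 by (auto simp: N_def)
    thus "100000 * 107495424 * \<kappa> * N \<le> \<epsilon>\<^sup>2 * real m" "(1600 * 5888 * (L + 20))\<^sup>2 * N \<le> \<epsilon>\<^sup>2 * real m"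
      using m unfolding L_def[symmetric] N_def[symmetric] distrib_right by linarith+
  qed
  define G where "G = {t \<in> \<Omega>. deviation K S t {..<m * B} \<le> \<epsilon> * real (m * B) / 8 \<and>
    (\<forall>s\<le>S. (\<Sum>b<m. (real p * deviation (2 ^ s) (s + 5) t (blk B b) / (real B * 2 ^ s) / \<theta>) ^ (2 * n))
      \<le> 32 * real (S + 1) * real m)}"
  have cG: "7 / 8 * real (card \<Omega>) \<le> real (card G)"
    unfolding G_def \<Omega>_def by (rule good_rows[OF pos Sp kap \<theta> eps m1[unfolded N_def]])
  have finG: "finite G" using \<Omega> by (simp add: G_def)
  define H where "H t = {X \<in> \<Sigma>. (t, X) \<in> ?R}" for t
  have cH: "15 / 16 * real (card \<Sigma>) \<le> real (card (H t))" if t: "t \<in> G" for t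
  proof -
    have td: "t k < d" if "k < m * B" for k using t that by (auto simp: G_def \<Omega>_def PiE_iff)
    have dK: "deviation K S t {..<m * B} \<le> \<epsilon> * real (m * B) / 8" using t by (simp add: G_def)
    moreover have "\<epsilon> * real (m * B) \<le> 1 * real (m * B)" using eps by (intro mult_right_mono) auto
    ultimately have dM: "deviation K S t {..<m * B} \<le> real (m * B)" by linarith
    define \<beta> where "\<beta> s = L + 5 * real p / sqrt (2 ^ s)" for s
    interpret signed_blocks D m B n K S p "\<lambda>k. u (t (B * fst k + snd k))" \<beta>
      unfolding \<beta>_def L_def using t by (intro signed_blocks_of_deviation[OF pos Sp pn BK \<theta>(1) td _ dM]) (simp_all add: G_def)
    have small: "5888 * (\<Sum>s<S. \<beta> s) * sqrt (real (n * K) / real m) \<le> \<epsilon> / 1600"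
    proof -
      have "(\<Sum>s<S. \<beta> s) = real S * L + 5 * real p * (\<Sum>s<S. 1 / sqrt (2 ^ s))"
        by (simp add: \<beta>_def sum.distrib sum_distrib_left)
      \<comment> \<open>The constant part occurs on \<open>S \<le> p\<close> levels and the other
        part is geometric, so both sum to order \<open>p\<close>.\<close>
      also have "\<dots> \<le> real p * L + 5 * real p * 4"
      proof (intro add_mono mult_right_mono mult_left_mono)
        have "(\<Sum>s<S. 1 / sqrt (2 ^ s)) \<le> 4 - 4 / sqrt (2 ^ S)" by (rule sum_inverse_sqrt_pow2_le)
        moreover have "0 \<le> 4 / sqrt (2 ^ S)" by simp
        ultimately show "(\<Sum>s<S. 1 / sqrt (2 ^ s)) \<le> 4" by linarith
      qed (use Sp L0 in auto)
      finally have b: "(\<Sum>s<S. \<beta> s) \<le> real p * (L + 20)" by (simp add: algebra_simps)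
      have "(1600 * 5888 * (L + 20) * (real p * sqrt (real (n * K) / real m)))\<^sup>2 = (1600 * 5888 * (L + 20))\<^sup>2 * N / real m"
        by (simp add: power_mult_distrib N_def)
      also have "\<dots> \<le> \<epsilon>\<^sup>2" using m2 pos by (simp add: divide_le_eq)
      finally have "1600 * 5888 * (L + 20) * (real p * sqrt (real (n * K) / real m)) \<le> \<epsilon>"
        by (rule power2_le_imp_le) (use eps in simp)
      moreover have "5888 * (\<Sum>s<S. \<beta> s) * sqrt (real (n * K) / real m)
          \<le> 5888 * (real p * (L + 20)) * sqrt (real (n * K) / real m)"
        using b by (intro mult_right_mono mult_left_mono) auto
      moreover have "5888 * (real p * (L + 20)) * sqrt (real (n * K) / real m)
          = 1600 * 5888 * (L + 20) * (real p * sqrt (real (n * K) / real m)) / 1600" by simp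
      ultimately show ?thesis by linarith
    qed
    have cl: "Pow cells = \<Sigma>" by (simp add: cells_def \<Sigma>_def)
    have "15 / 16 * real (card (Pow cells)) \<le> real (card {X \<in> Pow cells. \<forall>y\<in>sparse_net D K S.
       \<bar>block_power cells X y - row_energy y\<bar> \<le> \<epsilon> * real (m * B) / 8})"
      by (rule good_signs[OF eps small])
    also have "\<dots> \<le> real (card (H t))"
    proof (intro of_nat_mono card_mono subsetI)
      show "finite (H t)" by (simp add: H_def \<Sigma>_def)
      fix X assume "X \<in> {X \<in> Pow cells. \<forall>y\<in>sparse_net D K S. \<bar>block_power cells X y - row_energy y\<bar> \<le> \<epsilon> * real (m * B) / 8}"
      hence X: "X \<in> \<Sigma>" and n1: "\<And>y. y \<in> sparse_net D K S \<Longrightarrow> \<bar>block_power cells X y - row_energy y\<bar> \<le> \<epsilon> * real (m * B) / 8"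
        by (auto simp: cl)
      have n2: "\<bar>block_power cells X y - real (m * B) * (\<Sum>j<D. (y j)\<^sup>2)\<bar> \<le> \<epsilon> * real (m * B) / 4" if y: "y \<in> sparse_net D K S" for y
      proof -
        have "row_energy y = energy t {..<m * B} y"
          unfolding row_energy_def fst_conv snd_conv energy_blk unfolding energy_def by (rule sum_blk_total)
        moreover have "\<bar>energy t {..<m * B} y - real (card {..<m * B}) * (\<Sum>j<D. (y j)\<^sup>2)\<bar> \<le> deviation K S t {..<m * B}"
          unfolding deviation_def by (rule maxf_ge[OF finite_sparse_net y])
        ultimately show ?thesis using n1[OF y] dK unfolding card_lessThan by linarith
      qed
      have "\<bar>block_power cells X x - real (m * B) * (\<Sum>j<D. (x j)\<^sup>2)\<bar> \<le> \<epsilon> * real (m * B)" if x: "x \<in> sparse_ball D K" for x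
      proof -
        have "0 \<le> \<epsilon> * real (m * B)" using eps by simp
        thus ?thesis using isometry_of_net[OF S n2 x] by linarith
      qed
      moreover have "block_power cells X x = (\<Sum>b<m. (cmod (\<Sum>i<B. complex_of_real (eps X (b, i)) * lin D (u (t (B * b + i))) x))\<^sup>2)" for x
        by (simp add: block_power_def phi_def cells_def)
      ultimately show "X \<in> H t" using X t by (simp add: H_def G_def)
    qed
    finally show ?thesis unfolding cl .
  qed
  have finS: "finite \<Sigma>" by (simp add: \<Sigma>_def)
  have "3 / 4 * real (card (\<Omega> \<times> \<Sigma>)) \<le> (7 / 8 * real (card \<Omega>)) * (15 / 16 * real (card \<Sigma>))"
    by (simp add: card_cartesian_product)
  also have "\<dots> \<le> real (card G) * (15 / 16 * real (card \<Sigma>))"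
    using cG by (intro mult_right_mono) auto
  also have "\<dots> \<le> real (card (SIGMA t:G. H t))"
    using finG finS cH by (intro card_Sigma_ge) (auto simp: H_def)
  also have "\<dots> \<le> real (card ?R)"
    using \<Omega> finS by (intro of_nat_mono card_mono finite_subset[of ?R "\<Omega> \<times> \<Sigma>"]) (auto simp: H_def)
  finally show ?thesis .
qed

end

lemma sum_double: "(\<Sum>j<2 * d. f j) = (\<Sum>j<d. f j) + (\<Sum>j<d. f (d + j :: nat) :: 'a :: comm_monoid_add)"
proof -
  have "(\<Sum>j<2 * d. f j) = (\<Sum>b<2. \<Sum>k\<in>blk d b. f k)" by (rule sum_blk_total[symmetric])
  also have "{..<2::nat} = {0, 1}" by auto
  finally show ?thesis unfolding sum_blk by simp
qed

lemma one_less_ln_3: "1 < ln (3 :: real)"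
proof -
  have "exp 1 < (3 :: real)" using e_less_272 by simp
  hence "ln (exp 1) < ln (3 :: real)" by (subst ln_less_cancel_iff) auto
  thus ?thesis by simp
qed

subsection \<open>The parameters\<close>

text \<open>With l = ln (k ln d), \<open>p\<close> is the least integer such that
  \<open>2 ^ p\<close> is at least 64 exp (c l). As \<open>B\<close> is at most (ln d)^c and
  \<open>c \<ge> 1\<close>, this dominates \<open>64 * B * k\<close>. Since l is at most 2 ln d,
  both \<open>p\<close> and \<open>n\<close> are at most of order ln d, and
  \<open>p ^ 4 * n\<^sup>2\<close> is of order (ln d)^6.\<close>

lemma parameter_choice:
  fixes c :: real
  assumes c: "1 \<le> c"
  shows "\<exists>\<kappa>>0. \<exists>Cn>0. \<exists>Cp>0. \<forall>d k B :: nat. 3 \<le> d \<longrightarrow> 0 < k \<longrightarrow> k \<le> d \<longrightarrow> 0 < B \<longrightarrow>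
    ln (real d) powr 6.5 \<le> real B \<longrightarrow> real B \<le> ln (real d) powr c \<longrightarrow>
    (\<exists>p n. 0 < p \<and> 0 < n \<and> p \<le> 2 * n \<and> 64 * k \<le> 2 ^ p \<and> B * (2 * k) \<le> 2 ^ (p - 1) \<and>
      real p ^ 4 * (real n)\<^sup>2 \<le> \<kappa> * real B \<and> d \<le> 3 ^ n \<and> 2 * (2 * d) + 1 \<le> 3 ^ n \<and>
      real p \<le> Cp * ln (real k * ln (real d)) \<and> real n \<le> Cn * ln (real d))"
proof -
  \<comment> \<open>A positive lower bound for l, available because \<open>d \<ge> 3\<close>; it
    turns the additive constants in \<open>p\<close> into multiples of l.\<close>
  define c1 where "c1 = ln (ln (3 :: real))"
  have c1: "0 < c1" using one_less_ln_3 by (simp add: c1_def)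
  define Cp where "Cp = (ln 64 / c1 + c) / ln 2 + 1 / c1"
  define Cn where "Cn = 4 + 2 * Cp"
  define \<kappa> where "\<kappa> = 16 * Cp ^ 4 * Cn\<^sup>2"
  have Cp0: "0 < Cp" using c1 c by (auto simp: Cp_def intro!: add_pos_pos divide_pos_pos)
  have Cn0: "0 < Cn" using Cp0 by (simp add: Cn_def)
  have \<kappa>0: "0 < \<kappa>" using Cp0 Cn0 by (simp add: \<kappa>_def)
  have "\<exists>p n. 0 < p \<and> 0 < n \<and> p \<le> 2 * n \<and> 64 * k \<le> 2 ^ p \<and> B * (2 * k) \<le> 2 ^ (p - 1) \<and>
      real p ^ 4 * (real n)\<^sup>2 \<le> \<kappa> * real B \<and> d \<le> 3 ^ n \<and> 2 * (2 * d) + 1 \<le> 3 ^ n \<and>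
      real p \<le> Cp * ln (real k * ln (real d)) \<and> real n \<le> Cn * ln (real d)"
    if d: "3 \<le> d" and k: "0 < k" "k \<le> d" and B: "0 < B" "ln (real d) powr 6.5 \<le> real B" "real B \<le> ln (real d) powr c"
    for d k B :: nat
  proof -
    define lam where "lam = ln (real d)"
    have "ln 3 \<le> lam" using d by (simp add: lam_def)
    hence lam: "1 < lam" "ln 3 \<le> lam" using one_less_ln_3 by auto
    define l where "l = ln (real k * lam)"
    have lk: "l = ln (real k) + ln lam" using k lam by (simp add: l_def ln_mult)
    have lnk: "0 \<le> ln (real k)" using k by simp
    have c1l: "c1 \<le> ln lam" using lam one_less_ln_3 by (simp add: c1_def)
    have l1: "c1 \<le> l" using lk lnk c1l by simp
    have l0: "0 < l" using c1 l1 by simp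
    have l2: "l \<le> 2 * lam"
    proof -
      have "ln (real k) \<le> lam" using k d by (simp add: lam_def)
      moreover have "ln lam \<le> lam - 1" by (rule ln_le_minus_one) (use lam in simp)
      ultimately show ?thesis using lk by simp
    qed
    define p where "p = nat \<lceil>(ln 64 + c * l) / ln 2\<rceil>"
    have pos64: "0 < (ln 64 + c * l) / ln 2" using c l0 by (auto intro!: divide_pos_pos add_pos_pos)
    have p_ge: "(ln 64 + c * l) / ln 2 \<le> real p" unfolding p_def by (rule real_nat_ceiling_ge)
    have p_le: "real p \<le> (ln 64 + c * l) / ln 2 + 1" unfolding p_def using pos64 by linarith
    have p0: "0 < p" using p_ge pos64 by (cases p) auto
    have pl: "real p \<le> Cp * l"
    proof -
      have "ln 64 \<le> ln 64 / c1 * l" using c1 l1 by (simp add: field_simps)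
      moreover have "1 \<le> 1 / c1 * l" using c1 l1 by (simp add: field_simps)
      ultimately have "(ln 64 + c * l) / ln 2 + 1 \<le> (ln 64 / c1 * l + c * l) / ln 2 + 1 / c1 * l"
        by (intro add_mono divide_right_mono) auto
      also have "\<dots> = Cp * l" by (simp add: Cp_def algebra_simps add_divide_distrib)
      finally show ?thesis using p_le by linarith
    qed
    have big: "64 * real B * real k \<le> 2 ^ p"
    proof -
      have "real B \<le> lam powr c" using B(3) by (simp only: lam_def)
      hence "ln (real B) \<le> ln (lam powr c)" using B(1) lam by (subst ln_le_cancel_iff) auto
      hence "ln (real B) \<le> c * ln lam" using lam by (simp add: ln_powr)
      moreover have "1 * ln (real k) \<le> c * ln (real k)" using c lnk by (rule mult_right_mono)
      ultimately have "ln 64 + ln (real B) + ln (real k) \<le> ln 64 + c * l" by (simp add: lk distrib_left)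
      also have "\<dots> \<le> real p * ln 2" using p_ge by (simp add: pos_divide_le_eq)
      finally have "ln (64 * real B * real k) \<le> ln (2 ^ p)"
        using B k by (simp add: ln_mult ln_realpow)
      thus ?thesis using B k by (subst (asm) ln_le_cancel_iff) auto
    qed
    have big': "64 * B * k \<le> 2 ^ p"
    proof -
      have "real (64 * B * k) \<le> real (2 ^ p)" using big by simp
      thus ?thesis by (rule of_nat_le_iff[THEN iffD1])
    qed
    have p64: "64 * k \<le> 2 ^ p"
    proof -
      have "64 * 1 * k \<le> 64 * B * k" using B by (intro mult_le_mono) auto
      from order_trans[OF this big'] show ?thesis by simp
    qed
    have pB: "B * (2 * k) \<le> 2 ^ (p - 1)"
    proof -
      have "2 * (B * (2 * k)) \<le> 64 * B * k" by simp
      also have "\<dots> \<le> 2 * 2 ^ (p - 1)" using big' p0 by (cases p) auto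
      finally show ?thesis by simp
    qed
    define n where "n = nat \<lceil>(3 + 2 * Cp) * lam\<rceil>"
    have pos3: "0 < (3 + 2 * Cp) * lam" using Cp0 lam by (intro mult_pos_pos) auto
    have n_ge: "(3 + 2 * Cp) * lam \<le> real n" unfolding n_def by (rule real_nat_ceiling_ge)
    have "real n \<le> (3 + 2 * Cp) * lam + 1" unfolding n_def using pos3 by linarith
    also have "\<dots> \<le> (3 + 2 * Cp) * lam + lam" using lam by simp
    finally have nl: "real n \<le> Cn * lam" by (simp add: Cn_def algebra_simps)
    have n0: "0 < n" using n_ge pos3 by (cases n) auto
    have pn: "p \<le> n"
    proof -
      have "real p \<le> Cp * (2 * lam)" using pl mult_left_mono[OF l2, of Cp] Cp0 by linarith
      also have "\<dots> \<le> (3 + 2 * Cp) * lam" using lam by (simp add: algebra_simps)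
      finally show ?thesis using n_ge by linarith
    qed
    have n3: "3 * lam \<le> real n"
    proof -
      have "0 \<le> Cp * lam" using Cp0 lam by simp
      thus ?thesis using n_ge by (simp add: algebra_simps)
    qed
    have d3: "d ^ 3 \<le> 3 ^ n"
    proof -
      have "ln (real d ^ 3) = 3 * lam" using d by (simp add: ln_realpow lam_def)
      also have "\<dots> \<le> real n * 1" using n3 by simp
      also have "\<dots> \<le> real n * ln 3" using one_less_ln_3 by (intro mult_left_mono) auto
      also have "\<dots> = ln (3 ^ n)" by (simp add: ln_realpow)
      finally have "real d ^ 3 \<le> 3 ^ n" using d by (subst (asm) ln_le_cancel_iff) auto
      hence "real (d ^ 3) \<le> real (3 ^ n)" by simp
      thus ?thesis by (rule of_nat_le_iff[THEN iffD1])
    qed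
    have dn: "2 * (2 * d) + 1 \<le> 3 ^ n"
    proof -
      have "9 * d \<le> d * d * d" using mult_le_mono[OF mult_le_mono[OF d d] order_refl[of d]] by simp
      moreover have "2 * (2 * d) + 1 \<le> 9 * d" using d by linarith
      ultimately show ?thesis using d3 unfolding power3_eq_cube by linarith
    qed
    hence dn': "d \<le> 3 ^ n" by linarith
    have kap: "real p ^ 4 * (real n)\<^sup>2 \<le> \<kappa> * real B"
    proof -
      have "real p \<le> Cp * (2 * lam)" using pl mult_left_mono[OF l2, of Cp] Cp0 by linarith
      hence "real p \<le> 2 * Cp * lam" by (simp add: mult_ac)
      hence "real p ^ 4 * (real n)\<^sup>2 \<le> (2 * Cp * lam) ^ 4 * (Cn * lam)\<^sup>2"
        using nl by (intro mult_mono power_mono) auto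
      also have "\<dots> = \<kappa> * lam ^ 6"
        by (simp add: \<kappa>_def power_mult_distrib power_add[symmetric])
      also have "lam ^ 6 = lam powr 6" using powr_realpow[of lam 6] lam by simp
      also have "lam powr 6 \<le> lam powr 6.5" using lam by (intro powr_mono) auto
      also have "\<dots> \<le> real B" using B by (simp add: lam_def)
      finally show ?thesis using \<kappa>0 by simp
    qed
    have "p \<le> 2 * n" using pn by simp
    thus ?thesis using p0 n0 p64 pB kap dn' dn pl nl unfolding l_def lam_def by blast
  qed
  thus ?thesis using \<kappa>0 Cn0 Cp0 by blast
qed

subsection \<open>Reduction to real vectors and counting\<close>

text \<open>A complex vector of length \<open>d\<close> is treated as the real vector of its \<open>d\<close> real and \<open>d\<close> imaginary parts.\<close>

definition real_columns :: "nat \<Rightarrow> complex mat \<Rightarrow> nat \<Rightarrow> nat \<Rightarrow> complex" where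
  "real_columns d U r j = (if j < d then U $$ (r, j) else \<i> * U $$ (r, j - d))"

definition real_parts :: "nat \<Rightarrow> complex vec \<Rightarrow> nat \<Rightarrow> real" where
  "real_parts d x j = (if j < d then Re (x $ j) else if j < 2 * d then Im (x $ (j - d)) else 0)"

lemma lin_real_columns:
  "lin (2 * d) (real_columns d U r) y = (\<Sum>j<d. U $$ (r, j) * Complex (y j) (y (d + j)))"
  unfolding lin_def sum_double sum.distrib[symmetric]
  by (rule sum.cong) (auto simp: real_columns_def complex_eq_iff)

lemma unitary_columns:
  assumes d: "0 < d" and U: "U \<in> carrier_mat d d" and V: "unitary_mat d (complex_of_real (1 / sqrt (real d)) \<cdot>\<^sub>m U)"
    and jl: "j < d" "l < d"
  shows "(\<Sum>r<d. cnj (U $$ (r, j)) * U $$ (r, l)) = (if j = l then of_nat d else 0)"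
proof -
  define V where "V = complex_of_real (1 / sqrt (real d)) \<cdot>\<^sub>m U"
  have Vc: "V \<in> carrier_mat d d" using U by (simp add: V_def)
  have e: "V $$ (r, i) = complex_of_real (1 / sqrt (real d)) * U $$ (r, i)" if "r < d" "i < d" for r i
    using that U by (simp add: V_def)
  have "(mat_adjoint V * V) $$ (j, l) = (\<Sum>r<d. cnj (V $$ (r, j)) * V $$ (r, l))"
    using Vc jl by (simp add: mat_adjoint_def mat_of_rows_def scalar_prod_def atLeast0LessThan)
  also have "\<dots> = (\<Sum>r<d. complex_of_real (1 / real d) * (cnj (U $$ (r, j)) * U $$ (r, l)))"
  proof (rule sum.cong[OF refl])
    fix r assume "r \<in> {..<d}"
    hence r: "r < d" by simp
    have "complex_of_real (1 / real d) = complex_of_real (1 / sqrt (real d)) * complex_of_real (1 / sqrt (real d))"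
      unfolding of_real_mult[symmetric] by simp
    thus "cnj (V $$ (r, j)) * V $$ (r, l) = complex_of_real (1 / real d) * (cnj (U $$ (r, j)) * U $$ (r, l))"
      unfolding e[OF r jl(1)] e[OF r jl(2)] complex_cnj_mult complex_cnj_complex_of_real by (simp only: mult_ac)
  qed
  also have "\<dots> = complex_of_real (1 / real d) * (\<Sum>r<d. cnj (U $$ (r, j)) * U $$ (r, l))"
    by (simp only: sum_distrib_left)
  also have "(mat_adjoint V * V) $$ (j, l) = (if j = l then 1 else 0)"
    using V jl by (simp add: unitary_mat_def V_def)
  finally have "(if j = l then 1 else 0) = complex_of_real (1 / real d) * (\<Sum>r<d. cnj (U $$ (r, j)) * U $$ (r, l))" .
  thus ?thesis using d by (auto simp: field_simps)
qed

lemma unitary_isometry: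
  assumes d: "0 < d" and U: "U \<in> carrier_mat d d" and V: "unitary_mat d (complex_of_real (1 / sqrt (real d)) \<cdot>\<^sub>m U)"
  shows "(\<Sum>r<d. (cmod (\<Sum>j<d. U $$ (r, j) * z j))\<^sup>2) = real d * (\<Sum>j<d. (cmod (z j))\<^sup>2)"
proof -
  have "complex_of_real (\<Sum>r<d. (cmod (\<Sum>j<d. U $$ (r, j) * z j))\<^sup>2)
      = (\<Sum>r<d. \<Sum>l<d. \<Sum>j<d. (z l * cnj (z j)) * (cnj (U $$ (r, j)) * U $$ (r, l)))"
    unfolding of_real_sum complex_norm_square cnj_sum sum_product complex_cnj_mult
    by (intro sum.cong refl) (simp only: mult_ac)
  also have "\<dots> = (\<Sum>l<d. \<Sum>r<d. \<Sum>j<d. (z l * cnj (z j)) * (cnj (U $$ (r, j)) * U $$ (r, l)))"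
    by (rule sum.swap)
  also have "\<dots> = (\<Sum>l<d. \<Sum>j<d. \<Sum>r<d. (z l * cnj (z j)) * (cnj (U $$ (r, j)) * U $$ (r, l)))"
    by (rule sum.cong[OF refl], rule sum.swap)
  also have "\<dots> = (\<Sum>l<d. \<Sum>j<d. (z l * cnj (z j)) * (if j = l then of_nat d else 0))"
    unfolding sum_distrib_left[symmetric] by (intro sum.cong refl) (simp add: unitary_columns[OF d U V])
  also have "\<dots> = (\<Sum>l<d. of_nat d * (z l * cnj (z l)))"
    by (intro sum.cong refl) (simp add: if_distrib cong: if_cong)
  also have "\<dots> = complex_of_real (real d * (\<Sum>j<d. (cmod (z j))\<^sup>2))"
    by (simp only: of_real_mult of_real_of_nat_eq of_real_sum complex_norm_square sum_distrib_left)
  finally show ?thesis by (simp only: of_real_eq_iff)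
qed

text \<open>Under the real inner product a column is orthogonal to its multiple by the imaginary
  unit, so the isometry of \<open>U\<close> on complex vectors is one on their real
  coordinates.\<close>

lemma bounded_orthonormal_real_columns:
  assumes d: "0 < d" "0 < n" and U: "U \<in> carrier_mat d d" and V: "unitary_mat d (complex_of_real (1 / sqrt (real d)) \<cdot>\<^sub>m U)"
    and le: "\<forall>i<d. \<forall>j<d. cmod (U $$ (i, j)) \<le> 1" and n: "d \<le> 3 ^ n" "2 * (2 * d) + 1 \<le> 3 ^ n"
  shows "bounded_orthonormal (2 * d) d n (real_columns d U)"
proof
  show "cmod (real_columns d U r j) \<le> 1" if "r < d" "j < 2 * d" for r j
    using that le by (auto simp: real_columns_def norm_mult)
  show "(\<Sum>r<d. (cmod (lin (2 * d) (real_columns d U r) y))\<^sup>2) = real d * (\<Sum>j<2 * d. (y j)\<^sup>2)" for y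
    unfolding lin_real_columns unitary_isometry[OF d(1) U V] sum_double
    by (simp add: cmod_power2 sum.distrib)
qed (use d n in auto)

text \<open>A nonzero complex entry has at most two nonzero real parts. The minimum with
  \<open>d\<close> bounds the sparsity by the dimension, as the choice of parameters
  requires.\<close>

lemma real_parts_sparse:
  assumes x: "x \<in> sparse_vecs d k"
  shows "real_parts d x \<in> sparse_ball (2 * d) (2 * min k d)" "(\<Sum>j<2 * d. (real_parts d x j)\<^sup>2) = (l2_norm x)\<^sup>2"
    "lin (2 * d) (real_columns d U r) (real_parts d x) = (\<Sum>j<d. U $$ (r, j) * x $ j)"
proof -
  have dx: "dim_vec x = d" and l0: "l0_norm x \<le> k" and l2: "l2_norm x \<le> 1" using x by (auto simp: sparse_vecs_def)
  have l20: "0 \<le> l2_norm x" by (simp add: l2_norm_def)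
  have "(\<Sum>j<2 * d. (real_parts d x j)\<^sup>2) = (\<Sum>j<d. (cmod (x $ j))\<^sup>2)"
    unfolding sum_double sum.distrib[symmetric] by (rule sum.cong) (auto simp: real_parts_def cmod_power2)
  also have "\<dots> = (l2_norm x)\<^sup>2" by (simp add: l2_norm_def L2_set_def dx sum_nonneg)
  finally show s: "(\<Sum>j<2 * d. (real_parts d x j)\<^sup>2) = (l2_norm x)\<^sup>2" .
  let ?A = "{l. l < dim_vec x \<and> x $ l \<noteq> 0}"
  have fA: "finite ?A" by simp
  have "card ?A \<le> card {..<d}" using dx by (intro card_mono) auto
  hence cA: "card ?A \<le> min k d" using l0 by (simp add: l0_norm_def)
  have "{j. real_parts d x j \<noteq> 0} \<subseteq> ?A \<union> (\<lambda>l. l + d) ` ?A"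
  proof
    fix j assume j: "j \<in> {j. real_parts d x j \<noteq> 0}"
    show "j \<in> ?A \<union> (\<lambda>l. l + d) ` ?A"
    proof (cases "j < d")
      case True
      thus ?thesis using j dx by (auto simp: real_parts_def)
    next
      case False
      hence "j = (j - d) + d" "j - d \<in> ?A" using j dx by (auto simp: real_parts_def split: if_splits)
      thus ?thesis by blast
    qed
  qed
  hence "card {j. real_parts d x j \<noteq> 0} \<le> card (?A \<union> (\<lambda>l. l + d) ` ?A)"
    using fA by (intro card_mono) auto
  also have "\<dots> \<le> card ?A + card ((\<lambda>l. l + d) ` ?A)" by (rule card_Un_le)
  also have "\<dots> \<le> card ?A + card ?A" using card_image_le[OF fA] by simp
  also have "\<dots> \<le> 2 * min k d" using cA by linarith
  finally have "card {j. real_parts d x j \<noteq> 0} \<le> 2 * min k d" .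
  moreover have "(l2_norm x)\<^sup>2 \<le> 1" using l20 l2 by (simp add: power_le_one)
  ultimately show "real_parts d x \<in> sparse_ball (2 * d) (2 * min k d)"
    unfolding sparse_ball_def using s by (auto simp: real_parts_def)
  show "lin (2 * d) (real_columns d U r) (real_parts d x) = (\<Sum>j<d. U $$ (r, j) * x $ j)"
    unfolding lin_real_columns by (intro sum.cong refl) (simp add: real_parts_def)
qed

section \<open>From counting to probability\<close>

lemma pair_pmf_of_set:
  assumes "finite A" "A \<noteq> {}" "finite B" "B \<noteq> {}"
  shows "pair_pmf (pmf_of_set A) (pmf_of_set B) = pmf_of_set (A \<times> B)"
proof (rule pmf_eqI)
  fix z
  show "pmf (pair_pmf (pmf_of_set A) (pmf_of_set B)) z = pmf (pmf_of_set (A \<times> B)) z"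
    using assms by (cases z) (simp add: pmf_pair indicator_def card_cartesian_product)
qed

definition block_matrix :: "nat \<Rightarrow> nat \<Rightarrow> nat \<Rightarrow> complex mat \<Rightarrow> (nat \<Rightarrow> nat) \<times> (nat \<times> nat \<Rightarrow> complex) \<Rightarrow> complex mat" where
  "block_matrix m B d U = (\<lambda>(t, \<sigma>). signed_block_sums m B (mat\<^sub>r (m * B) d (\<lambda>j. Matrix.row U (t j))) \<sigma>)"

text \<open>Independent uniform choices from finite sets form one uniform choice from the product,
  so probabilities become proportions.\<close>

lemma signed_block_law:
  assumes "0 < d"
  shows "signed_block_construction (bounded_orthogonal_ensemble d U (m * B)) m B =
    map_pmf (block_matrix m B d U)
      (pmf_of_set (PiE_dflt {..<m * B} 0 (\<lambda>_. {..<d}) \<times> PiE_dflt ({..<m} \<times> {..<B}) 0 (\<lambda>_. {1, -1})))"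
proof -
  let ?T = "PiE_dflt {..<m * B} 0 (\<lambda>_. {..<d})"
  let ?S = "PiE_dflt ({..<m} \<times> {..<B}) 0 (\<lambda>_. {1, -1 :: complex})"
  have "(\<lambda>i. if i < m * B then 0 else 0) \<in> ?T" using assms by (auto simp: PiE_dflt_def)
  hence T: "finite ?T" "?T \<noteq> {}" by - (rule finite_PiE_dflt[OF finite_lessThan finite_lessThan], blast)
  have "(\<lambda>k. if k \<in> {..<m} \<times> {..<B} then 1 else 0) \<in> ?S" by (auto simp: PiE_dflt_def)
  hence S: "finite ?S" "?S \<noteq> {}" by (auto intro!: finite_PiE_dflt)
  have 1: "Pi_pmf {..<m * B} 0 (\<lambda>_. pmf_of_set {..<d}) = pmf_of_set ?T"
  proof (intro Pi_pmf_of_set)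
    have "0 \<in> {..<d}" using assms by simp
    thus "{..<d} \<noteq> {}" by blast
  qed auto
  have 2: "uniform_signs m B = pmf_of_set ?S"
    unfolding uniform_signs_def by (intro Pi_pmf_of_set) auto
  show ?thesis
    unfolding signed_block_construction_def bounded_orthogonal_ensemble_def 1 2 pair_map_pmf1
      pair_pmf_of_set[OF T S] pmf.map_comp
    by (rule arg_cong[where f = "\<lambda>f. map_pmf f _"]) (auto simp: fun_eq_iff block_matrix_def)
qed

text \<open>\<open>t'\<close> and \<open>\<sigma>\<close> may differ from \<open>t\<close> and the
  signs of \<open>X\<close> outside the index sets, where the counting spaces and the probability
  spaces use different default values.\<close>

lemma block_matrix_isometry:
  fixes t :: "nat \<Rightarrow> nat" and \<epsilon> :: real
  assumes mB: "0 < m" "0 < B" and U: "U \<in> carrier_mat d d" and t: "\<And>j. j < m * B \<Longrightarrow> t j < d"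
    and iso: "\<forall>x\<in>sparse_ball (2 * d) (2 * min k d).
      \<bar>(\<Sum>b<m. (cmod (\<Sum>i<B. complex_of_real (eps X (b, i)) * lin (2 * d) (real_columns d U (t (B * b + i))) x))\<^sup>2)
        - real (m * B) * (\<Sum>j<2 * d. (x j)\<^sup>2)\<bar> \<le> \<epsilon> * real (m * B)"
    and t': "\<And>j. j < m * B \<Longrightarrow> t' j = t j"
    and \<sigma>: "\<And>b i. b < m \<Longrightarrow> i < B \<Longrightarrow> \<sigma> (b, i) = complex_of_real (eps X (b, i))"
  shows "(SUP x\<in>sparse_vecs d k. \<bar>1 / real (m * B) * (l2_norm (block_matrix m B d U (t', \<sigma>) *\<^sub>v x))\<^sup>2 - (l2_norm x)\<^sup>2\<bar>) \<le> \<epsilon>"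
proof (rule cSUP_least)
  show "sparse_vecs d k \<noteq> {}" using zero_in_sparse_vecs by blast
  fix x assume x: "x \<in> sparse_vecs d k"
  define \<Phi> where "\<Phi> = block_matrix m B d U (t', \<sigma>)"
  have dx: "dim_vec x = d" using x by (auto simp: sparse_vecs_def)
  have dim: "dim_row \<Phi> = m" "dim_col \<Phi> = d" by (simp_all add: \<Phi>_def block_matrix_def signed_block_sums_def)
  have idx: "B * b + i < m * B" if "b < m" "i < B" for b i
  proof -
    have "B * b + i \<in> blk B b" using that by (simp add: blk_def mult.commute)
    thus ?thesis using blk_subset[OF that(1), of B] by auto
  qed
  have entry: "\<Phi> $$ (b, l) = (\<Sum>i<B. complex_of_real (eps X (b, i)) * U $$ (t (B * b + i), l))" if b: "b < m" and l: "l < d" for b l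
  proof -
    have "\<Phi> $$ (b, l) = (\<Sum>i<B. \<sigma> (b, i) * mat\<^sub>r (m * B) d (\<lambda>j. Matrix.row U (t' j)) $$ (B * b + i, l))"
      using b l by (simp add: \<Phi>_def block_matrix_def signed_block_sums_def block_index_def)
    also have "\<dots> = (\<Sum>i<B. complex_of_real (eps X (b, i)) * U $$ (t (B * b + i), l))"
      using idx[OF b] t U l by (intro sum.cong refl) (simp add: \<sigma>[OF b] t')
    finally show ?thesis .
  qed
  have coord: "(\<Phi> *\<^sub>v x) $ b = (\<Sum>i<B. complex_of_real (eps X (b, i)) * lin (2 * d) (real_columns d U (t (B * b + i))) (real_parts d x))"
    if b: "b < m" for b
  proof -
    have "(\<Phi> *\<^sub>v x) $ b = (\<Sum>l<d. \<Phi> $$ (b, l) * x $ l)"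
      using b dim dx by (simp add: scalar_prod_def atLeast0LessThan)
    also have "\<dots> = (\<Sum>l<d. \<Sum>i<B. complex_of_real (eps X (b, i)) * (U $$ (t (B * b + i), l) * x $ l))"
      using b by (intro sum.cong refl) (simp add: entry sum_distrib_right mult.assoc)
    also have "\<dots> = (\<Sum>i<B. \<Sum>l<d. complex_of_real (eps X (b, i)) * (U $$ (t (B * b + i), l) * x $ l))"
      by (rule sum.swap)
    finally show ?thesis unfolding real_parts_sparse(3)[OF x] sum_distrib_left .
  qed
  have "(l2_norm (\<Phi> *\<^sub>v x))\<^sup>2 = (\<Sum>b<m. (cmod ((\<Phi> *\<^sub>v x) $ b))\<^sup>2)"
    using dim by (simp add: l2_norm_def L2_set_def sum_nonneg)
  also have "\<dots> = (\<Sum>b<m. (cmod (\<Sum>i<B. complex_of_real (eps X (b, i)) * lin (2 * d) (real_columns d U (t (B * b + i))) (real_parts d x)))\<^sup>2)"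
    by (intro sum.cong refl) (simp add: coord)
  finally have "\<bar>(l2_norm (\<Phi> *\<^sub>v x))\<^sup>2 - real (m * B) * (l2_norm x)\<^sup>2\<bar> \<le> \<epsilon> * real (m * B)"
    using bspec[OF iso real_parts_sparse(1)[OF x]] real_parts_sparse(2)[OF x] by (simp only:)
  moreover have "\<bar>1 / real (m * B) * (l2_norm (\<Phi> *\<^sub>v x))\<^sup>2 - (l2_norm x)\<^sup>2\<bar>
      = \<bar>(l2_norm (\<Phi> *\<^sub>v x))\<^sup>2 - real (m * B) * (l2_norm x)\<^sup>2\<bar> / real (m * B)"
  proof -
    have M: "0 < real (m * B)" using mB by simp
    have "1 / real (m * B) * (l2_norm (\<Phi> *\<^sub>v x))\<^sup>2 - (l2_norm x)\<^sup>2
      = ((l2_norm (\<Phi> *\<^sub>v x))\<^sup>2 - real (m * B) * (l2_norm x)\<^sup>2) / real (m * B)"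
      using mB by (simp add: diff_divide_distrib)
    thus ?thesis using M by (simp only: abs_divide abs_of_pos)
  qed
  ultimately show "\<bar>1 / real (m * B) * (l2_norm (block_matrix m B d U (t', \<sigma>) *\<^sub>v x))\<^sup>2 - (l2_norm x)\<^sup>2\<bar> \<le> \<epsilon>"
    using mB by (simp add: \<Phi>_def pos_divide_le_eq)
qed

lemma prob_of_counting:
  fixes U :: "complex mat" and \<epsilon> :: real
  assumes d: "0 < d" and mB: "0 < m" "0 < B" and U: "U \<in> carrier_mat d d"
  defines "\<Omega> \<equiv> PiE {..<m * B} (\<lambda>_. {..<d})" and "\<Sigma> \<equiv> Pow ({..<m} \<times> {..<B})"
  assumes count: "3 / 4 * real (card (\<Omega> \<times> \<Sigma>)) \<le> real (card {(t, X) \<in> \<Omega> \<times> \<Sigma>. \<forall>x\<in>sparse_ball (2 * d) (2 * min k d).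
    \<bar>(\<Sum>b<m. (cmod (\<Sum>i<B. complex_of_real (eps X (b, i)) * lin (2 * d) (real_columns d U (t (B * b + i))) x))\<^sup>2)
      - real (m * B) * (\<Sum>j<2 * d. (x j)\<^sup>2)\<bar> \<le> \<epsilon> * real (m * B)})"
    (is "_ \<le> real (card ?R)")
  shows "measure_pmf.prob (signed_block_construction (bounded_orthogonal_ensemble d U (m * B)) m B)
    {\<Phi>. (SUP x\<in>sparse_vecs d k. \<bar>1 / real (m * B) * (l2_norm (\<Phi> *\<^sub>v x))\<^sup>2 - (l2_norm x)\<^sup>2\<bar>) \<le> \<epsilon>} \<ge> 3 / 4"
    (is "measure_pmf.prob _ ?E \<ge> _")
proof -
  let ?T = "PiE_dflt {..<m * B} 0 (\<lambda>_. {..<d})"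
  let ?S = "PiE_dflt ({..<m} \<times> {..<B}) 0 (\<lambda>_. {1, -1 :: complex})"
  have fin: "finite (?T \<times> ?S)" by (auto intro!: finite_PiE_dflt)
  have cardT: "card ?T = d ^ (m * B)" by (subst card_PiE_dflt) auto
  have cardS: "card ?S = 2 ^ (m * B)" by (subst card_PiE_dflt) (auto simp: card_cartesian_product numeral_2_eq_2)
  have card\<Omega>: "card \<Omega> = d ^ (m * B)" unfolding \<Omega>_def by (subst card_PiE) auto
  have card\<Sigma>: "card \<Sigma> = 2 ^ (m * B)" unfolding \<Sigma>_def by (subst card_Pow) (auto simp: card_cartesian_product)
  have cc: "card (?T \<times> ?S) = card (\<Omega> \<times> \<Sigma>)"
    by (simp only: card_cartesian_product cardT cardS card\<Omega> card\<Sigma>)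
  have c0: "0 < card (?T \<times> ?S)" using d by (simp add: card_cartesian_product cardT cardS)
  hence ne: "?T \<times> ?S \<noteq> {}" by (metis card.empty less_irrefl)
  \<comment> \<open>Extensional functions and sets are sent to functions with default 0. Both spaces
    have \<open>d ^ (m * B) * 2 ^ (m * B)\<close> elements, so injectivity is enough to carry the
    proportion over.\<close>
  define g where "g = (\<lambda>(t :: nat \<Rightarrow> nat, X). ((\<lambda>j. if j < m * B then t j else 0),
     (\<lambda>k. if k \<in> {..<m} \<times> {..<B} then complex_of_real (eps X k) else 0)))"
  have inj: "inj_on g (\<Omega> \<times> \<Sigma>)"
  proof (rule inj_onI, clarify)
    fix t X t' X' assume a: "t \<in> \<Omega>" "t' \<in> \<Omega>" "X \<in> \<Sigma>" "X' \<in> \<Sigma>" "g (t, X) = g (t', X')"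
    have "t j = t' j" for j
    proof (cases "j < m * B")
      case True
      thus ?thesis using a(5) by (auto simp: g_def fun_eq_iff) metis
    next
      case False
      thus ?thesis using a(1,2) by (auto simp: \<Omega>_def PiE_iff extensional_def)
    qed
    moreover have "k \<in> X \<longleftrightarrow> k \<in> X'" for k
    proof (cases "k \<in> {..<m} \<times> {..<B}")
      case True
      have "snd (g (t, X)) k = snd (g (t', X')) k" using a(5) by simp
      hence "eps X k = eps X' k" using True by (simp add: g_def)
      thus ?thesis by (auto simp: eps_def split: if_splits)
    next
      case False
      thus ?thesis using a(3,4) by (auto simp: \<Sigma>_def)
    qed
    ultimately show "t = t' \<and> X = X'" by auto
  qed
  have sub: "g ` ?R \<subseteq> (?T \<times> ?S) \<inter> block_matrix m B d U -` ?E"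
  proof
    fix q assume "q \<in> g ` ?R"
    then obtain t X where tX: "(t, X) \<in> ?R" "q = g (t, X)" by auto
    have td: "t j < d" if "j < m * B" for j using tX(1) that by (auto simp: \<Omega>_def PiE_iff)
    have "q \<in> ?T \<times> ?S" using td unfolding tX(2) g_def by (auto simp: PiE_dflt_def eps_def)
    moreover have "block_matrix m B d U q \<in> ?E"
      unfolding tX(2) g_def mem_Collect_eq prod.case
      by (rule block_matrix_isometry[OF mB U td]) (use tX(1) in auto)
    ultimately show "q \<in> (?T \<times> ?S) \<inter> block_matrix m B d U -` ?E" by simp
  qed
  have "card ?R = card (g ` ?R)" by (rule card_image[symmetric], rule inj_on_subset[OF inj]) auto
  also have "\<dots> \<le> card ((?T \<times> ?S) \<inter> block_matrix m B d U -` ?E)"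
    using fin sub by (intro card_mono) auto
  finally have "3 / 4 * real (card (?T \<times> ?S)) \<le> real (card ((?T \<times> ?S) \<inter> block_matrix m B d U -` ?E))"
    using count unfolding cc by linarith
  moreover have "measure_pmf.prob (signed_block_construction (bounded_orthogonal_ensemble d U (m * B)) m B) ?E
     = real (card ((?T \<times> ?S) \<inter> block_matrix m B d U -` ?E)) / real (card (?T \<times> ?S))"
    unfolding signed_block_law[OF d] measure_map_pmf by (rule measure_pmf_of_set[OF ne fin])
  ultimately show ?thesis using c0 by (simp only: pos_le_divide_eq of_nat_0_less_iff)
qed

theorem theorem2:
  fixes c :: real
  assumes "c \<ge> 6.5"
  shows "\<exists>C::real. \<forall>(\<epsilon>::real) (d::nat) (k::nat) (B::nat) (U::complex mat).
           0 < \<epsilon> \<longrightarrow> \<epsilon> < 1 \<longrightarrow> 0 < d \<longrightarrow> 0 < k \<longrightarrow> 0 < B \<longrightarrow>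
           ln (real d) powr 6.5 \<le> real B \<longrightarrow> real B \<le> ln (real d) powr c \<longrightarrow>
           U \<in> carrier_mat d d \<longrightarrow>
           unitary_mat d (complex_of_real (1 / sqrt (real d)) \<cdot>\<^sub>m U) \<longrightarrow>
           (\<forall>i<d. \<forall>j<d. cmod (U $$ (i, j)) \<le> 1) \<longrightarrow>
           (\<exists>m::nat. 0 < m \<and>
              real m \<le> C / \<epsilon>\<^sup>2 * real k * ln (real d) * (ln (real k * ln (real d)))\<^sup>2 \<and>
              (real k \<ge> ln (real m) powr 2.5 \<longrightarrow>
                 measure_pmf.prob
                   (signed_block_construction (bounded_orthogonal_ensemble d U (m * B)) m B)
                   {\<Phi>. (SUP x\<in>sparse_vecs d k.
                          \<bar>1 / real (m * B) * (l2_norm (\<Phi> *\<^sub>v x))\<^sup>2 - (l2_norm x)\<^sup>2\<bar>) \<le> \<epsilon>}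
                 \<ge> 3 / 4))"
proof -
  have "1 \<le> c" using assms by simp
  from parameter_choice[OF this] obtain \<kappa> Cn Cp where \<kappa>: "0 < \<kappa>" and Cn: "0 < Cn" and Cp: "0 < Cp"
    and par: "\<And>d k B :: nat. 3 \<le> d \<Longrightarrow> 0 < k \<Longrightarrow> k \<le> d \<Longrightarrow> 0 < B \<Longrightarrow>
    ln (real d) powr 6.5 \<le> real B \<Longrightarrow> real B \<le> ln (real d) powr c \<Longrightarrow>
    (\<exists>p n. 0 < p \<and> 0 < n \<and> p \<le> 2 * n \<and> 64 * k \<le> 2 ^ p \<and> B * (2 * k) \<le> 2 ^ (p - 1) \<and>
      real p ^ 4 * (real n)\<^sup>2 \<le> \<kappa> * real B \<and> d \<le> 3 ^ n \<and> 2 * (2 * d) + 1 \<le> 3 ^ n \<and>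
      real p \<le> Cp * ln (real k * ln (real d)) \<and> real n \<le> Cn * ln (real d))"
    by blast
  define \<theta> where "\<theta> = sqrt (288 * 107495424 * \<kappa> + 41472 * 107495424\<^sup>2 * \<kappa>\<^sup>2)"
  have \<theta>: "0 < \<theta>" "\<theta>\<^sup>2 = 288 * 107495424 * \<kappa> + 41472 * 107495424\<^sup>2 * \<kappa>\<^sup>2"
    using \<kappa> by (auto simp: \<theta>_def intro!: add_pos_pos)
  define A where "A = 100000 * 107495424 * \<kappa> + (1600 * 5888 * (sqrt (130 * (18 + 32 * \<theta>)) + 20))\<^sup>2"
  have A: "0 < A" using \<kappa> by (auto simp: A_def intro!: add_pos_nonneg)
  \<comment> \<open>\<open>A + 1\<close> leaves room for rounding \<open>m\<close> up; the factor 2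
    is the doubled sparsity of the real coordinates.\<close>
  define C where "C = 2 * (A + 1) * Cn * Cp\<^sup>2"
  show ?thesis
  proof (intro exI[of _ C] allI impI)
    fix \<epsilon> :: real and d k B :: nat and U :: "complex mat"
    assume eps: "0 < \<epsilon>" "\<epsilon> < 1" and d: "0 < d" and k: "0 < k" and B: "0 < B"
      and B1: "ln (real d) powr 6.5 \<le> real B" and B2: "real B \<le> ln (real d) powr c"
      and U: "U \<in> carrier_mat d d" and V: "unitary_mat d (complex_of_real (1 / sqrt (real d)) \<cdot>\<^sub>m U)"
      and le: "\<forall>i<d. \<forall>j<d. cmod (U $$ (i, j)) \<le> 1"
    \<comment> \<open>A positive integer \<open>B\<close> below a positive power of ln d forces ln d
      to be at least 1, so degenerate dimensions do not occur.\<close>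
    have lam1: "1 \<le> ln (real d)"
    proof (rule ccontr)
      assume "\<not> 1 \<le> ln (real d)"
      moreover have "0 \<le> ln (real d)" using d by simp
      ultimately have "ln (real d) powr c < 1 powr c" using assms by (intro powr_less_mono2) auto
      thus False using B B2 by simp
    qed
    have d3: "3 \<le> d"
    proof (rule ccontr)
      assume "\<not> 3 \<le> d"
      hence "real d \<le> 2" by simp
      hence "ln (real d) \<le> ln 2" using d by (subst ln_le_cancel_iff) auto
      thus False using lam1 ln_2_less_1 by linarith
    qed
    define k' where "k' = min k d"
    have k': "0 < k'" "k' \<le> d" "k' \<le> k" using k d by (auto simp: k'_def)
    obtain p n where pn: "0 < p" "0 < n" "p \<le> 2 * n" "64 * k' \<le> 2 ^ p" "B * (2 * k') \<le> 2 ^ (p - 1)"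
      "real p ^ 4 * (real n)\<^sup>2 \<le> \<kappa> * real B" "d \<le> 3 ^ n" "2 * (2 * d) + 1 \<le> 3 ^ n"
      "real p \<le> Cp * ln (real k' * ln (real d))" "real n \<le> Cn * ln (real d)"
      using par[OF d3 k'(1,2) B B1 B2] by blast
    define N where "N = real (n * (2 * k') * p\<^sup>2)"
    have N1: "1 \<le> N" unfolding N_def using pn k' by (metis One_nat_def Suc_leI mult_pos_pos of_nat_1 of_nat_mono pos2 zero_less_power)
    define m where "m = nat \<lceil>A * N / \<epsilon>\<^sup>2\<rceil>"
    have e2: "0 < \<epsilon>\<^sup>2" "\<epsilon>\<^sup>2 \<le> 1" using eps by (auto simp: power_le_one)
    have q0: "0 < A * N / \<epsilon>\<^sup>2" using A N1 e2 by simp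
    have m_ge: "A * N / \<epsilon>\<^sup>2 \<le> real m" unfolding m_def by (rule real_nat_ceiling_ge)
    have m0: "0 < m" using m_ge q0 by (cases m) auto
    have m_le: "real m \<le> C / \<epsilon>\<^sup>2 * real k * ln (real d) * (ln (real k * ln (real d)))\<^sup>2"
    proof -
      have "real m \<le> A * N / \<epsilon>\<^sup>2 + 1" unfolding m_def using q0 by linarith
      also have "1 \<le> N / \<epsilon>\<^sup>2" using e2 N1 by (simp add: pos_le_divide_eq)
      also have "A * N / \<epsilon>\<^sup>2 + N / \<epsilon>\<^sup>2 = (A + 1) * N / \<epsilon>\<^sup>2" by (simp add: distrib_right add_divide_distrib)
      also have "\<dots> \<le> (A + 1) * ((Cn * ln (real d)) * (2 * real k) * (Cp * ln (real k * ln (real d)))\<^sup>2) / \<epsilon>\<^sup>2"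
      proof (intro divide_right_mono mult_left_mono)
        have "real k' * ln (real d) \<le> real k * ln (real d)" using k' lam1 by (intro mult_right_mono) auto
        moreover have "0 < real k' * ln (real d)" by (rule mult_pos_pos) (use k'(1) lam1 in linarith)+
        ultimately have "ln (real k' * ln (real d)) \<le> ln (real k * ln (real d))"
          by (subst ln_le_cancel_iff) linarith+
        hence "Cp * ln (real k' * ln (real d)) \<le> Cp * ln (real k * ln (real d))" using Cp by (intro mult_left_mono) auto
        hence "real p \<le> Cp * ln (real k * ln (real d))" using pn(9) by linarith
        hence "real n * (2 * real k') * (real p)\<^sup>2 \<le> (Cn * ln (real d)) * (2 * real k) * (Cp * ln (real k * ln (real d)))\<^sup>2"
          using pn(10) k' Cn lam1 by (intro mult_mono power_mono) auto
        thus "N \<le> (Cn * ln (real d)) * (2 * real k) * (Cp * ln (real k * ln (real d)))\<^sup>2" by (simp add: N_def)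
      qed (use A e2 in auto)
      also have "\<dots> = C / \<epsilon>\<^sup>2 * real k * ln (real d) * (ln (real k * ln (real d)))\<^sup>2"
        by (simp add: C_def power_mult_distrib)
      finally show ?thesis by simp
    qed
    interpret bounded_orthonormal "2 * d" d n "real_columns d U"
      by (rule bounded_orthonormal_real_columns[OF d pn(2) U V le pn(7,8)])
    have mA: "A * real (n * (2 * k') * p\<^sup>2) \<le> \<epsilon>\<^sup>2 * real m"
      using m_ge e2 unfolding N_def[symmetric] by (simp only: pos_divide_le_eq mult.commute)
    have S: "32 * (2 * k') \<le> 2 ^ p" using pn(4) by simp
    have K: "0 < 2 * k'" using k' by simp
    \<comment> \<open>The depth \<open>S\<close> of the net is taken equal to
      \<open>p\<close>.\<close>
    note count = signed_block_isometry[OF m0 B K pn(1) pn(1) S order_refl pn(3) pn(5) pn(6) \<theta> eps mA[unfolded A_def]]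
    have "measure_pmf.prob (signed_block_construction (bounded_orthogonal_ensemble d U (m * B)) m B)
        {\<Phi>. (SUP x\<in>sparse_vecs d k. \<bar>1 / real (m * B) * (l2_norm (\<Phi> *\<^sub>v x))\<^sup>2 - (l2_norm x)\<^sup>2\<bar>) \<le> \<epsilon>} \<ge> 3 / 4"
      by (rule prob_of_counting[OF d m0 B U count[unfolded k'_def]])
    thus "\<exists>m::nat. 0 < m \<and>
              real m \<le> C / \<epsilon>\<^sup>2 * real k * ln (real d) * (ln (real k * ln (real d)))\<^sup>2 \<and>
              (real k \<ge> ln (real m) powr 2.5 \<longrightarrow>
                 measure_pmf.prob
                   (signed_block_construction (bounded_orthogonal_ensemble d U (m * B)) m B)
                   {\<Phi>. (SUP x\<in>sparse_vecs d k.
                          \<bar>1 / real (m * B) * (l2_norm (\<Phi> *\<^sub>v x))\<^sup>2 - (l2_norm x)\<^sup>2\<bar>) \<le> \<epsilon>}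
                 \<ge> 3 / 4)"
      using m0 m_le by blast
  qed
qed

end
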